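(* Let $\{X_n, n\in\mathbb{N}\}$ be a stationary sequence of associated random variables with $X_1\sim F$ and $P(|X_1|\le C_1)=1$ for some $0<C_1<\infty$. Let $\rho:\mathbb{R}^2\to\mathbb{R}$ be a symmetric kernel which is bounded, i.e. $|\rho(x,y)|\le C_2$ for some $C_2<\infty$ and all $x,y\in\mathbb{R}$, and let $U_n(\rho)=\binom n2^{-1}\sum_{1\le j_1<j_2\le n}\rho(X_{j_1},X_{j_2})$. Put $\theta=\int\int\rho(x,y)\,dF(x)\,dF(y)$, $\rho_1(x)=\int_{\mathbb{R}}\rho(x,y)\,dF(y)$, $\sigma_1^2=Var(\rho_1(X_1))$ and $\sigma_{1j}=Cov(\rho_1(X_1),\rho_1(X_{1+j}))$ for $j\in\mathbb{N}$. Assume: (i) $\sum_{j=1}^\infty Cov(X_1,X_j)^{1/21}<\infty$; (ii) the density/characteristic function conditions (T1) and (T2) given in the context hold; (iii) $\sigma_1^2<\infty$ and $\sum_{j=1}^\infty|\sigma_{1j}|<\infty$. Then $$Var(U_n(\rho))=\frac{4\sigma_U^2}{n}+o\Big(\frac1n\Big),\qquad \sigma_U^2=\sigma_1^2+2\sum_{j=1}^\infty\sigma_{1j}.$$ Further, if $\sigma_U^2>0$ and there exists a function $\tilde\rho_1:\mathbb{R}\to\mathbb{R}$ such that $\rho_1\ll\tilde\rho_1$ and $\sum_{j=1}^\infty Cov(\tilde\rho_1(X_1),\tilde\rho_1(X_j))<\infty$, then $$\frac{\sqrt n\,(U_n(\rho)-\theta)}{2\sigma_U}\xrightarrow{\mathcal{L}}N(0,1)\quad\text{as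 } n\to\infty.$$
   Context: A finite collection $\{X_j,1\le j\le n\}$ of random variables is associated if for all component-wise non-decreasing $h,g:\mathbb{R}^n\to\mathbb{R}$, $Cov(h(X_1,\ldots,X_n),g(X_1,\ldots,X_n))\ge0$ whenever it exists; an infinite collection is associated if every finite sub-collection is. For real-valued functions $f,\tilde f$ on $\mathbb{R}^n$, $f\ll\tilde f$ means that $\tilde f+f$ and $\tilde f-f$ are both coordinate-wise non-decreasing. The probability density function $f_{\mathbf Z}$ of a random vector $\mathbf Z\in\mathbb{R}^k$ satisfies a Lipschitz condition of order 1 if, for every $\mathbf x,\mathbf u\in\mathbb{R}^k$ and some finite constant $C>0$, $|f_{\mathbf Z}(\mathbf x+\mathbf u)-f_{\mathbf Z}(\mathbf x)|\le C\sum_{j=1}^k|u_j|$. $\{X_n',n\in\mathbb{N}\}$ is a sequence of i.i.d. random variables, independent of $\{X_n\}$, with $X_1'\sim F$. (T1) For all distinct $i_1,i_2,i_3,i_4$ with $1\le i_1<i_2\le n$ and $1\le i_3<i_4\le n$ (for all $n$), the densities of each of the vectors $(X_{i_1},X_{i_2},X_{i_3},X_{i_4})$, $(X_{i_1}',X_{i_2},X_{i_3},X_{i_4})$, $(X_{i_1},X_{i_2}',X_{i_3},X_{i_4})$, $(X_{i_1},X_{i_2},X_{i_3}',X_{i_4})$ are bounded and satisfy the Lipschitz condition of order 1, and the characteristic functions of these vectors are absolutely integrable. (T2) For any 3 distinct indices $i,j,k$ from $(i_1,i_2,i_3,i_4)$ with $1\le i_1<i_2\le n$, $1\le i_3<i_4\le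 n$ (for all $n$), the densities of $(X_i,X_j,X_k)$ and $(X_i',X_j,X_k)$ are bounded and satisfy the Lipschitz condition of order 1, and their characteristic functions are absolutely integrable.
   Formalization: In (T1) and (T2) the Lipschitz constant C is taken to be the same for all choices of indices; if it may depend on the indices, the variance expansion can fail. *)

theory Defs
  imports "HOL-Probability.Probability"
begin

text \<open>Sequences of random variables are functions \<open>nat \<Rightarrow> 'a \<Rightarrow> real\<close> of which only the
  indices \<open>1, 2, \<dots>\<close> are used. A distribution function \<open>F\<close> is represented by the
  corresponding Borel measure on the real line, so that integration \<open>dF\<close> is
  Lebesgue integration with respect to that measure.\<close>

definition covariance :: "'a measure \<Rightarrow> ('a \<Rightarrow> real) \<Rightarrow> ('a \<Rightarrow> real) \<Rightarrow> real" where
  "covariance M Y Z =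
     (LINT w|M. (Y w - prob_space.expectation M Y) * (Z w - prob_space.expectation M Z))"

text \<open>A function on \<open>\<real>\<^sup>J\<close> is represented by a function on all families of
  reals. Applying the condition below to families that agree on \<open>J\<close> shows that such
  an \<open>h\<close> depends on the coordinates in \<open>J\<close> only.\<close>

definition coordwise_nondecreasing :: "'i set \<Rightarrow> (('i \<Rightarrow> real) \<Rightarrow> real) \<Rightarrow> bool" where
  "coordwise_nondecreasing J h \<longleftrightarrow> (\<forall>x y. (\<forall>j\<in>J. x j \<le> y j) \<longrightarrow> h x \<le> h y)"

text \<open>The three integrability conditions say that the covariance exists; they include
  measurability, which is not automatic for coordinatewise monotone functions.\<close>

definition finitely_associated :: "'a measure \<Rightarrow> ('i \<Rightarrow> 'a \<Rightarrow> real) \<Rightarrow> 'i set \<Rightarrow> bool" where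
  "finitely_associated M X J \<longleftrightarrow>
     (\<forall>h g. coordwise_nondecreasing J h \<and> coordwise_nondecreasing J g \<and>
        integrable M (\<lambda>w. h (\<lambda>j. X j w)) \<and>
        integrable M (\<lambda>w. g (\<lambda>j. X j w)) \<and>
        integrable M (\<lambda>w. h (\<lambda>j. X j w) * g (\<lambda>j. X j w)) \<longrightarrow>
        covariance M (\<lambda>w. h (\<lambda>j. X j w)) (\<lambda>w. g (\<lambda>j. X j w)) \<ge> 0)"

definition associated :: "'a measure \<Rightarrow> ('i \<Rightarrow> 'a \<Rightarrow> real) \<Rightarrow> 'i set \<Rightarrow> bool" where
  "associated M X I \<longleftrightarrow> (\<forall>J. finite J \<and> J \<subseteq> I \<longrightarrow> finitely_associated M X J)"

text \<open>Strict stationarity: all shifts of the sequence have the same finite-dimensional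
  distributions.\<close>

definition stationary :: "'a measure \<Rightarrow> (nat \<Rightarrow> 'a \<Rightarrow> real) \<Rightarrow> bool" where
  "stationary M X \<longleftrightarrow>
     (\<forall>n k. distr M (Pi\<^sub>M {1..n} (\<lambda>_. borel)) (\<lambda>w. \<lambda>i\<in>{1..n}. X (i + k) w) =
            distr M (Pi\<^sub>M {1..n} (\<lambda>_. borel)) (\<lambda>w. \<lambda>i\<in>{1..n}. X i w))"

text \<open>The relation written \<open>f \<lless> g\<close>. On \<open>real ^ 'n\<close> the order is the
  coordinatewise one, so that \<^const>\<open>mono\<close> means coordinatewise non-decreasing.\<close>

definition mono_dominated :: "('b::order \<Rightarrow> real) \<Rightarrow> ('b \<Rightarrow> real) \<Rightarrow> bool" where
  "mono_dominated f g \<longleftrightarrow> mono (\<lambda>x. g x + f x) \<and> mono (\<lambda>x. g x - f x)"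

definition lipschitz1 :: "real \<Rightarrow> (real ^ 'k \<Rightarrow> real) \<Rightarrow> bool" where
  "lipschitz1 C f \<longleftrightarrow> (\<forall>x u. \<bar>f (x + u) - f x\<bar> \<le> C * (\<Sum>j\<in>UNIV. \<bar>u $ j\<bar>))"

definition char_vec :: "'a measure \<Rightarrow> ('a \<Rightarrow> real ^ 'k) \<Rightarrow> real ^ 'k \<Rightarrow> complex" where
  "char_vec M Z t = (CLINT w|M. iexp (t \<bullet> Z w))"

text \<open>Densities are only determined almost everywhere; the condition asks for a version
  that is bounded and Lipschitz everywhere.\<close>

definition regular_vector :: "real \<Rightarrow> 'a measure \<Rightarrow> ('a \<Rightarrow> real ^ 'k) \<Rightarrow> bool" where
  "regular_vector C M Z \<longleftrightarrow>
     (\<exists>f. (\<forall>x. 0 \<le> f x) \<and> distributed M lborel Z (\<lambda>x. ennreal (f x)) \<and>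
          (\<exists>B. \<forall>x. f x \<le> B) \<and> lipschitz1 C f) \<and>
     integrable lborel (char_vec M Z)"

text \<open>In the two conditions below the Lipschitz constant is a single one for all choices of
  indices. With a constant depending on the indices the variance expansion fails.\<close>

definition cond_T1 :: "'a measure \<Rightarrow> (nat \<Rightarrow> 'a \<Rightarrow> real) \<Rightarrow> (nat \<Rightarrow> 'a \<Rightarrow> real) \<Rightarrow> bool" where
  "cond_T1 M X X' \<longleftrightarrow>
     (\<exists>C>0. \<forall>n i1 i2 i3 i4. distinct [i1, i2, i3, i4] \<and>
        1 \<le> i1 \<and> i1 < i2 \<and> i2 \<le> n \<and> 1 \<le> i3 \<and> i3 < i4 \<and> i4 \<le> n \<longrightarrow>
        regular_vector C M (\<lambda>w. vector [X i1 w, X i2 w, X i3 w, X i4 w] :: real ^ 4) \<and>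
        regular_vector C M (\<lambda>w. vector [X' i1 w, X i2 w, X i3 w, X i4 w] :: real ^ 4) \<and>
        regular_vector C M (\<lambda>w. vector [X i1 w, X' i2 w, X i3 w, X i4 w] :: real ^ 4) \<and>
        regular_vector C M (\<lambda>w. vector [X i1 w, X i2 w, X' i3 w, X i4 w] :: real ^ 4))"

definition cond_T2 :: "'a measure \<Rightarrow> (nat \<Rightarrow> 'a \<Rightarrow> real) \<Rightarrow> (nat \<Rightarrow> 'a \<Rightarrow> real) \<Rightarrow> bool" where
  "cond_T2 M X X' \<longleftrightarrow>
     (\<exists>C>0. \<forall>n i1 i2 i3 i4. 1 \<le> i1 \<and> i1 < i2 \<and> i2 \<le> n \<and> 1 \<le> i3 \<and> i3 < i4 \<and> i4 \<le> n \<longrightarrow>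
        (\<forall>i\<in>{i1, i2, i3, i4}. \<forall>j\<in>{i1, i2, i3, i4}. \<forall>k\<in>{i1, i2, i3, i4}.
           distinct [i, j, k] \<longrightarrow>
           regular_vector C M (\<lambda>w. vector [X i w, X j w, X k w] :: real ^ 3) \<and>
           regular_vector C M (\<lambda>w. vector [X' i w, X j w, X k w] :: real ^ 3)))"

definition iid_copy ::
  "'a measure \<Rightarrow> (nat \<Rightarrow> 'a \<Rightarrow> real) \<Rightarrow> real measure \<Rightarrow> (nat \<Rightarrow> 'a \<Rightarrow> real) \<Rightarrow> bool" where
  "iid_copy M X F X' \<longleftrightarrow>
     prob_space.indep_vars M (\<lambda>_. borel) X' {1..} \<and>
     (\<forall>n\<ge>1. distr M borel (X' n) = F) \<and>
     prob_space.indep_var M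
       (Pi\<^sub>M {1..} (\<lambda>_. borel)) (\<lambda>w. \<lambda>i\<in>{1..}. X i w)
       (Pi\<^sub>M {1..} (\<lambda>_. borel)) (\<lambda>w. \<lambda>i\<in>{1..}. X' i w)"

definition U_stat ::
  "(real \<Rightarrow> real \<Rightarrow> real) \<Rightarrow> (nat \<Rightarrow> 'a \<Rightarrow> real) \<Rightarrow> nat \<Rightarrow> 'a \<Rightarrow> real" where
  "U_stat \<rho> X n w =
     (\<Sum>(j1, j2)\<in>{(j1, j2). 1 \<le> j1 \<and> j1 < j2 \<and> j2 \<le> n}. \<rho> (X j1 w) (X j2 w)) / real (n choose 2)"

definition theta :: "(real \<Rightarrow> real \<Rightarrow> real) \<Rightarrow> real measure \<Rightarrow> real" where
  "theta \<rho> F = (LINT x|F. LINT y|F. \<rho> x y)"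

definition rho1 :: "(real \<Rightarrow> real \<Rightarrow> real) \<Rightarrow> real measure \<Rightarrow> real \<Rightarrow> real" where
  "rho1 \<rho> F x = (LINT y|F. \<rho> x y)"

definition sigma1_sq ::
  "'a measure \<Rightarrow> (nat \<Rightarrow> 'a \<Rightarrow> real) \<Rightarrow> (real \<Rightarrow> real \<Rightarrow> real) \<Rightarrow> real measure \<Rightarrow> real" where
  "sigma1_sq M X \<rho> F = prob_space.variance M (\<lambda>w. rho1 \<rho> F (X 1 w))"

definition sigma1 ::
  "'a measure \<Rightarrow> (nat \<Rightarrow> 'a \<Rightarrow> real) \<Rightarrow> (real \<Rightarrow> real \<Rightarrow> real) \<Rightarrow> real measure \<Rightarrow> nat \<Rightarrow> real" where
  "sigma1 M X \<rho> F j =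
     covariance M (\<lambda>w. rho1 \<rho> F (X 1 w)) (\<lambda>w. rho1 \<rho> F (X (1 + j) w))"

text \<open>Sums over \<open>j \<ge> 1\<close> are written as series over all \<open>j\<close> with index \<open>Suc j\<close>.\<close>

definition sigmaU_sq ::
  "'a measure \<Rightarrow> (nat \<Rightarrow> 'a \<Rightarrow> real) \<Rightarrow> (real \<Rightarrow> real \<Rightarrow> real) \<Rightarrow> real measure \<Rightarrow> real" where
  "sigmaU_sq M X \<rho> F = sigma1_sq M X \<rho> F + 2 * (\<Sum>j. sigma1 M X \<rho> F (Suc j))"

end

theory Submission
  imports Defs
begin

text \<open>
  Let \<open>h\<close> be the degenerate part of the kernel, so that \<open>U - \<theta>\<close> is \<open>2/n\<close> times the sum of the
  \<open>\<rho>\<^sub>1(X\<^sub>i) - \<theta>\<close> plus the average of the \<open>h(X\<^sub>i, X\<^sub>j)\<close>.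
  If one variable of \<open>h(X\<^sub>i, X\<^sub>j) h(X\<^sub>k, X\<^sub>l)\<close> is replaced by its independent copy, the expectation
  vanishes, so the expectation is bounded by the distance of the densities before and after the
  replacement. Both densities are Lipschitz, and testing their difference against a product of tent
  functions, whose covariances association controls, bounds the difference by a constant times the
  sum of the covariances to the power \<open>1/7\<close>. The geometric mean of three such bounds, for the replacement
  of \<open>X\<^sub>i\<close>, \<open>X\<^sub>j\<close> and \<open>X\<^sub>k\<close>, contains two different pairs of indices in each of its terms, and
  summability of the \<open>1/21\<close>-th powers shows that the square of the sum of all \<open>h(X\<^sub>i, X\<^sub>j)\<close> has
  expectation \<open>O(n\<^sup>2)\<close>. Hence the remainder is negligible for both claims. The sum of the
  \<open>\<rho>\<^sub>1(X\<^sub>i)\<close> satisfies Newman's central limit theorem: the characteristic function of a sum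
  of blocks differs from the product of those of the blocks by at most the covariances between the
  blocks of the dominating function.
\<close>

section \<open>Essentially bounded variables and associated processes\<close>

text \<open>\<open>h\<close> is merely bounded, so association, which controls functions dominated
  by monotone ones (Lipschitz functions, for instance), says nothing about products of
  \<open>h\<close> directly; the regularity has to come from the densities. The price is the
  exponent. A gap \<open>\<delta>\<close> between Lipschitz densities in dimension \<open>d\<close>
  persists on a cube of side of order \<open>\<delta>\<close>, so the covariances bound
  \<open>\<delta> ^ (d + 3)\<close>: one factor for the height, \<open>d\<close> for the volume, two
  for the slopes of the tents. Dimension 4 yields 1/7, and a geometric mean of three bounds divides
  by 3, hence 1/21. One replacement is not enough: each term of its bound ties only two of the four
  indices together and leaves of order n^3 quadruples. Two replacements, at \<open>i\<close> and
  \<open>j\<close>, share the edge \<open>ij\<close> and still produce terms with that edge alone.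
  The star at \<open>k\<close> misses this edge, which forces a second one, and the sum drops to
  order n^2. This is small against the order n^3 that the linear part contributes on the same
  scale.\<close>

context prob_space begin

text \<open>The bound is almost sure because the \<open>X n\<close> are bounded only almost surely.
  The class is closed under sums and products, so covariances are bilinear on it without further
  integrability conditions.\<close>

definition ess_bounded :: "('a \<Rightarrow> real) \<Rightarrow> bool" where
  "ess_bounded Y \<longleftrightarrow> Y \<in> borel_measurable M \<and> (\<exists>c. AE w in M. \<bar>Y w\<bar> \<le> c)"

lemma ess_boundedI:
  "Y \<in> borel_measurable M \<Longrightarrow> AE w in M. \<bar>Y w\<bar> \<le> c \<Longrightarrow> ess_bounded Y"
  unfolding ess_bounded_def by blast

lemma ess_bounded_measurable: "ess_bounded Y \<Longrightarrow> Y \<in> borel_measurable M"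
  unfolding ess_bounded_def by blast

lemma ess_bounded_integrable: "ess_bounded Y \<Longrightarrow> integrable M Y"
  unfolding ess_bounded_def by (auto intro!: integrable_const_bound)

lemma ess_bounded_const: "ess_bounded (\<lambda>_. c)"
  by (rule ess_boundedI[where c = "\<bar>c\<bar>"]) auto

lemma ess_bounded_add:
  assumes "ess_bounded Y" "ess_bounded Z"
  shows "ess_bounded (\<lambda>w. Y w + Z w)"
proof -
  obtain c d where "AE w in M. \<bar>Y w\<bar> \<le> c" "AE w in M. \<bar>Z w\<bar> \<le> d"
    using assms unfolding ess_bounded_def by blast
  then have "AE w in M. \<bar>Y w + Z w\<bar> \<le> c + d" by eventually_elim linarith
  with assms show ?thesis unfolding ess_bounded_def by auto
qed

lemma ess_bounded_mult:
  assumes "ess_bounded Y" "ess_bounded Z"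
  shows "ess_bounded (\<lambda>w. Y w * Z w)"
proof -
  obtain c d where "AE w in M. \<bar>Y w\<bar> \<le> c" "AE w in M. \<bar>Z w\<bar> \<le> d"
    using assms unfolding ess_bounded_def by blast
  then have "AE w in M. \<bar>Y w * Z w\<bar> \<le> c * d"
    by eventually_elim (simp add: abs_mult mult_mono')
  with assms show ?thesis unfolding ess_bounded_def by auto
qed

lemma ess_bounded_cmult: "ess_bounded Y \<Longrightarrow> ess_bounded (\<lambda>w. c * Y w)"
  using ess_bounded_mult[OF ess_bounded_const] .

lemma ess_bounded_diff:
  assumes "ess_bounded Y" "ess_bounded Z"
  shows "ess_bounded (\<lambda>w. Y w - Z w)"
  using ess_bounded_add[OF assms(1) ess_bounded_cmult[OF assms(2), of "-1"]] by simp

lemma ess_bounded_sum: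
  "(\<And>i. i \<in> I \<Longrightarrow> ess_bounded (Y i)) \<Longrightarrow> ess_bounded (\<lambda>w. \<Sum>i\<in>I. Y i w)"
  by (induction I rule: infinite_finite_induct) (auto intro: ess_bounded_add ess_bounded_const)

lemmas ess_bounded_intros =
  ess_bounded_const ess_bounded_add ess_bounded_mult ess_bounded_diff ess_bounded_sum

lemma covariance_eq:
  assumes "ess_bounded Y" "ess_bounded Z"
  shows "covariance M Y Z = expectation (\<lambda>w. Y w * Z w) - expectation Y * expectation Z"
proof -
  have i: "integrable M Y" "integrable M Z" "integrable M (\<lambda>w. Y w * Z w)"
    by (auto intro!: ess_bounded_integrable ess_bounded_mult assms)
  have "covariance M Y Z = expectation (\<lambda>w. Y w * Z w - expectation Z * Y w - expectation Y * Z w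
      + expectation Y * expectation Z)"
    unfolding covariance_def by (simp add: algebra_simps)
  also have "\<dots> = expectation (\<lambda>w. Y w * Z w) - expectation Y * expectation Z"
    using i by (simp add: prob_space)
  finally show ?thesis .
qed

lemma covariance_commute: "covariance M Y Z = covariance M Z Y"
  unfolding covariance_def by (simp add: mult.commute)

lemma covariance_add_left:
  assumes "ess_bounded Y" "ess_bounded Y'" "ess_bounded Z"
  shows "covariance M (\<lambda>w. Y w + Y' w) Z = covariance M Y Z + covariance M Y' Z"
  using assms
  by (simp add: covariance_eq ess_bounded_intros ess_bounded_integrable algebra_simps)

lemma covariance_cmult_left:
  assumes "ess_bounded Y" "ess_bounded Z"
  shows "covariance M (\<lambda>w. c * Y w) Z = c * covariance M Y Z"
  using assms by (simp add: covariance_eq ess_bounded_intros algebra_simps)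

lemma covariance_const_left: "ess_bounded Z \<Longrightarrow> covariance M (\<lambda>_. c) Z = 0"
  by (simp add: covariance_eq ess_bounded_const prob_space)

lemma covariance_sum_left:
  assumes "\<And>i. i \<in> I \<Longrightarrow> ess_bounded (Y i)" "ess_bounded Z"
  shows "covariance M (\<lambda>w. \<Sum>i\<in>I. Y i w) Z = (\<Sum>i\<in>I. covariance M (Y i) Z)"
  using assms
  by (induction I rule: infinite_finite_induct)
    (simp_all add: covariance_const_left covariance_add_left ess_bounded_intros)

lemma covariance_cmult_right:
  assumes "ess_bounded Y" "ess_bounded Z"
  shows "covariance M Y (\<lambda>w. c * Z w) = c * covariance M Y Z"
  using covariance_cmult_left[OF assms(2,1)] by (simp add: covariance_commute)

lemma covariance_sum_right:
  assumes "\<And>i. i \<in> I \<Longrightarrow> ess_bounded (Z i)" "ess_bounded Y"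
  shows "covariance M Y (\<lambda>w. \<Sum>i\<in>I. Z i w) = (\<Sum>i\<in>I. covariance M Y (Z i))"
  by (subst (1 2) covariance_commute) (rule covariance_sum_left[OF assms])

lemma covariance_add_right:
  assumes "ess_bounded Y" "ess_bounded Z" "ess_bounded Z'"
  shows "covariance M Y (\<lambda>w. Z w + Z' w) = covariance M Y Z + covariance M Y Z'"
  using covariance_add_left[OF assms(2,3,1)] by (simp add: covariance_commute[of Y])

text \<open>The factor \<open>c\<close> stays free: nonnegativity of the variance for
  \<open>c\<close> and for \<open>- c\<close> gives a weighted Cauchy-Schwarz bound for the
  covariance.\<close>

lemma variance_add:
  assumes "ess_bounded Y" "ess_bounded Z"
  shows "variance (\<lambda>w. Y w + c * Z w) = variance Y + 2 * c * covariance M Y Z + c\<^sup>2 * variance Z"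
proof -
  have V: "variance W = covariance M W W" for W by (simp add: covariance_def power2_eq_square)
  show ?thesis
    unfolding V using assms covariance_commute[of Z Y]
    by (simp add: covariance_add_left covariance_add_right covariance_cmult_left covariance_cmult_right
      ess_bounded_add ess_bounded_cmult power2_eq_square algebra_simps)
qed

text \<open>This is \<open>f \<lless> f'\<close> in the coordinates \<open>J\<close>, with the two monotonicity conditions combined
  into one inequality.\<close>

definition coordwise_dominated :: "'i set \<Rightarrow> (('i \<Rightarrow> real) \<Rightarrow> real) \<Rightarrow> (('i \<Rightarrow> real) \<Rightarrow> real) \<Rightarrow> bool"
  where "coordwise_dominated J f f' \<longleftrightarrow>
    (\<forall>x y. (\<forall>j\<in>J. x j \<le> y j) \<longrightarrow> \<bar>f y - f x\<bar> \<le> f' y - f' x)"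

text \<open>The functions \<open>f' + f\<close>, \<open>f' - f\<close>, \<open>g' + g\<close> and
  \<open>g' - g\<close> are nondecreasing, so association gives four inequalities. Adding those with
  equal signs, and those with opposite signs, cancels the mixed covariances and leaves the two
  halves of the claim.\<close>

lemma abs_covariance_le_dominated:
  assumes assoc: "finitely_associated M X J"
    and f: "coordwise_dominated J f f'" and g: "coordwise_dominated J g g'"
    and b: "ess_bounded (\<lambda>w. f (\<lambda>j. X j w))" "ess_bounded (\<lambda>w. f' (\<lambda>j. X j w))"
      "ess_bounded (\<lambda>w. g (\<lambda>j. X j w))" "ess_bounded (\<lambda>w. g' (\<lambda>j. X j w))"
  shows "\<bar>covariance M (\<lambda>w. f (\<lambda>j. X j w)) (\<lambda>w. g (\<lambda>j. X j w))\<bar>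
    \<le> covariance M (\<lambda>w. f' (\<lambda>j. X j w)) (\<lambda>w. g' (\<lambda>j. X j w))"
proof -
  let ?f = "\<lambda>w. f (\<lambda>j. X j w)" and ?g = "\<lambda>w. g (\<lambda>j. X j w)"
  let ?f' = "\<lambda>w. f' (\<lambda>j. X j w)" and ?g' = "\<lambda>w. g' (\<lambda>j. X j w)"
  have *: "0 \<le> covariance M ?f' ?g' + s * covariance M ?f' ?g + r * covariance M ?f ?g'
      + r * s * covariance M ?f ?g" if rs: "\<bar>r\<bar> = 1" "\<bar>s\<bar> = 1" for r s :: real
  proof -
    let ?h = "\<lambda>x. f' x + r * f x" and ?k = "\<lambda>x. g' x + s * g x"
    have sgn: "r = 1 \<or> r = -1" "s = 1 \<or> s = -1" using rs by linarith+
    have "coordwise_nondecreasing J ?h" "coordwise_nondecreasing J ?k"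
      using f g sgn unfolding coordwise_nondecreasing_def coordwise_dominated_def
      by (fastforce simp: abs_le_iff)+
    moreover have eb: "ess_bounded (\<lambda>w. ?h (\<lambda>j. X j w))" "ess_bounded (\<lambda>w. ?k (\<lambda>j. X j w))"
      by (intro ess_bounded_intros b)+
    ultimately have "0 \<le> covariance M (\<lambda>w. ?h (\<lambda>j. X j w)) (\<lambda>w. ?k (\<lambda>j. X j w))"
      using assoc[unfolded finitely_associated_def, rule_format, of ?h ?k]
        ess_bounded_mult[OF eb] by (auto intro: ess_bounded_integrable)
    also have "\<dots> = covariance M ?f' ?g' + s * covariance M ?f' ?g + r * covariance M ?f ?g'
      + r * s * covariance M ?f ?g"
      using b by (simp add: covariance_eq ess_bounded_intros ess_bounded_integrable algebra_simps)
    finally show ?thesis .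
  qed
  from *[of 1 1] *[of 1 "-1"] *[of "-1" 1] *[of "-1" "-1"] show ?thesis by simp
qed

end

section \<open>Invariance of laws and covariances under shifts\<close>

locale stationary_associated = prob_space M for M :: "'a measure" +
  fixes X :: "nat \<Rightarrow> 'a \<Rightarrow> real" and F :: "real measure" and C :: real
  assumes X_measurable: "\<And>n. 1 \<le> n \<Longrightarrow> X n \<in> borel_measurable M"
    and stationary: "stationary M X"
    and assoc: "associated M X {1..}"
    and distr_X_1: "distr M borel (X 1) = F"
    and X_1_bounded: "AE w in M. \<bar>X 1 w\<bar> \<le> C"
begin

lemma integral_shift:
  fixes g :: "(nat \<Rightarrow> real) \<Rightarrow> 'c::{banach, second_countable_topology}"
  assumes g: "g \<in> borel_measurable (Pi\<^sub>M {1..n} (\<lambda>_. borel))"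
  shows "(\<integral>w. g (\<lambda>i\<in>{1..n}. X (i + k) w) \<partial>M) = (\<integral>w. g (\<lambda>i\<in>{1..n}. X i w) \<partial>M)"
proof -
  have m: "(\<lambda>w. \<lambda>i\<in>{1..n}. X (i + k) w) \<in> M \<rightarrow>\<^sub>M Pi\<^sub>M {1..n} (\<lambda>_. borel)" for k
    by (intro measurable_restrict X_measurable) auto
  have "(\<integral>w. g (\<lambda>i\<in>{1..n}. X (i + k) w) \<partial>M)
      = integral\<^sup>L (distr M (Pi\<^sub>M {1..n} (\<lambda>_. borel)) (\<lambda>w. \<lambda>i\<in>{1..n}. X (i + k) w)) g"
    by (rule integral_distr[OF m g, symmetric])
  also have "\<dots> = integral\<^sup>L (distr M (Pi\<^sub>M {1..n} (\<lambda>_. borel)) (\<lambda>w. \<lambda>i\<in>{1..n}. X i w)) g"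
    using stationary[unfolded stationary_def, rule_format, of n k] by simp
  also have "\<dots> = (\<integral>w. g (\<lambda>i\<in>{1..n}. X i w) \<partial>M)"
    using integral_distr[OF m[of 0] g] by simp
  finally show ?thesis .
qed

lemma distr_X: assumes "1 \<le> n" shows "distr M borel (X n) = F"
proof -
  have m: "(\<lambda>w. \<lambda>i\<in>{1..1}. X (i + k) w) \<in> M \<rightarrow>\<^sub>M Pi\<^sub>M {1..1} (\<lambda>_. borel)" for k
    by (intro measurable_restrict X_measurable) auto
  have p: "(\<lambda>x. x 1) \<in> Pi\<^sub>M {1..1::nat} (\<lambda>_. borel) \<rightarrow>\<^sub>M (borel :: real measure)"
    by (rule measurable_component_singleton) simp
  obtain k where k: "n = 1 + k" using assms le_Suc_ex by blast
  have "distr M borel (X (1 + k)) = distr (distr M (Pi\<^sub>M {1..1} (\<lambda>_. borel))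
      (\<lambda>w. \<lambda>i\<in>{1..1}. X (i + k) w)) borel (\<lambda>x. x 1)"
    by (subst distr_distr[OF p m]) (simp add: comp_def)
  also have "\<dots> = distr (distr M (Pi\<^sub>M {1..1} (\<lambda>_. borel))
      (\<lambda>w. \<lambda>i\<in>{1..1}. X i w)) borel (\<lambda>x. x 1)"
    using stationary[unfolded stationary_def, rule_format, of 1 k] by simp
  also have "\<dots> = distr M borel (X 1)"
    using distr_distr[OF p m[of 0]] by (simp add: comp_def)
  finally show ?thesis using k distr_X_1 by simp
qed

lemma sets_F [simp]: "sets F = sets borel" and space_F [simp]: "space F = UNIV"
  by (auto simp: distr_X_1[symmetric])

lemma prob_space_F: "prob_space F"
  unfolding distr_X_1[symmetric] by (rule prob_space_distr) (simp add: X_measurable)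

lemma integral_X:
  fixes g :: "real \<Rightarrow> 'c::{banach, second_countable_topology}"
  assumes "1 \<le> n" "g \<in> borel_measurable borel"
  shows "(\<integral>w. g (X n w) \<partial>M) = (\<integral>x. g x \<partial>F)"
  unfolding distr_X[OF assms(1), symmetric]
  by (rule integral_distr[symmetric]) (use assms X_measurable in auto)

lemma X_bounded: assumes "1 \<le> n" shows "AE w in M. \<bar>X n w\<bar> \<le> C"
proof -
  have "AE x in distr M borel (X 1). \<bar>x\<bar> \<le> C"
    by (subst AE_distr_iff) (use X_1_bounded X_measurable in auto)
  then have "AE x in distr M borel (X n). \<bar>x\<bar> \<le> C" by (simp only: distr_X[OF assms] distr_X_1)
  then show ?thesis by (subst (asm) AE_distr_iff) (use assms X_measurable in auto)
qed

lemma ess_bounded_X: "1 \<le> n \<Longrightarrow> ess_bounded (X n)"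
  by (rule ess_boundedI[OF X_measurable X_bounded])

lemma finitely_associated_X: "finite J \<Longrightarrow> J \<subseteq> {1..} \<Longrightarrow> finitely_associated M X J"
  using assoc unfolding associated_def by blast

lemma integral_X2_shift:
  fixes g :: "real \<Rightarrow> real \<Rightarrow> real"
  assumes "1 \<le> i" "(\<lambda>(x, y). g x y) \<in> borel_measurable (borel :: (real \<times> real) measure)"
  shows "expectation (\<lambda>w. g (X i w) (X (i + d) w)) = expectation (\<lambda>w. g (X 1 w) (X (1 + d) w))"
proof -
  obtain k where k: "i = 1 + k" using assms(1) le_Suc_ex by blast
  let ?g = "\<lambda>x. (case (x 1, x (1 + d)) of (x, y) \<Rightarrow> g x y)"
  have "?g \<in> borel_measurable (Pi\<^sub>M {1..1 + d} (\<lambda>_. borel))"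
    by (rule measurable_compose[OF _ assms(2)[folded borel_prod]]) measurable
  from integral_shift[OF this, of k] show ?thesis by (simp add: k add_ac)
qed

lemma covariance_shift:
  assumes "1 \<le> i" "p \<in> borel_measurable borel" "q \<in> borel_measurable borel"
  shows "covariance M (\<lambda>w. p (X i w)) (\<lambda>w. q (X (i + d) w))
    = covariance M (\<lambda>w. p (X 1 w)) (\<lambda>w. q (X (1 + d) w))"
  unfolding covariance_def using assms
  \<comment> \<open>Both means become integrals over \<open>F\<close>, which do not depend on the
    index, so the covariance is the expectation of one fixed function of two variables.\<close>
  apply (simp add: integral_X)
  using integral_X2_shift[of i "\<lambda>x y. (p x - integral\<^sup>L F p) * (q y - integral\<^sup>L F q)" d] assms
  apply (simp add: borel_prod[symmetric])
  done

end

section \<open>Densities and decoupling\<close>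

text \<open>A bump of height 1 around \<open>a\<close> that vanishes at distance \<open>r\<close>.
  Its slope is at most \<open>1 / r\<close>, so it is dominated by the monotone function
  \<open>x / r\<close>; a covariance of two such bumps therefore costs the factor
  \<open>1 / r\<^sup>2\<close>.\<close>

definition tent :: "real \<Rightarrow> real \<Rightarrow> real \<Rightarrow> real" where
  "tent a r x = max 0 (1 - \<bar>x - a\<bar> / r)"

lemma tent_nonneg: "0 \<le> tent a r x"
  by (simp add: tent_def)

lemma tent_le_1: "0 < r \<Longrightarrow> tent a r x \<le> 1"
  by (simp add: tent_def)

lemma tent_eq_0: "0 < r \<Longrightarrow> r \<le> \<bar>x - a\<bar> \<Longrightarrow> tent a r x = 0"
  by (simp add: tent_def)

lemma tent_ge_half: "0 < r \<Longrightarrow> \<bar>x - a\<bar> \<le> r / 2 \<Longrightarrow> 1 / 2 \<le> tent a r x"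
  by (simp add: tent_def field_simps)

lemma tent_lipschitz: assumes "0 < r" shows "\<bar>tent a r x - tent a r y\<bar> \<le> \<bar>x - y\<bar> / r"
proof -
  have "\<bar>\<bar>x - a\<bar> / r - \<bar>y - a\<bar> / r\<bar> \<le> \<bar>x - y\<bar> / r"
    using assms by (simp add: diff_divide_distrib[symmetric] divide_right_mono)
  then show ?thesis unfolding tent_def by linarith
qed

lemma measurable_tent [measurable]: "tent a r \<in> borel_measurable borel"
  unfolding tent_def by measurable

lemma measurable_vec_nth [measurable (raw)]:
  fixes f :: "'b \<Rightarrow> real ^ 'k"
  assumes "f \<in> borel_measurable N"
  shows "(\<lambda>x. f x $ j) \<in> borel_measurable N"
  by (rule measurable_compose[OF assms])
    (auto intro!: borel_measurable_continuous_onI continuous_intros)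

lemma measurable_vec_lambda [measurable (raw)]:
  fixes f :: "'k::finite \<Rightarrow> 'b \<Rightarrow> real"
  assumes "\<And>j. f j \<in> borel_measurable N"
  shows "(\<lambda>x. \<chi> j. f j x) \<in> borel_measurable N"
  using assms
  by (subst borel_measurable_euclidean_space) (auto simp: Basis_vec_def inner_axis)

context prob_space begin

text \<open>If the densities differ by \<open>\<delta>\<close> at a point, then by the Lipschitz condition they differ
  by at least \<open>\<delta>/2\<close> on a cube whose side is proportional to \<open>\<delta>\<close>, and a product of tent
  functions supported in that cube detects the difference.\<close>

lemma density_gap_power_le:
  fixes Z Z' :: "'a \<Rightarrow> real ^ 'k" and f g :: "real ^ 'k \<Rightarrow> real"
  defines "d \<equiv> CARD('k)"
  assumes f: "distributed M lborel Z (\<lambda>x. ennreal (f x))" "\<And>x. 0 \<le> f x" "lipschitz1 L f"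
    and g: "distributed M lborel Z' (\<lambda>x. ennreal (g x))" "\<And>x. 0 \<le> g x" "lipschitz1 L g"
    and L: "0 < L"
    and gap: "\<And>a r. 0 < r \<Longrightarrow> \<bar>expectation (\<lambda>w. \<Prod>j\<in>UNIV. tent (a j) r (Z w $ j))
        - expectation (\<lambda>w. \<Prod>j\<in>UNIV. tent (a j) r (Z' w $ j))\<bar> \<le> S / r\<^sup>2"
  shows "\<bar>f x - g x\<bar> ^ (d + 3) \<le> 2 ^ (d + 1) * (4 * L * d) ^ (d + 2) * S"
proof (cases "f x = g x")
  case True
  have "0 \<le> S" using gap[of 1 "\<lambda>_. 0"] by simp
  then have "0 \<le> 2 ^ (d + 1) * (4 * L * d) ^ (d + 2) * S" using L by (intro mult_nonneg_nonneg) auto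
  with True show ?thesis by (simp add: power_0_left)
next
  case False
  define \<delta> where "\<delta> = \<bar>f x - g x\<bar>"
  have \<delta>: "0 < \<delta>" using False by (simp add: \<delta>_def)
  define s where "s = sgn (f x - g x)"
  have s: "s * (f x - g x) = \<delta>" "\<bar>s\<bar> = 1" using False by (auto simp: s_def \<delta>_def sgn_if)
  have d: "0 < d" by (simp add: d_def)
  \<comment> \<open>With this choice each density changes by at most
    \<open>L * d * r = \<delta> / 4\<close> on the cube, so half of the gap survives there.\<close>
  define r where "r = \<delta> / (4 * L * d)"
  have r: "0 < r" using \<delta> L d by (simp add: r_def)
  define \<phi> where "\<phi> y = (\<Prod>j\<in>UNIV. tent (x $ j) r (y $ j))" for y :: "real ^ 'k"
  have \<phi>_meas: "\<phi> \<in> borel_measurable lborel" unfolding \<phi>_def by measurable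
  have \<phi>01: "0 \<le> \<phi> y" "\<phi> y \<le> 1" for y
    unfolding \<phi>_def by (auto intro!: prod_nonneg prod_le_1 tent_nonneg tent_le_1 r)
  have low: "\<delta> / 2 \<le> s * (f y - g y)" if "\<And>j. \<bar>y $ j - x $ j\<bar> \<le> r" for y
  proof -
    have "(\<Sum>j\<in>UNIV. \<bar>(y - x) $ j\<bar>) \<le> (\<Sum>j\<in>(UNIV::'k set). r)"
      by (rule sum_mono) (use that in simp)
    also have "\<dots> = d * r" by (simp add: d_def)
    finally have *: "L * (\<Sum>j\<in>UNIV. \<bar>(y - x) $ j\<bar>) \<le> L * (d * r)"
      using L by (intro mult_left_mono) auto
    have "\<bar>f y - f x\<bar> \<le> L * (d * r)"
      using f(3)[unfolded lipschitz1_def, rule_format, of x "y - x"] * by simp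
    moreover have "\<bar>g y - g x\<bar> \<le> L * (d * r)"
      using g(3)[unfolded lipschitz1_def, rule_format, of x "y - x"] * by simp
    moreover have "L * (d * r) = \<delta> / 4" using L d by (simp add: r_def)
    moreover have "s = 1 \<or> s = -1" using s(2) by linarith
    ultimately show ?thesis using s(1) by auto
  qed
  \<comment> \<open>The product of tents lives on the cube of half-side \<open>r\<close>. On
    \<open>?Q\<close>, which is half as wide, every tent is at least 1/2, whence the factor
    \<open>(1 / 2) ^ d\<close>.\<close>
  let ?Q = "cbox (\<chi> j. x $ j - r / 2) (\<chi> j. x $ j + r / 2)"
  have Q: "measure lborel ?Q = r ^ d"
  proof -
    have "?Q \<noteq> {}" using r by (auto simp: box_ne_empty Basis_vec_def inner_axis)
    then show ?thesis by (simp add: content_cbox_cart d_def)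
  qed
  \<comment> \<open>Inside the support of \<open>\<phi>\<close> the difference of the densities has
    the sign \<open>s\<close>, so nothing is lost to cancellation; outside the support both sides
    are 0.\<close>
  have pw: "indicator ?Q y * (\<delta> / 2 * (1 / 2) ^ d) \<le> s * (f y * \<phi> y - g y * \<phi> y)" for y
  proof (cases "\<forall>j. \<bar>y $ j - x $ j\<bar> \<le> r")
    case True
    have "\<delta> / 2 * \<phi> y \<le> s * (f y - g y) * \<phi> y"
      by (intro mult_right_mono low \<phi>01) (use True in auto)
    moreover have "(1 / 2) ^ d \<le> \<phi> y" if "y \<in> ?Q"
    proof -
      have "(1 / 2) ^ d = (\<Prod>j\<in>(UNIV::'k set). 1 / 2 :: real)" by (simp add: d_def)
      also have "\<dots> \<le> \<phi> y" unfolding \<phi>_def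
      proof (intro prod_mono conjI)
        fix j
        have "x $ j - r / 2 \<le> y $ j \<and> y $ j \<le> x $ j + r / 2"
          using that by (simp add: mem_box_cart)
        then show "1 / 2 \<le> tent (x $ j) r (y $ j)"
          by (intro tent_ge_half r) linarith
      qed simp
      finally show ?thesis .
    qed
    moreover have "s * (f y - g y) * \<phi> y = s * (f y * \<phi> y - g y * \<phi> y)"
      by (simp add: algebra_simps)
    moreover have "indicator ?Q y * (\<delta> / 2 * (1 / 2) ^ d) \<le> \<delta> / 2 * \<phi> y"
      if "y \<in> ?Q \<Longrightarrow> (1 / 2) ^ d \<le> \<phi> y"
    proof (cases "y \<in> ?Q")
      case True
      then have "\<delta> / 2 * (1 / 2) ^ d \<le> \<delta> / 2 * \<phi> y" using \<delta> that by (intro mult_left_mono) auto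
      then show ?thesis using True by simp
    qed (use \<delta> \<phi>01(1)[of y] in simp)
    ultimately show ?thesis by linarith
  next
    case False
    then obtain j where j: "r < \<bar>y $ j - x $ j\<bar>" by (auto simp: not_le)
    then have "\<phi> y = 0" unfolding \<phi>_def
      by (intro prod_zero bexI[of _ j] tent_eq_0 r) auto
    moreover have "y \<notin> ?Q"
    proof
      assume "y \<in> ?Q"
      then have "x $ j - r / 2 \<le> y $ j \<and> y $ j \<le> x $ j + r / 2" by (simp add: mem_box_cart)
      with j r show False by linarith
    qed
    ultimately show ?thesis by simp
  qed
  have [measurable]: "random_variable borel Z" "random_variable borel Z'"
    using f(1) g(1) distributed_measurable by fastforce+
  have iZ: "integrable M (\<lambda>w. \<phi> (Z w))" "integrable M (\<lambda>w. \<phi> (Z' w))"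
    by (rule integrable_const_bound[where B = 1]; use \<phi>01 \<phi>_meas in \<open>auto simp: abs_of_nonneg\<close>)+
  have i: "integrable lborel (\<lambda>y. f y * \<phi> y)" "integrable lborel (\<lambda>y. g y * \<phi> y)"
    using distributed_integrable[OF f(1) \<phi>_meas] distributed_integrable[OF g(1) \<phi>_meas] f(2) g(2) iZ
    by auto
  have "integral\<^sup>L lborel (\<lambda>y. indicator ?Q y * (\<delta> / 2 * (1 / 2) ^ d))
      \<le> integral\<^sup>L lborel (\<lambda>y. s * (f y * \<phi> y - g y * \<phi> y))"
    by (intro integral_mono pw integrable_mult_left integrable_real_indicator
      integrable_mult_right Bochner_Integration.integrable_diff i) (auto simp: emeasure_lborel_cbox_eq)
  also have "\<dots> = s * (expectation (\<lambda>w. \<phi> (Z w)) - expectation (\<lambda>w. \<phi> (Z' w)))"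
    using i distributed_integral[OF f(1) \<phi>_meas] distributed_integral[OF g(1) \<phi>_meas] f(2) g(2)
    by simp
  also have "\<dots> \<le> \<bar>expectation (\<lambda>w. \<phi> (Z w)) - expectation (\<lambda>w. \<phi> (Z' w))\<bar>"
    using s(2) by (metis abs_ge_self abs_mult mult_1)
  also have "\<dots> \<le> S / r\<^sup>2" using gap[OF r, of "\<lambda>j. x $ j"] by (simp add: \<phi>_def)
  finally have "r ^ d * (\<delta> / 2 * (1 / 2) ^ d) \<le> S / r\<^sup>2" by (simp add: Q)
  then have "\<delta> * r ^ (d + 2) \<le> 2 ^ (d + 1) * S"
    using r by (simp add: field_simps power_add power2_eq_square)
  \<comment> \<open>As \<open>4 * L * d * r = \<delta>\<close>, this factor turns every
    \<open>r\<close> on the left into \<open>\<delta>\<close>.\<close>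
  then have "(4 * L * d) ^ (d + 2) * (\<delta> * r ^ (d + 2)) \<le> (4 * L * d) ^ (d + 2) * (2 ^ (d + 1) * S)"
    using L by (intro mult_left_mono) auto
  moreover have "(4 * L * d) ^ (d + 2) * (\<delta> * r ^ (d + 2)) = \<delta> ^ (d + 3)"
  proof -
    have "(4 * L * d) * r = \<delta>" using L d by (simp add: r_def)
    then have "(4 * L * d) ^ (d + 2) * r ^ (d + 2) = \<delta> ^ (d + 2)"
      by (metis power_mult_distrib)
    then show ?thesis by (simp add: power_add power3_eq_cube power2_eq_square algebra_simps)
  qed
  ultimately show ?thesis by (simp add: \<delta>_def mult_ac)
qed

text \<open>Both vectors stay in a cube of side \<open>2 * c\<close>, so a uniform bound for the
  difference of the densities integrates to that bound times the volume. This is where boundedness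
  of the variables is essential: on the whole space a uniform bound says nothing about the
  integral.\<close>

lemma expectation_gap_le_density_gap:
  fixes Z Z' :: "'a \<Rightarrow> real ^ 'k" and f g G :: "real ^ 'k \<Rightarrow> real"
  assumes f: "distributed M lborel Z (\<lambda>x. ennreal (f x))" "\<And>x. 0 \<le> f x"
    and g: "distributed M lborel Z' (\<lambda>x. ennreal (g x))" "\<And>x. 0 \<le> g x"
    and box: "AE w in M. \<forall>j. \<bar>Z w $ j\<bar> \<le> c" "AE w in M. \<forall>j. \<bar>Z' w $ j\<bar> \<le> c" and c: "0 < c"
    and G: "G \<in> borel_measurable borel" "\<And>x. \<bar>G x\<bar> \<le> B"
    and gap: "\<And>x. \<bar>f x - g x\<bar> \<le> \<delta>"
  shows "\<bar>expectation (\<lambda>w. G (Z w)) - expectation (\<lambda>w. G (Z' w))\<bar> \<le> B * \<delta> * (2 * c) ^ CARD('k)"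
proof -
  let ?Q = "cbox (\<chi> j. - c) (\<chi> j. c) :: (real ^ 'k) set"
  have Q: "measure lborel ?Q = (2 * c) ^ CARD('k)"
  proof -
    have "?Q \<noteq> {}" using c by (auto simp: box_ne_empty Basis_vec_def inner_axis)
    then show ?thesis by (simp add: content_cbox_cart)
  qed
  \<comment> \<open>Cutting \<open>G\<close> off outside the cube changes neither expectation and
    confines the Lebesgue integrals to a set of finite volume.\<close>
  define G' where "G' x = G x * indicator ?Q x" for x
  have [measurable]: "G \<in> borel_measurable borel" by (rule G)
  have G'_meas: "G' \<in> borel_measurable lborel" unfolding G'_def by measurable
  have B: "0 \<le> B" using G(2)[of 0] by linarith
  have G'_le: "\<bar>G' x\<bar> \<le> B" for x using G(2)[of x] B by (simp add: G'_def indicator_def)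
  have [measurable]: "random_variable borel Z" "random_variable borel Z'"
    using f(1) g(1) distributed_measurable by fastforce+
  have in_Q: "x \<in> ?Q \<longleftrightarrow> (\<forall>j. \<bar>x $ j\<bar> \<le> c)" for x
    by (auto simp: mem_box_cart abs_le_iff minus_le_iff)
  have eq: "expectation (\<lambda>w. G (Y w)) = expectation (\<lambda>w. G' (Y w))"
    if [measurable]: "random_variable borel Y" and "AE w in M. \<forall>j. \<bar>Y w $ j\<bar> \<le> c" for Y
  proof (rule integral_cong_AE)
    show "AE w in M. G (Y w) = G' (Y w)"
      using that(2) by eventually_elim (auto simp: G'_def in_Q indicator_def)
  qed (use G'_meas in auto)
  have iZ: "integrable M (\<lambda>w. G' (Z w))" "integrable M (\<lambda>w. G' (Z' w))"
    by (rule integrable_const_bound[where B = B]; use G'_le G'_meas in auto)+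
  have i: "integrable lborel (\<lambda>y. f y * G' y)" "integrable lborel (\<lambda>y. g y * G' y)"
    using distributed_integrable[OF f(1) G'_meas] distributed_integrable[OF g(1) G'_meas] f(2) g(2) iZ
    by auto
  have "\<bar>expectation (\<lambda>w. G (Z w)) - expectation (\<lambda>w. G (Z' w))\<bar>
      = \<bar>integral\<^sup>L lborel (\<lambda>y. f y * G' y - g y * G' y)\<bar>"
    using i distributed_integral[OF f(1) G'_meas] distributed_integral[OF g(1) G'_meas] f(2) g(2)
    by (simp add: eq box)
  also have "\<dots> \<le> integral\<^sup>L lborel (\<lambda>y. \<bar>f y * G' y - g y * G' y\<bar>)"
    by (rule integral_abs_bound)
  also have "\<dots> \<le> integral\<^sup>L lborel (\<lambda>y. indicator ?Q y * (\<delta> * B))"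
  proof (intro integral_mono integrable_abs Bochner_Integration.integrable_diff i
      integrable_mult_left integrable_real_indicator)
    fix y
    have "\<bar>f y * G' y - g y * G' y\<bar> = \<bar>f y - g y\<bar> * \<bar>G' y\<bar>"
      by (simp add: abs_mult[symmetric] left_diff_distrib)
    also have "\<dots> \<le> indicator ?Q y * (\<delta> * B)"
      using gap[of y] G'_le[of y] by (auto simp: G'_def indicator_def intro!: mult_mono)
    finally show "\<bar>f y * G' y - g y * G' y\<bar> \<le> indicator ?Q y * (\<delta> * B)" .
  qed (auto simp: emeasure_lborel_cbox_eq)
  also have "\<dots> = B * \<delta> * (2 * c) ^ CARD('k)" by (simp add: Q)
  finally show ?thesis .
qed

end

text \<open>Truncated subtraction makes at least one summand 0, so this is the absolute difference
  without leaving \<open>nat\<close>.\<close>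

definition ndist :: "nat \<Rightarrow> nat \<Rightarrow> nat" where
  "ndist i j = (i - j) + (j - i)"

section \<open>Products of tents under association\<close>

context stationary_associated begin

lemma covariance_ndist:
  assumes "1 \<le> i" "1 \<le> j" "p \<in> borel_measurable borel"
  shows "covariance M (\<lambda>w. p (X i w)) (\<lambda>w. p (X j w))
    = covariance M (\<lambda>w. p (X 1 w)) (\<lambda>w. p (X (1 + ndist i j) w))"
proof (cases "i \<le> j")
  case True
  then show ?thesis using covariance_shift[OF assms(1,3,3), of "j - i"] by (simp add: ndist_def)
next
  case False
  then show ?thesis using covariance_shift[OF assms(2,3,3), of "i - j"]
    by (simp add: ndist_def covariance_commute)
qed

text \<open>A product of factors in [0, 1] changes by at most the sum of the changes of its factors.
  Hence it is dominated by the sum of the \<open>x (\<iota> j) / r\<close>, and association compares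
  the covariance with that of two linear functions.\<close>

lemma covariance_tent_le:
  fixes \<iota> :: "'k::finite \<Rightarrow> nat"
  assumes \<iota>: "inj \<iota>" "\<And>j. 1 \<le> \<iota> j" and r: "0 < r"
  shows "\<bar>covariance M (\<lambda>w. tent (a j0) r (X (\<iota> j0) w))
      (\<lambda>w. \<Prod>j\<in>-{j0}. tent (a j) r (X (\<iota> j) w))\<bar>
    \<le> (\<Sum>j\<in>-{j0}. covariance M (X (\<iota> j0)) (X (\<iota> j))) / r\<^sup>2"
proof -
  let ?f = "\<lambda>x. tent (a j0) r (x (\<iota> j0))" and ?f' = "\<lambda>x. (1 / r) * x (\<iota> j0)"
  let ?g = "\<lambda>x. \<Prod>j\<in>-{j0}. tent (a j) r (x (\<iota> j))" and ?g' = "\<lambda>x. \<Sum>j\<in>-{j0}. (1 / r) * x (\<iota> j)"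
  note [measurable] = X_measurable[OF \<iota>(2)]
  have "\<bar>covariance M (\<lambda>w. ?f (\<lambda>j. X j w)) (\<lambda>w. ?g (\<lambda>j. X j w))\<bar>
    \<le> covariance M (\<lambda>w. ?f' (\<lambda>j. X j w)) (\<lambda>w. ?g' (\<lambda>j. X j w))"
  proof (rule abs_covariance_le_dominated[where f = ?f and f' = ?f' and g = ?g and g' = ?g' and J = "range \<iota>"])
    show "finitely_associated M X (range \<iota>)" by (rule finitely_associated_X) (use \<iota> in auto)
    show "coordwise_dominated (range \<iota>) ?f ?f'"
      unfolding coordwise_dominated_def
    proof (intro allI impI)
      fix x y :: "nat \<Rightarrow> real" assume "\<forall>j\<in>range \<iota>. x j \<le> y j"
      then show "\<bar>?f y - ?f x\<bar> \<le> ?f' y - ?f' x"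
        using tent_lipschitz[OF r, of "a j0" "y (\<iota> j0)" "x (\<iota> j0)"] by (simp add: diff_divide_distrib)
    qed
    show "coordwise_dominated (range \<iota>) ?g ?g'"
      unfolding coordwise_dominated_def
    proof (intro allI impI)
      fix x y :: "nat \<Rightarrow> real" assume xy: "\<forall>j\<in>range \<iota>. x j \<le> y j"
      have "\<bar>?g y - ?g x\<bar> \<le> (\<Sum>j\<in>-{j0}. \<bar>tent (a j) r (y (\<iota> j)) - tent (a j) r (x (\<iota> j))\<bar>)"
        using norm_prod_diff[of "-{j0}" "\<lambda>j. tent (a j) r (y (\<iota> j))" "\<lambda>j. tent (a j) r (x (\<iota> j))"]
        by (simp add: tent_nonneg tent_le_1 r)
      also have "\<dots> \<le> (\<Sum>j\<in>-{j0}. (1 / r) * y (\<iota> j) - (1 / r) * x (\<iota> j))"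
      proof (rule sum_mono)
        fix j show "\<bar>tent (a j) r (y (\<iota> j)) - tent (a j) r (x (\<iota> j))\<bar> \<le> (1 / r) * y (\<iota> j) - (1 / r) * x (\<iota> j)"
          using tent_lipschitz[OF r, of "a j" "y (\<iota> j)" "x (\<iota> j)"] xy by (simp add: diff_divide_distrib)
      qed
      finally show "\<bar>?g y - ?g x\<bar> \<le> ?g' y - ?g' x" by (simp add: sum_subtractf)
    qed
    show "ess_bounded (\<lambda>w. ?f (\<lambda>j. X j w))"
      by (rule ess_boundedI[where c = 1]) (auto simp: tent_nonneg tent_le_1 r)
    show "ess_bounded (\<lambda>w. ?g (\<lambda>j. X j w))"
      by (rule ess_boundedI[where c = 1])
        (auto simp: tent_nonneg tent_le_1 r abs_prod intro!: prod_le_1)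
  qed (intro ess_bounded_intros ess_bounded_X \<iota>)+
  also have "\<dots> = (\<Sum>j\<in>-{j0}. 1 / r * (1 / r * covariance M (X (\<iota> j0)) (X (\<iota> j))))"
    using \<iota> by (simp add: covariance_sum_right covariance_cmult_left covariance_cmult_right
      ess_bounded_intros ess_bounded_X del: times_divide_eq_left)
  also have "\<dots> = (\<Sum>j\<in>-{j0}. covariance M (X (\<iota> j0)) (X (\<iota> j))) / r\<^sup>2"
    by (simp add: sum_divide_distrib power2_eq_square)
  finally show ?thesis .
qed

end

section \<open>Replacing one variable by its independent copy\<close>

locale decoupled = stationary_associated +
  fixes X' :: "nat \<Rightarrow> 'a \<Rightarrow> real"
  assumes copy: "iid_copy M X F X'" and C_pos: "0 < C"
begin

lemma distr_X': "1 \<le> n \<Longrightarrow> distr M borel (X' n) = F"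
  using copy unfolding iid_copy_def by blast

lemma X'_measurable: "1 \<le> n \<Longrightarrow> X' n \<in> borel_measurable M"
  using copy unfolding iid_copy_def indep_vars_def by auto

text \<open>Independence is given between the two whole sequences, so Fubini is applied to their
  joint law; only afterwards is the inner integral reduced to the single coordinate
  \<open>n\<close>, whose law is \<open>F\<close>.\<close>

lemma expectation_X':
  fixes \<Phi> :: "real \<Rightarrow> (nat \<Rightarrow> real) \<Rightarrow> real"
  assumes n: "1 \<le> n"
    and \<Phi>: "(\<lambda>(x, \<xi>). \<Phi> x \<xi>) \<in> borel_measurable (borel \<Otimes>\<^sub>M Pi\<^sub>M {1..} (\<lambda>_. borel))"
      "\<And>x \<xi>. \<bar>\<Phi> x \<xi>\<bar> \<le> B"
  shows "expectation (\<lambda>w. \<Phi> (X' n w) (\<lambda>i\<in>{1..}. X i w))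
    = expectation (\<lambda>w. LINT x|F. \<Phi> x (\<lambda>i\<in>{1..}. X i w))"
proof -
  let ?S = "Pi\<^sub>M {1..} (\<lambda>_. borel) :: (nat \<Rightarrow> real) measure"
  let ?\<xi> = "\<lambda>w. \<lambda>i\<in>{1..}. X i w"
  have \<xi>: "?\<xi> \<in> M \<rightarrow>\<^sub>M ?S" by (intro measurable_restrict X_measurable) auto
  have \<xi>': "(\<lambda>w. \<lambda>i\<in>{1..}. X' i w) \<in> M \<rightarrow>\<^sub>M ?S" (is "?\<xi>' \<in> _")
    by (intro measurable_restrict X'_measurable) auto
  have n_meas: "(\<lambda>\<xi>. \<xi> n) \<in> ?S \<rightarrow>\<^sub>M borel"
    using n by (intro measurable_component_singleton) auto
  note [measurable] = X'_measurable[OF n] \<xi> \<xi>' n_meas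
  interpret P: prob_space "distr M ?S ?\<xi>" by (rule prob_space_distr) measurable
  interpret P': prob_space "distr M ?S ?\<xi>'" by (rule prob_space_distr) measurable
  interpret PP: pair_prob_space "distr M ?S ?\<xi>" "distr M ?S ?\<xi>'" ..
  interpret F: prob_space F by (rule prob_space_F)
  have "indep_var ?S ?\<xi> ?S ?\<xi>'"
    using copy unfolding iid_copy_def by blast
  then have eq: "distr M ?S ?\<xi> \<Otimes>\<^sub>M distr M ?S ?\<xi>' = distr M (?S \<Otimes>\<^sub>M ?S) (\<lambda>w. (?\<xi> w, ?\<xi>' w))"
    unfolding indep_var_distribution_eq by blast
  have \<Phi>': "(\<lambda>(\<xi>, \<eta>). \<Phi> (\<eta> n) \<xi>) \<in> borel_measurable (?S \<Otimes>\<^sub>M ?S)"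
  proof -
    have "(\<lambda>p. (snd p n, fst p)) \<in> ?S \<Otimes>\<^sub>M ?S \<rightarrow>\<^sub>M borel \<Otimes>\<^sub>M ?S"
      by (intro measurable_Pair measurable_compose[OF measurable_snd n_meas] measurable_fst)
    from measurable_compose[OF this \<Phi>(1)] show ?thesis by (simp add: case_prod_beta')
  qed
  have "expectation (\<lambda>w. \<Phi> (X' n w) (?\<xi> w))
      = integral\<^sup>L (distr M ?S ?\<xi> \<Otimes>\<^sub>M distr M ?S ?\<xi>') (\<lambda>(\<xi>, \<eta>). \<Phi> (\<eta> n) \<xi>)"
    unfolding eq using \<Phi>' n
    by (subst integral_distr[OF measurable_Pair[OF \<xi> \<xi>']]) (auto simp: case_prod_beta')
  also have "\<dots> = (\<integral>\<xi>. (\<integral>\<eta>. \<Phi> (\<eta> n) \<xi> \<partial>distr M ?S ?\<xi>') \<partial>distr M ?S ?\<xi>)"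
  proof -
    have sets: "sets (distr M ?S ?\<xi> \<Otimes>\<^sub>M distr M ?S ?\<xi>') = sets (?S \<Otimes>\<^sub>M ?S)"
      by (intro sets_pair_measure_cong) auto
    have "integrable (distr M ?S ?\<xi> \<Otimes>\<^sub>M distr M ?S ?\<xi>') (\<lambda>(\<xi>, \<eta>). \<Phi> (\<eta> n) \<xi>)"
    proof (rule PP.integrable_const_bound[where B = B])
      show "(\<lambda>(\<xi>, \<eta>). \<Phi> (\<eta> n) \<xi>) \<in> borel_measurable (distr M ?S ?\<xi> \<Otimes>\<^sub>M distr M ?S ?\<xi>')"
        unfolding measurable_cong_sets[OF sets refl] by (rule \<Phi>')
    qed (use \<Phi>(2) in \<open>auto simp: case_prod_beta'\<close>)
    from PP.integral_fst'[OF this] show ?thesis by simp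
  qed
  also have "\<dots> = (\<integral>\<xi>. (\<integral>x. \<Phi> x \<xi> \<partial>F) \<partial>distr M ?S ?\<xi>)"
  proof (rule Bochner_Integration.integral_cong[OF refl])
    fix \<xi> assume "\<xi> \<in> space (distr M ?S ?\<xi>)"
    then have \<xi>S: "\<xi> \<in> space ?S" by simp
    have m: "(\<lambda>x. \<Phi> x \<xi>) \<in> borel_measurable borel"
      using measurable_compose[OF measurable_Pair2'[OF \<xi>S] \<Phi>(1)] by simp
    have "(\<integral>x. \<Phi> x \<xi> \<partial>F) = expectation (\<lambda>w. \<Phi> (X' n w) \<xi>)"
      unfolding distr_X'[OF n, symmetric] by (rule integral_distr) (use m in measurable)
    moreover have "(\<integral>\<eta>. \<Phi> (\<eta> n) \<xi> \<partial>distr M ?S ?\<xi>') = expectation (\<lambda>w. \<Phi> (X' n w) \<xi>)"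
      using measurable_compose[OF n_meas m] n by (subst integral_distr[OF \<xi>']) auto
    ultimately show "(\<integral>\<eta>. \<Phi> (\<eta> n) \<xi> \<partial>distr M ?S ?\<xi>') = (\<integral>x. \<Phi> x \<xi> \<partial>F)" by simp
  qed
  also have "\<dots> = expectation (\<lambda>w. LINT x|F. \<Phi> x (?\<xi> w))"
  proof (rule integral_distr[OF \<xi>])
    have "(\<lambda>(\<xi>, x). \<Phi> x \<xi>) \<in> borel_measurable (?S \<Otimes>\<^sub>M borel)"
      using measurable_compose[OF measurable_pair_swap' \<Phi>(1)] by (simp add: case_prod_beta')
    also have "borel_measurable (?S \<Otimes>\<^sub>M borel) = borel_measurable (?S \<Otimes>\<^sub>M F)"
      by (intro measurable_cong_sets sets_pair_measure_cong) auto
    finally show "(\<lambda>\<xi>. LINT x|F. \<Phi> x \<xi>) \<in> borel_measurable ?S"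
      by (rule F.borel_measurable_lebesgue_integral)
  qed
  finally show ?thesis .
qed

end

lemma le_powr_inverse_of_power_le:
  fixes x y :: real
  assumes "0 \<le> x" "x ^ n \<le> y" "0 < n"
  shows "x \<le> y powr (1 / n)"
proof (cases "x = 0")
  case False
  then have "x = (x powr n) powr (1 / n)" using assms by (simp add: powr_powr)
  also have "\<dots> = (x ^ n) powr (1 / n)" using assms False by (simp add: powr_realpow)
  also have "\<dots> \<le> y powr (1 / n)" using assms by (intro powr_mono2) auto
  finally show ?thesis .
qed simp

context decoupled begin

lemma X'_bounded: assumes "1 \<le> n" shows "AE w in M. \<bar>X' n w\<bar> \<le> C"
proof -
  have "AE x in distr M borel (X 1). \<bar>x\<bar> \<le> C"
    by (subst AE_distr_iff) (use X_1_bounded X_measurable in auto)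
  then have "AE x in distr M borel (X' n). \<bar>x\<bar> \<le> C" by (simp only: distr_X'[OF assms] distr_X_1)
  then show ?thesis by (subst (asm) AE_distr_iff) (use assms X'_measurable in auto)
qed

text \<open>After the replacement the tent at \<open>j0\<close> is independent of the other factors
  and keeps its law, so the expectation factorizes and the difference is exactly a
  covariance.\<close>

lemma tent_product_gap_le:
  fixes \<iota> :: "'k::finite \<Rightarrow> nat"
  assumes \<iota>: "inj \<iota>" "\<And>j. 1 \<le> \<iota> j" and r: "0 < r"
  shows "\<bar>expectation (\<lambda>w. \<Prod>j\<in>UNIV. tent (a j) r (X (\<iota> j) w))
      - expectation (\<lambda>w. \<Prod>j\<in>UNIV. tent (a j) r (if j = j0 then X' (\<iota> j0) w else X (\<iota> j) w))\<bar>
    \<le> (\<Sum>j\<in>-{j0}. covariance M (X (\<iota> j0)) (X (\<iota> j))) / r\<^sup>2"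
proof -
  let ?p = "\<lambda>w. \<Prod>j\<in>-{j0}. tent (a j) r (X (\<iota> j) w)" and ?t = "\<lambda>w. tent (a j0) r (X (\<iota> j0) w)"
  note [measurable] = X_measurable[OF \<iota>(2)]
  have split: "(\<Prod>j\<in>UNIV. q j) = q j0 * (\<Prod>j\<in>-{j0}. q j)" for q :: "'k \<Rightarrow> real"
    by (subst prod.remove[of UNIV j0]) (auto simp: Compl_eq_Diff_UNIV)
  have b: "ess_bounded ?t" "ess_bounded ?p"
    by (rule ess_boundedI[where c = 1];
        auto simp: tent_nonneg tent_le_1 r abs_prod intro!: prod_le_1)+
  have "expectation (\<lambda>w. \<Prod>j\<in>UNIV. tent (a j) r (X (\<iota> j) w))
      = covariance M ?t ?p + expectation ?t * expectation ?p"
    by (simp add: split covariance_eq[OF b])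
  moreover have "expectation (\<lambda>w. \<Prod>j\<in>UNIV. tent (a j) r (if j = j0 then X' (\<iota> j0) w else X (\<iota> j) w))
      = expectation (\<lambda>w. tent (a j0) r (X' (\<iota> j0) w)
          * (\<Prod>j\<in>-{j0}. tent (a j) r ((\<lambda>i\<in>{1..}. X i w) (\<iota> j))))"
    using \<iota>(2) by (intro Bochner_Integration.integral_cong refl) (auto simp: split intro!: prod.cong)
  moreover have "\<dots> = expectation (\<lambda>w. LINT x|F. tent (a j0) r x
      * (\<Prod>j\<in>-{j0}. tent (a j) r ((\<lambda>i\<in>{1..}. X i w) (\<iota> j))))"
  proof (rule expectation_X'[OF \<iota>(2), where B = 1])
    have [measurable]: "(\<lambda>\<xi>. \<xi> (\<iota> j)) \<in> Pi\<^sub>M {1..} (\<lambda>_. borel) \<rightarrow>\<^sub>M (borel :: real measure)" for j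
      by (rule measurable_component_singleton) (use \<iota>(2) in auto)
    show "(\<lambda>(x, \<xi>). tent (a j0) r x * (\<Prod>j\<in>-{j0}. tent (a j) r (\<xi> (\<iota> j))))
        \<in> borel_measurable (borel \<Otimes>\<^sub>M Pi\<^sub>M {1..} (\<lambda>_. borel))"
      by measurable
    show "\<bar>tent (a j0) r x * (\<Prod>j\<in>-{j0}. tent (a j) r (\<xi> (\<iota> j)))\<bar> \<le> 1" for x and \<xi> :: "nat \<Rightarrow> real"
      by (auto simp: tent_nonneg tent_le_1 r abs_mult abs_prod intro!: mult_le_one prod_le_1 prod_nonneg)
  qed
  moreover have "\<dots> = expectation ?t * expectation ?p"
    using \<iota>(2) integral_X[OF \<iota>(2) measurable_tent] by simp
  ultimately show ?thesis using covariance_tent_le[OF \<iota> r] by simp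
qed

text \<open>Degeneracy in the coordinate \<open>j0\<close> makes the expectation with the copy
  vanish, so the expectation is itself a difference of expectations under two densities. Of
  \<open>G\<close> only a bound enters the estimate.\<close>

lemma abs_expectation_degenerate_le:
  fixes \<iota> :: "'k::finite \<Rightarrow> nat" and G :: "real ^ 'k \<Rightarrow> real"
  defines "d \<equiv> CARD('k)"
  assumes \<iota>: "inj \<iota>" "\<And>j. 1 \<le> \<iota> j"
    and Z: "regular_vector L M (\<lambda>w. \<chi> j. X (\<iota> j) w)"
    and Z': "regular_vector L M (\<lambda>w. \<chi> j. if j = j0 then X' (\<iota> j0) w else X (\<iota> j) w)"
    and L: "0 < L"
    and G: "G \<in> borel_measurable borel" "\<And>x. \<bar>G x\<bar> \<le> B"
    and degenerate: "\<And>y. (LINT x|F. G (\<chi> j. if j = j0 then x else y j)) = 0"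
  shows "\<bar>expectation (\<lambda>w. G (\<chi> j. X (\<iota> j) w))\<bar>
    \<le> B * (2 ^ (d + 1) * (4 * L * d) ^ (d + 2)
        * (\<Sum>j\<in>-{j0}. covariance M (X (\<iota> j0)) (X (\<iota> j)))) powr (1 / (d + 3)) * (2 * C) ^ d"
proof -
  let ?Z = "\<lambda>w. \<chi> j. X (\<iota> j) w" and ?Z' = "\<lambda>w. \<chi> j. if j = j0 then X' (\<iota> j0) w else X (\<iota> j) w"
  let ?S = "\<Sum>j\<in>-{j0}. covariance M (X (\<iota> j0)) (X (\<iota> j))"
  note [measurable] = X_measurable[OF \<iota>(2)] X'_measurable[OF \<iota>(2)] G(1)
  obtain f where f: "\<And>x. 0 \<le> f x" "distributed M lborel ?Z (\<lambda>x. ennreal (f x))" "lipschitz1 L f"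
    using Z unfolding regular_vector_def by blast
  obtain g where g: "\<And>x. 0 \<le> g x" "distributed M lborel ?Z' (\<lambda>x. ennreal (g x))" "lipschitz1 L g"
    using Z' unfolding regular_vector_def by blast
  have gap: "\<bar>f x - g x\<bar> \<le> (2 ^ (d + 1) * (4 * L * d) ^ (d + 2) * ?S) powr (1 / (d + 3))" for x
  proof (rule le_powr_inverse_of_power_le)
    show "\<bar>f x - g x\<bar> ^ (d + 3) \<le> 2 ^ (d + 1) * (4 * L * d) ^ (d + 2) * ?S"
      unfolding d_def
      by (rule density_gap_power_le[OF f(2,1,3) g(2,1,3) L])
        (simp only: vec_lambda_beta, rule tent_product_gap_le[OF \<iota>])
  qed auto
  have "\<bar>expectation (\<lambda>w. G (?Z w)) - expectation (\<lambda>w. G (?Z' w))\<bar>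
      \<le> B * (2 ^ (d + 1) * (4 * L * d) ^ (d + 2) * ?S) powr (1 / (d + 3)) * (2 * C) ^ d"
    unfolding d_def
  proof (rule expectation_gap_le_density_gap[OF f(2,1) g(2,1) _ _ C_pos G gap[unfolded d_def]])
    show "AE w in M. \<forall>j. \<bar>?Z w $ j\<bar> \<le> C" "AE w in M. \<forall>j. \<bar>?Z' w $ j\<bar> \<le> C"
      using X_bounded[OF \<iota>(2)] X'_bounded[OF \<iota>(2)] by (auto simp: AE_all_countable)
  qed
  moreover have "expectation (\<lambda>w. G (?Z' w)) = 0"
  proof -
    have "expectation (\<lambda>w. G (?Z' w)) = expectation (\<lambda>w. G (\<chi> j. if j = j0 then X' (\<iota> j0) w
        else (\<lambda>i\<in>{1..}. X i w) (\<iota> j)))"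
      using \<iota>(2) by (intro Bochner_Integration.integral_cong refl arg_cong[of _ _ G])
        (auto simp: vec_eq_iff)
    also have "\<dots> = expectation (\<lambda>w. LINT x|F. G (\<chi> j. if j = j0 then x
        else (\<lambda>i\<in>{1..}. X i w) (\<iota> j)))"
    proof (rule expectation_X'[where \<Phi> = "\<lambda>x \<xi>. G (\<chi> j. if j = j0 then x else \<xi> (\<iota> j))", OF \<iota>(2) _ G(2)])
      have [measurable]: "(\<lambda>\<xi>. \<xi> (\<iota> j)) \<in> Pi\<^sub>M {1..} (\<lambda>_. borel) \<rightarrow>\<^sub>M (borel :: real measure)" for j
        by (rule measurable_component_singleton) (use \<iota>(2) in auto)
      show "(\<lambda>(x, \<xi>). G (\<chi> j. if j = j0 then x else \<xi> (\<iota> j)))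
          \<in> borel_measurable (borel \<Otimes>\<^sub>M Pi\<^sub>M {1..} (\<lambda>_. borel))"
        by measurable
    qed
    also have "\<dots> = 0" using degenerate by simp
    finally show ?thesis .
  qed
  ultimately show ?thesis by simp
qed

end

section \<open>Summation over quadruples of indices\<close>

text \<open>One factor \<open>b i\<close> is kept and the others are enlarged to the full sum. The
  exponent is a successor because with exponent 0 the left side would count
  \<open>Q\<close>.\<close>

lemma sum_power_le_power_sum:
  fixes b :: "'i \<Rightarrow> real"
  assumes "\<And>i. i \<in> Q \<Longrightarrow> 0 \<le> b i"
  shows "(\<Sum>i\<in>Q. b i ^ Suc n) \<le> (\<Sum>i\<in>Q. b i) ^ Suc n"
proof (cases "finite Q")
  case True
  have "(\<Sum>i\<in>Q. b i ^ Suc n) \<le> (\<Sum>i\<in>Q. b i * (\<Sum>i\<in>Q. b i) ^ n)"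
    unfolding power_Suc using assms True
    by (intro sum_mono mult_left_mono power_mono member_le_sum) auto
  then show ?thesis by (simp add: sum_distrib_right)
qed simp

text \<open>With the exponents \<open>1/6\<close> and \<open>1/7\<close> that the vectors of dimension three and four
  provide, a bound by sums of covariances becomes a bound by the cube of a sum of their
  \<open>1/21\<close>-th powers.\<close>

lemma le_cube_of_le_powr:
  fixes e P K R :: real and a :: "'i \<Rightarrow> real" and m :: nat
  assumes e: "e \<le> P * (K * (\<Sum>q\<in>Q. a q)) powr (1 / m)" "e \<le> R"
    and pos: "0 \<le> P" "0 \<le> K" "0 \<le> R" "\<And>q. q \<in> Q \<Longrightarrow> 0 \<le> a q" and m: "0 < m" "m \<le> 7"
  shows "e \<le> (P * K powr (1 / m) + R) * (min 1 (\<Sum>q\<in>Q. a q powr (1 / 21))) ^ 3"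
proof -
  let ?s = "\<Sum>q\<in>Q. a q powr (1 / 21)"
  have s: "0 \<le> ?s" by (simp add: sum_nonneg)
  have PK: "0 \<le> P * K powr (1 / m)" using pos by simp
  show ?thesis
  \<comment> \<open>A sum of at least 1 makes the cap equal to 1, and then the trivial bound
    \<open>R\<close> suffices.\<close>
  proof (cases "1 \<le> ?s")
    case True
    then show ?thesis using e(2) PK by simp
  next
    case False
    have "a q = (a q powr (1 / 21)) ^ 21" if "q \<in> Q" for q
      using pos(4)[OF that] by (cases "a q = 0") (simp_all add: powr_power)
    then have "(\<Sum>q\<in>Q. a q) = (\<Sum>q\<in>Q. (a q powr (1 / 21)) ^ Suc 20)"
      by (intro sum.cong) auto
    also have "\<dots> \<le> ?s ^ Suc 20" by (rule sum_power_le_power_sum) simp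
    finally have "(\<Sum>q\<in>Q. a q) \<le> ?s ^ 21" by simp
    then have "(K * (\<Sum>q\<in>Q. a q)) powr (1 / m) \<le> (K * ?s ^ 21) powr (1 / m)"
      using pos by (intro powr_mono2 mult_left_mono mult_nonneg_nonneg sum_nonneg) auto
    also have "\<dots> = K powr (1 / m) * ?s powr (21 / m)"
    proof (cases "?s = 0")
      case False
      with s have "?s ^ 21 = ?s powr 21" using powr_realpow[of ?s 21] by simp
      then have "(?s ^ 21) powr (1 / m) = ?s powr (21 / m)" by (simp only: powr_powr) simp
      then show ?thesis using s pos by (simp add: powr_mult)
    qed (use m in simp)
    also have "\<dots> \<le> K powr (1 / m) * ?s ^ 3"
    proof (rule mult_left_mono)
      \<comment> \<open>Since \<open>m \<le> 7\<close>, the power obtained is at least the third,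
        and a base below 1 allows lowering the exponent to 3. This puts the cases
        \<open>m = 6\<close> and \<open>m = 7\<close> into one form.\<close>
      have "3 \<le> 21 / real m" using m by (simp add: field_simps)
      then have "?s powr (21 / m) \<le> ?s powr 3" using s False by (intro powr_mono') auto
      then show "?s powr (21 / m) \<le> ?s ^ 3" 
        using s powr_realpow[of ?s 3] by (cases "?s = 0") auto
    qed simp
    finally have "e \<le> P * (K powr (1 / m) * ?s ^ 3)"
      using e(1) pos(1) by (meson mult_left_mono order_trans)
    also have "\<dots> \<le> (P * K powr (1 / m) + R) * ?s ^ 3"
      using pos s by (simp add: distrib_right)
    finally show ?thesis using False by simp
  qed
qed

text \<open>The smallest of three bounds is at most their geometric mean; stating the bounds as
  cubes avoids taking roots.\<close>

lemma le_mult3_of_le_cubes: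
  fixes e K u v w :: real
  assumes "e \<le> K * u ^ 3" "e \<le> K * v ^ 3" "e \<le> K * w ^ 3" "0 \<le> K" "0 \<le> u" "0 \<le> v" "0 \<le> w"
  shows "e \<le> K * (u * v * w)"
proof -
  define m where "m = min u (min v w)"
  have "m ^ 3 = u ^ 3 \<or> m ^ 3 = v ^ 3 \<or> m ^ 3 = w ^ 3" by (auto simp: m_def min_def)
  then have "e \<le> K * m ^ 3" using assms(1-3) by auto
  also have "m ^ 3 \<le> u * v * w"
    using assms(5-7) unfolding power3_eq_cube by (intro mult_mono) (auto simp: m_def)
  finally show ?thesis using assms(4) by (simp add: mult_left_mono)
qed

text \<open>The second elementary symmetric polynomial of six variables, one product for each of the
  fifteen pairs.\<close>

definition esym2 :: "real \<Rightarrow> real \<Rightarrow> real \<Rightarrow> real \<Rightarrow> real \<Rightarrow> real \<Rightarrow> real" where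
  "esym2 x y z u v w = x * y + x * z + x * u + x * v + x * w + y * z + y * u + y * v + y * w
     + z * u + z * v + z * w + u * v + u * w + v * w"

text \<open>Think of \<open>x\<close>, \<open>y\<close>, \<open>z\<close>, \<open>u\<close>, \<open>v\<close>, \<open>w\<close> as weights of the edges \<open>ij\<close>, \<open>ik\<close>, \<open>il\<close>, \<open>jk\<close>, \<open>jl\<close>, \<open>kl\<close>
  of a graph on four vertices. The three factors collect the edges at \<open>i\<close>, \<open>j\<close> and \<open>k\<close>; as no
  edge contains all three vertices, each term of the product has two different edges.\<close>

lemma three_stars_le_esym2:
  assumes "x \<in> {0..1}" "y \<in> {0..1}" "z \<in> {0..1}" "u \<in> {0..1}" "v \<in> {0..1}" "w \<in> {0..1}"
  shows "(x + y + z) * (x + u + v) * (y + u + w) \<le> 4 * esym2 x y z u v w"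
proof -
  have nn: "0 \<le> x * y" "0 \<le> x * z" "0 \<le> x * u" "0 \<le> x * v" "0 \<le> x * w" "0 \<le> y * z" "0 \<le> y * u"
      "0 \<le> y * v" "0 \<le> y * w" "0 \<le> z * u" "0 \<le> z * v" "0 \<le> z * w" "0 \<le> u * v" "0 \<le> u * w" "0 \<le> v * w"
    using assms by auto
  let ?e = "esym2 x y z u v w"
  \<comment> \<open>The square of the common edge \<open>ij\<close> is the only term in the product
    of the first two stars that lacks two different edges.\<close>
  have "x * x \<le> x * 1" using assms by (intro mult_left_mono) auto
  then have "(x + y + z) * (x + u + v) \<le> x + ?e"
    using nn unfolding esym2_def by (simp add: algebra_simps)
  then have "(x + y + z) * (x + u + v) * (y + u + w) \<le> (x + ?e) * (y + u + w)"
    using assms by (intro mult_right_mono) auto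
  also have "\<dots> = x * (y + u + w) + ?e * (y + u + w)" by (simp add: distrib_right)
  \<comment> \<open>The third star does not contain \<open>x\<close>, so the leftover single edge is
    paired with a different one.\<close>
  also have "x * (y + u + w) \<le> ?e" using nn unfolding esym2_def by (simp add: algebra_simps)
  also have "?e * (y + u + w) \<le> ?e * 3"
    using assms nn by (intro mult_left_mono) (auto simp: esym2_def)
  finally show ?thesis by simp
qed

definition sum4 :: "'i set \<Rightarrow> ('i \<Rightarrow> 'i \<Rightarrow> 'i \<Rightarrow> 'i \<Rightarrow> real) \<Rightarrow> real" where
  "sum4 A f = (\<Sum>i\<in>A. \<Sum>j\<in>A. \<Sum>k\<in>A. \<Sum>l\<in>A. f i j k l)"

lemma sum4_swap12: "sum4 A (\<lambda>i j k l. f j i k l) = sum4 A f"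
  unfolding sum4_def by (rule sum.swap)

lemma sum4_swap23: "sum4 A (\<lambda>i j k l. f i k j l) = sum4 A f"
  unfolding sum4_def by (intro sum.cong refl sum.swap)

lemma sum4_swap34: "sum4 A (\<lambda>i j k l. f i j l k) = sum4 A f"
  unfolding sum4_def by (intro sum.cong refl sum.swap)

text \<open>Of the fifteen pairs of edges of the complete graph on four vertices, three are disjoint
  and twelve share a vertex. Permuting the summation indices reduces them to two shapes. In a
  disjoint pair each edge sums to at most \<open>card A * B\<close>; in a pair sharing a vertex two
  indices are summed along rows and two remain free.\<close>

lemma sum4_esym2_le:
  fixes \<beta> :: "'i \<Rightarrow> 'i \<Rightarrow> real" and B :: real
  assumes A: "finite A" and nn: "\<And>i j. 0 \<le> \<beta> i j" and sym: "\<And>i j. \<beta> i j = \<beta> j i"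
    and B: "\<And>i. i \<in> A \<Longrightarrow> (\<Sum>j\<in>A. \<beta> i j) \<le> B"
  shows "sum4 A (\<lambda>i j k l. esym2 (\<beta> i j) (\<beta> i k) (\<beta> i l) (\<beta> j k) (\<beta> j l) (\<beta> k l))
    \<le> 15 * (card A * B)\<^sup>2"
proof -
  let ?R = "\<lambda>i. \<Sum>j\<in>A. \<beta> i j"
  have R: "0 \<le> ?R i" for i by (simp add: sum_nonneg nn)
  have sR: "0 \<le> sum ?R A" "sum ?R A \<le> card A * B"
    using sum_bounded_above[of A ?R B] B by (auto intro: sum_nonneg R)
  have "sum4 A (\<lambda>i j k l. \<beta> i j * \<beta> k l) = sum ?R A * sum ?R A"
    unfolding sum4_def by (simp add: sum_distrib_left[symmetric] sum_distrib_right[symmetric])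
  also have "\<dots> \<le> (card A * B)\<^sup>2" using sR unfolding power2_eq_square by (intro mult_mono) auto
  finally have disjoint: "sum4 A (\<lambda>i j k l. \<beta> i j * \<beta> k l) \<le> (card A * B)\<^sup>2" .
  have "sum4 A (\<lambda>i j k l. \<beta> i j * \<beta> i k) = (\<Sum>i\<in>A. card A * (?R i * ?R i))"
    unfolding sum4_def
    by (simp add: sum_distrib_left[symmetric] sum_distrib_right[symmetric])
  also have "\<dots> \<le> (\<Sum>i\<in>A. card A * (B * B))"
    using B R by (intro sum_mono mult_left_mono mult_mono) (auto intro: order_trans[OF R])
  also have "\<dots> = (card A * B)\<^sup>2" by (simp add: power2_eq_square)
  finally have star: "sum4 A (\<lambda>i j k l. \<beta> i j * \<beta> i k) \<le> (card A * B)\<^sup>2" .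
  note s12 = ord_eq_le_trans[OF sum4_swap12] and s23 = ord_eq_le_trans[OF sum4_swap23]
    and s34 = ord_eq_le_trans[OF sum4_swap34]
  have i: "sum4 A (\<lambda>i j k l. \<beta> i j * \<beta> i l) \<le> (card A * B)\<^sup>2"
    by (rule s34) (rule star)
  have i': "sum4 A (\<lambda>i j k l. \<beta> i k * \<beta> i l) \<le> (card A * B)\<^sup>2"
    by (rule s23) (rule i)
  have j: "sum4 A (\<lambda>i j k l. \<beta> j i * \<beta> j k) \<le> (card A * B)\<^sup>2"
    by (rule s12) (rule star)
  have j': "sum4 A (\<lambda>i j k l. \<beta> j i * \<beta> j l) \<le> (card A * B)\<^sup>2"
    by (rule s12) (rule i)
  have j'': "sum4 A (\<lambda>i j k l. \<beta> j k * \<beta> j l) \<le> (card A * B)\<^sup>2"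
    by (rule s12) (rule i')
  have k: "sum4 A (\<lambda>i j k l. \<beta> k i * \<beta> k j) \<le> (card A * B)\<^sup>2"
    by (rule s23) (rule j)
  have k': "sum4 A (\<lambda>i j k l. \<beta> k i * \<beta> k l) \<le> (card A * B)\<^sup>2"
    by (rule s23) (rule j')
  have k'': "sum4 A (\<lambda>i j k l. \<beta> k j * \<beta> k l) \<le> (card A * B)\<^sup>2"
    by (rule s23) (rule j'')
  have l: "sum4 A (\<lambda>i j k l. \<beta> l i * \<beta> l j) \<le> (card A * B)\<^sup>2"
    by (rule s34) (rule k)
  have l': "sum4 A (\<lambda>i j k l. \<beta> l i * \<beta> l k) \<le> (card A * B)\<^sup>2"
    by (rule s34) (rule k')
  have l'': "sum4 A (\<lambda>i j k l. \<beta> l j * \<beta> l k) \<le> (card A * B)\<^sup>2"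
    by (rule s34) (rule k'')
  have d': "sum4 A (\<lambda>i j k l. \<beta> i k * \<beta> j l) \<le> (card A * B)\<^sup>2"
    by (rule s23) (rule disjoint)
  have d'': "sum4 A (\<lambda>i j k l. \<beta> i l * \<beta> j k) \<le> (card A * B)\<^sup>2"
    by (rule s34) (rule d')
  \<comment> \<open>Each factor is turned so that the shared vertex comes first, which is the form
    of the fifteen estimates above.\<close>
  have e: "esym2 (\<beta> i j) (\<beta> i k) (\<beta> i l) (\<beta> j k) (\<beta> j l) (\<beta> k l)
     = \<beta> i j * \<beta> k l + \<beta> i k * \<beta> j l + \<beta> i l * \<beta> j k
       + \<beta> i j * \<beta> i k + \<beta> i j * \<beta> i l + \<beta> i k * \<beta> i l
       + \<beta> j i * \<beta> j k + \<beta> j i * \<beta> j l + \<beta> j k * \<beta> j l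
       + \<beta> k i * \<beta> k j + \<beta> k i * \<beta> k l + \<beta> k j * \<beta> k l
       + \<beta> l i * \<beta> l j + \<beta> l i * \<beta> l k + \<beta> l j * \<beta> l k" for i j k l
    unfolding esym2_def using sym[of j i] sym[of k i] sym[of l i] sym[of k j] sym[of l j] sym[of l k]
    by simp
  have add: "sum4 A (\<lambda>i j k l. f i j k l + g i j k l) = sum4 A f + sum4 A g" for f g
    unfolding sum4_def by (simp add: sum.distrib)
  show ?thesis unfolding e add
    using disjoint d' d'' star i i' j j' j'' k k' k'' l l' l'' by linarith
qed

section \<open>The degenerate part of the kernel\<close>

locale ustat_setting = decoupled M X F C X' for M :: "'a measure" and X F C X' +
  fixes \<rho> :: "real \<Rightarrow> real \<Rightarrow> real" and C2 :: real
  assumes rho_measurable: "(\<lambda>(x, y). \<rho> x y) \<in> borel_measurable (borel :: (real \<times> real) measure)"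
    and rho_sym: "\<And>x y. \<rho> x y = \<rho> y x"
    and rho_bounded: "\<And>x y. \<bar>\<rho> x y\<bar> \<le> C2"
    and summable_cov: "summable (\<lambda>j. covariance M (X 1) (X (Suc j)) powr (1 / 21))"
    and T1: "cond_T1 M X X'" and T2: "cond_T2 M X X'"
begin

sublocale F: prob_space F by (rule prob_space_F)

abbreviation "r1 \<equiv> rho1 \<rho> F"

lemma measurable_rho [measurable (raw)]:
  "f \<in> borel_measurable N \<Longrightarrow> g \<in> borel_measurable N \<Longrightarrow> (\<lambda>x. \<rho> (f x) (g x)) \<in> borel_measurable N"
  using measurable_compose[OF borel_measurable_Pair rho_measurable, of f N g] by simp

lemma measurable_rho1 [measurable]: "r1 \<in> borel_measurable borel"
proof -
  have "(\<lambda>(x, y). \<rho> x y) \<in> borel_measurable (borel \<Otimes>\<^sub>M F)"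
    using rho_measurable unfolding borel_prod[symmetric]
    by (subst measurable_cong_sets[OF sets_pair_measure_cong refl]) auto
  from F.borel_measurable_lebesgue_integral[OF this] show ?thesis
    by (simp add: rho1_def[abs_def])
qed

lemma integrable_rho: "integrable F (\<lambda>y. \<rho> x y)"
  by (rule F.integrable_const_bound[where B = C2])
    (auto simp: rho_bounded measurable_cong_sets[OF sets_F refl])

lemma C2_nonneg: "0 \<le> C2"
  using rho_bounded[of 0 0] by linarith

lemma abs_rho1_le: "\<bar>r1 x\<bar> \<le> C2"
proof -
  have "\<bar>r1 x\<bar> \<le> (LINT y|F. \<bar>\<rho> x y\<bar>)" unfolding rho1_def by (rule integral_abs_bound)
  also have "\<dots> \<le> (LINT y|F. C2)"
    by (intro integral_mono integrable_abs integrable_rho) (auto simp: rho_bounded)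
  also have "\<dots> = C2" by (simp add: F.prob_space[simplified])
  finally show ?thesis .
qed

lemma integrable_rho1: "integrable F r1"
  by (rule F.integrable_const_bound[where B = C2])
    (auto simp: abs_rho1_le measurable_cong_sets[OF sets_F refl])

lemma theta_eq: "theta \<rho> F = integral\<^sup>L F r1"
  by (simp add: theta_def rho1_def[abs_def])

lemma abs_theta_le: "\<bar>theta \<rho> F\<bar> \<le> C2"
proof -
  have "\<bar>theta \<rho> F\<bar> \<le> (LINT y|F. \<bar>r1 y\<bar>)" unfolding theta_eq by (rule integral_abs_bound)
  also have "\<dots> \<le> (LINT y|F. C2)"
    by (intro integral_mono integrable_abs integrable_rho1) (auto simp: abs_rho1_le)
  also have "\<dots> = C2" by (simp add: F.prob_space[simplified])
  finally show ?thesis .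
qed

text \<open>Hoeffding's canonical kernel: the constant compensates the mean that is subtracted
  twice, so integrating out either variable gives 0.\<close>

definition h :: "real \<Rightarrow> real \<Rightarrow> real" where
  "h x y = \<rho> x y - r1 x - r1 y + theta \<rho> F"

lemma h_sym: "h x y = h y x"
  unfolding h_def using rho_sym[of x y] by simp

lemma abs_h_le: "\<bar>h x y\<bar> \<le> 4 * C2"
  unfolding h_def using rho_bounded[of x y] abs_rho1_le[of x] abs_rho1_le[of y] abs_theta_le by linarith

lemma measurable_h [measurable (raw)]:
  "f \<in> borel_measurable N \<Longrightarrow> g \<in> borel_measurable N \<Longrightarrow> (\<lambda>x. h (f x) (g x)) \<in> borel_measurable N"
  unfolding h_def
  by (intro borel_measurable_add borel_measurable_diff borel_measurable_const measurable_rho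
    measurable_compose[OF _ measurable_rho1])

lemma integral_h: "(LINT x|F. h x y) = 0" "(LINT x|F. h y x) = 0"
proof -
  have "(LINT x|F. h y x) = r1 y - r1 y - theta \<rho> F + theta \<rho> F"
    unfolding h_def using integrable_rho[of y] integrable_rho1
    by (simp add: theta_eq F.prob_space[simplified] rho1_def[symmetric])
  then show "(LINT x|F. h y x) = 0" by simp
  then show "(LINT x|F. h x y) = 0" by (simp add: h_sym[of _ y])
qed

definition acov :: "nat \<Rightarrow> real" where
  "acov d = covariance M (X 1) (X (1 + d))"

lemma covariance_X: "1 \<le> i \<Longrightarrow> 1 \<le> j \<Longrightarrow> covariance M (X i) (X j) = acov (ndist i j)"
  using covariance_ndist[of i j "\<lambda>x. x"] by (simp add: acov_def)

text \<open>Coordinate projections dominate themselves, so the absolute value of the covariance is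
  at most the covariance.\<close>

lemma acov_nonneg: "0 \<le> acov d"
proof -
  have "\<bar>covariance M (\<lambda>w. (\<lambda>x. x 1) (\<lambda>j. X j w)) (\<lambda>w. (\<lambda>x. x (1 + d)) (\<lambda>j. X j w))\<bar>
    \<le> covariance M (\<lambda>w. (\<lambda>x. x 1) (\<lambda>j. X j w)) (\<lambda>w. (\<lambda>x. x (1 + d)) (\<lambda>j. X j w))"
    by (rule abs_covariance_le_dominated[where J = "{1, 1 + d}"])
      (auto intro!: finitely_associated_X ess_bounded_X simp: coordwise_dominated_def)
  then show ?thesis by (simp add: acov_def)
qed

text \<open>The cap keeps the weights in [0, 1], as the inequality for three stars requires. A
  coincidence of indices counts as an edge of full weight.\<close>

definition wt :: "nat \<Rightarrow> nat \<Rightarrow> real" where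
  "wt i j = (if i = j then 1 else min 1 (acov (ndist i j) powr (1 / 21)))"

lemma wt_bounds: "0 \<le> wt i j" "wt i j \<le> 1"
  by (auto simp: wt_def)

lemma wt_refl: "wt i i = 1"
  by (simp add: wt_def)

lemma wt_sym: "wt i j = wt j i"
  by (simp add: wt_def ndist_def add.commute)

lemma sum_wt_bounded: "\<exists>B. \<forall>n i. (\<Sum>j\<in>{1..n}. wt i j) \<le> B"
proof -
  define g where "g d = (if d = 0 then 1 else min 1 (acov d powr (1 / 21)))" for d
  have g: "0 \<le> g d" for d by (simp add: g_def)
  have wt: "wt i j = g (ndist i j)" for i j by (auto simp: wt_def g_def ndist_def)
  have "summable g"
  proof (rule summable_comparison_test_ev)
    show "summable (\<lambda>d. acov d powr (1 / 21))" using summable_cov by (simp add: acov_def)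
    show "\<forall>\<^sub>F d in sequentially. norm (g d) \<le> acov d powr (1 / 21)"
      using eventually_gt_at_top[of 0] by eventually_elim (simp add: g_def)
  qed
  then have le: "sum g D \<le> suminf g" if "finite D" for D using that g by (intro sum_le_suminf) auto
  have "(\<Sum>j\<in>{1..n}. wt i j) \<le> 2 * suminf g" for n i
  proof -
    \<comment> \<open>Each lag occurs at most once on either side of \<open>i\<close>, so two copies
      of the series suffice; the overlap \<open>j = i\<close> is counted twice.\<close>
    have "(\<Sum>j\<in>{1..n}. wt i j) = sum (wt i) ({1..n} \<inter> {..i} \<union> {1..n} \<inter> {i..})"
      by (intro sum.cong) auto
    also have "\<dots> \<le> sum (wt i) ({1..n} \<inter> {..i} \<union> {1..n} \<inter> {i..})
        + sum (wt i) ({1..n} \<inter> {..i} \<inter> ({1..n} \<inter> {i..}))"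
      by (simp add: sum_nonneg wt_bounds)
    also have "\<dots> = (\<Sum>j\<in>{1..n} \<inter> {..i}. wt i j) + (\<Sum>j\<in>{1..n} \<inter> {i..}. wt i j)"
      by (rule sum.union_inter) auto
    finally have "(\<Sum>j\<in>{1..n}. wt i j)
      \<le> (\<Sum>j\<in>{1..n} \<inter> {..i}. wt i j) + (\<Sum>j\<in>{1..n} \<inter> {i..}. wt i j)" .
    also have "(\<Sum>j\<in>{1..n} \<inter> {..i}. wt i j) = sum g ((\<lambda>j. i - j) ` ({1..n} \<inter> {..i}))"
      by (subst sum.reindex) (auto simp: inj_on_def wt ndist_def intro!: sum.cong)
    also have "\<dots> \<le> suminf g" by (rule le) auto
    also have "(\<Sum>j\<in>{1..n} \<inter> {i..}. wt i j) = sum g ((\<lambda>j. j - i) ` ({1..n} \<inter> {i..}))"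
      by (subst sum.reindex) (auto simp: inj_on_def wt ndist_def intro!: sum.cong)
    also have "\<dots> \<le> suminf g" by (rule le) auto
    finally show ?thesis by simp
  qed
  then show ?thesis by blast
qed

lemma abs_expectation_le:
  fixes f :: "'a \<Rightarrow> real"
  assumes "f \<in> borel_measurable M" "\<And>w. \<bar>f w\<bar> \<le> R"
  shows "\<bar>expectation f\<bar> \<le> R"
proof -
  have "\<bar>expectation f\<bar> \<le> expectation (\<lambda>w. \<bar>f w\<bar>)" by (rule integral_abs_bound)
  also have "\<dots> \<le> expectation (\<lambda>w. R)"
    using assms order_trans[OF abs_ge_zero assms(2)]
    by (intro integral_mono integrable_abs integrable_const_bound[where B = R]) auto
  finally show ?thesis by (simp add: prob_space)
qed

text \<open>\<open>K\<close> is chosen before the indices, the replaced coordinate and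
  \<open>G\<close>; only this uniformity allows summation over all quadruples. The restriction to
  dimension at most 4 keeps the root \<open>d + 3\<close> at most 7, where 21 / 7 is the exponent
  3.\<close>

lemma abs_expectation_degenerate_le_wt:
  fixes G :: "real ^ 'k \<Rightarrow> real"
  assumes k: "CARD('k) \<le> 4" and L: "0 < L"
  shows "\<exists>K\<ge>0. \<forall>(\<iota> :: 'k \<Rightarrow> nat) j0 G. inj \<iota> \<longrightarrow> (\<forall>j. 1 \<le> \<iota> j)
      \<longrightarrow> regular_vector L M (\<lambda>w. \<chi> j. X (\<iota> j) w)
      \<longrightarrow> regular_vector L M (\<lambda>w. \<chi> j. if j = j0 then X' (\<iota> j0) w else X (\<iota> j) w)
      \<longrightarrow> G \<in> borel_measurable borel \<longrightarrow> (\<forall>x. \<bar>G x\<bar> \<le> B)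
      \<longrightarrow> (\<forall>y. (LINT x|F. G (\<chi> j. if j = j0 then x else y j)) = 0)
      \<longrightarrow> \<bar>expectation (\<lambda>w. G (\<chi> j. X (\<iota> j) w))\<bar> \<le> K * (\<Sum>j\<in>-{j0}. wt (\<iota> j0) (\<iota> j)) ^ 3"
proof (cases "0 \<le> B")
  case False
  \<comment> \<open>For negative \<open>B\<close> no \<open>G\<close> satisfies the bound, so any
    constant serves.\<close>
  then have "\<nexists>G. \<forall>x. \<bar>G x\<bar> \<le> B" by (auto simp: not_le intro: order_less_le_trans[of B 0])
  then show ?thesis by (intro exI[of _ 0] conjI order_refl allI impI) blast
next
  case B: True
  let ?d = "CARD('k)"
  let ?P = "B * (2 * C) ^ ?d" and ?K = "2 ^ (?d + 1) * (4 * L * ?d) ^ (?d + 2)"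
  have P: "0 \<le> ?P" and K: "0 \<le> ?K" using B C_pos L by auto
  show ?thesis
  proof (intro exI[of _ "?P * ?K powr (1 / (?d + 3)) + B"] conjI allI impI)
    fix \<iota> :: "'k \<Rightarrow> nat" and j0 and G :: "real ^ 'k \<Rightarrow> real"
    assume \<iota>: "inj \<iota>" "\<forall>j. 1 \<le> \<iota> j"
      and reg: "regular_vector L M (\<lambda>w. \<chi> j. X (\<iota> j) w)"
        "regular_vector L M (\<lambda>w. \<chi> j. if j = j0 then X' (\<iota> j0) w else X (\<iota> j) w)"
      and G: "G \<in> borel_measurable borel" "\<forall>x. \<bar>G x\<bar> \<le> B"
        "\<forall>y. (LINT x|F. G (\<chi> j. if j = j0 then x else y j)) = 0"
    let ?a = "\<lambda>j. acov (ndist (\<iota> j0) (\<iota> j))"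
    note [measurable] = G(1) X_measurable[OF \<iota>(2)[rule_format]]
    have "\<bar>expectation (\<lambda>w. G (\<chi> j. X (\<iota> j) w))\<bar>
        \<le> ?P * (?K * (\<Sum>j\<in>-{j0}. ?a j)) powr (1 / (?d + 3))"
      using abs_expectation_degenerate_le[OF \<iota>(1) \<iota>(2)[rule_format] reg L G(1) G(2,3)[rule_format]]
        \<iota>(2) by (simp add: covariance_X mult_ac)
    moreover have "\<bar>expectation (\<lambda>w. G (\<chi> j. X (\<iota> j) w))\<bar> \<le> B"
      by (rule abs_expectation_le) (use G(2) in auto)
    ultimately have "\<bar>expectation (\<lambda>w. G (\<chi> j. X (\<iota> j) w))\<bar>
        \<le> (?P * ?K powr (1 / (?d + 3)) + B) * (min 1 (\<Sum>j\<in>-{j0}. ?a j powr (1 / 21))) ^ 3"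
      using P K B acov_nonneg k by (intro le_cube_of_le_powr[of _ _ _ ?a "-{j0}"]) auto
    also have "\<dots> \<le> (?P * ?K powr (1 / (?d + 3)) + B) * (\<Sum>j\<in>-{j0}. wt (\<iota> j0) (\<iota> j)) ^ 3"
    proof (intro mult_left_mono power_mono)
      have ne: "\<iota> j0 \<noteq> \<iota> j" if "j \<in> -{j0}" for j using \<iota>(1) that by (auto dest: injD)
      \<comment> \<open>On the left the sum is capped, on the right each term. If one term reaches
        1, its weight alone is already 1; otherwise no term is capped.\<close>
      show "min 1 (\<Sum>j\<in>-{j0}. ?a j powr (1 / 21)) \<le> (\<Sum>j\<in>-{j0}. wt (\<iota> j0) (\<iota> j))"
      proof (cases "\<exists>j\<in>-{j0}. 1 \<le> ?a j powr (1 / 21)")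
        case True
        then obtain j where j: "j \<in> -{j0}" "1 \<le> ?a j powr (1 / 21)" by blast
        then have "1 = wt (\<iota> j0) (\<iota> j)" using ne by (simp add: wt_def)
        also have "\<dots> \<le> (\<Sum>j\<in>-{j0}. wt (\<iota> j0) (\<iota> j))"
          using j by (intro member_le_sum) (auto simp: wt_bounds)
        finally show ?thesis by simp
      next
        case False
        have "(\<Sum>j\<in>-{j0}. ?a j powr (1 / 21)) = (\<Sum>j\<in>-{j0}. wt (\<iota> j0) (\<iota> j))"
        proof (rule sum.cong[OF refl])
          fix j assume j: "j \<in> -{j0}"
          then have "?a j powr (1 / 21) \<le> 1" using False by (auto simp: not_le less_imp_le)
          then show "?a j powr (1 / 21) = wt (\<iota> j0) (\<iota> j)" using ne[OF j] by (simp add: wt_def min_def)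
        qed
        then show ?thesis by simp
      qed
    qed (use P B in \<open>auto intro!: sum_nonneg\<close>)
    finally show "\<bar>expectation (\<lambda>w. G (\<chi> j. X (\<iota> j) w))\<bar>
      \<le> (?P * ?K powr (1 / (?d + 3)) + B) * (\<Sum>j\<in>-{j0}. wt (\<iota> j0) (\<iota> j)) ^ 3" .
  qed (use P B in auto)
qed

end

lemma Compl_4: "- {1::4} = {2, 3, 4}" "- {2::4} = {1, 3, 4}" "- {3::4} = {1, 2, 4}"
  by (simp_all add: set_eq_iff forall_4)

lemma Compl_3: "- {1::3} = {2, 3}"
  by (simp add: set_eq_iff forall_3)

lemma vector_4: "(vector [a, b, c, d] :: 'b::zero ^ 4) $ 1 = a" "(vector [a, b, c, d] :: 'b ^ 4) $ 2 = b"
    "(vector [a, b, c, d] :: 'b ^ 4) $ 3 = c" "(vector [a, b, c, d] :: 'b ^ 4) $ 4 = d"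
  unfolding vector_def by simp_all

abbreviation "pairs n \<equiv> {(j1, j2). 1 \<le> j1 \<and> j1 < j2 \<and> j2 \<le> (n :: nat)}"

section \<open>The second moment of the degenerate sum\<close>

context ustat_setting begin

text \<open>With four different indices each variable occurs in only one factor \<open>h\<close>, so
  the product is degenerate in each coordinate. The replacements at \<open>i\<close>,
  \<open>j\<close> and \<open>k\<close> bound the same number by the cubes of three stars.\<close>

lemma expectation_hh_disjoint_le:
  "\<exists>K\<ge>0. \<forall>i j k l. 1 \<le> i \<and> i < j \<and> 1 \<le> k \<and> k < l \<and> distinct [i, j, k, l] \<longrightarrow>
    \<bar>expectation (\<lambda>w. h (X i w) (X j w) * h (X k w) (X l w))\<bar>
    \<le> K * ((wt i j + wt i k + wt i l) * (wt i j + wt j k + wt j l) * (wt i k + wt j k + wt k l))"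
proof -
  obtain L where L: "0 < L" and T: "\<forall>n i1 i2 i3 i4. distinct [i1, i2, i3, i4] \<and>
        1 \<le> i1 \<and> i1 < i2 \<and> i2 \<le> n \<and> 1 \<le> i3 \<and> i3 < i4 \<and> i4 \<le> n \<longrightarrow>
        regular_vector L M (\<lambda>w. vector [X i1 w, X i2 w, X i3 w, X i4 w] :: real ^ 4) \<and>
        regular_vector L M (\<lambda>w. vector [X' i1 w, X i2 w, X i3 w, X i4 w] :: real ^ 4) \<and>
        regular_vector L M (\<lambda>w. vector [X i1 w, X' i2 w, X i3 w, X i4 w] :: real ^ 4) \<and>
        regular_vector L M (\<lambda>w. vector [X i1 w, X i2 w, X' i3 w, X i4 w] :: real ^ 4)"
    using T1 unfolding cond_T1_def by (elim exE conjE) (rule that)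
  \<comment> \<open>The regularity condition asks for an upper bound \<open>n\<close> of the
    indices, and \<open>max i2 i4\<close> is the least one.\<close>
  note reg = T[rule_format, where n = "max i2 i4" and ?i1.0 = i1 and ?i2.0 = i2 and ?i3.0 = i3 and ?i4.0 = i4 for i1 i2 i3 i4]
  define B where "B = 4 * C2 * (4 * C2)"
  define G where "G x = h (x $ 1) (x $ 2) * h (x $ 3) (x $ 4)" for x :: "real ^ 4"
  have G_meas: "G \<in> borel_measurable borel" unfolding G_def by measurable
  have G_le: "\<bar>G x\<bar> \<le> B" for x
    unfolding G_def abs_mult B_def by (intro mult_mono abs_h_le) (use C2_nonneg in auto)
  have G_0: "(LINT x|F. G (\<chi> j. if j = j0 then x else y j)) = 0" if "j0 \<in> {1, 2, 3}" for j0 y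
    using that by (auto simp: G_def integral_h)
  obtain K where K: "0 \<le> K" and le: "\<And>(\<iota> :: 4 \<Rightarrow> nat) j0. inj \<iota> \<Longrightarrow> (\<And>j. 1 \<le> \<iota> j)
      \<Longrightarrow> regular_vector L M (\<lambda>w. \<chi> j. X (\<iota> j) w)
      \<Longrightarrow> regular_vector L M (\<lambda>w. \<chi> j. if j = j0 then X' (\<iota> j0) w else X (\<iota> j) w)
      \<Longrightarrow> j0 \<in> {1, 2, 3}
      \<Longrightarrow> \<bar>expectation (\<lambda>w. G (\<chi> j. X (\<iota> j) w))\<bar> \<le> K * (\<Sum>j\<in>-{j0}. wt (\<iota> j0) (\<iota> j)) ^ 3"
    using abs_expectation_degenerate_le_wt[where 'k = 4 and L = L and B = B] L G_meas G_le G_0 by auto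
  show ?thesis
  proof (intro exI[of _ K] conjI allI impI K)
    fix i j k l :: nat
    assume *: "1 \<le> i \<and> i < j \<and> 1 \<le> k \<and> k < l \<and> distinct [i, j, k, l]"
    define \<iota> where "\<iota> = (\<lambda>m. (vector [i, j, k, l] :: nat ^ 4) $ m)"
    have \<iota>: "\<iota> 1 = i" "\<iota> 2 = j" "\<iota> 3 = k" "\<iota> 4 = l" by (simp_all add: \<iota>_def vector_4)
    have vec: "(\<lambda>w. \<chi> m. Y m w) = (\<lambda>w. vector [Y 1 w, Y 2 w, Y 3 w, Y 4 w] :: real ^ 4)"
      for Y :: "4 \<Rightarrow> 'a \<Rightarrow> real"
      by (simp add: fun_eq_iff vec_eq_iff forall_4 vector_4)
    have inj: "inj \<iota>" unfolding inj_def using * by (simp add: forall_4 \<iota>)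
    have pos: "1 \<le> \<iota> m" for m
    proof -
      have "\<forall>m. 1 \<le> \<iota> m" using * by (simp add: forall_4 \<iota>)
      then show ?thesis ..
    qed
    have le': "\<bar>expectation (\<lambda>w. h (X i w) (X j w) * h (X k w) (X l w))\<bar>
        \<le> K * (\<Sum>m\<in>-{j0}. wt (\<iota> j0) (\<iota> m)) ^ 3" if "j0 \<in> {1, 2, 3}" for j0
    proof -
      have "\<bar>expectation (\<lambda>w. G (\<chi> m. X (\<iota> m) w))\<bar> \<le> K * (\<Sum>m\<in>-{j0}. wt (\<iota> j0) (\<iota> m)) ^ 3"
        using that reg[of i j k l] *
        by (intro le[OF inj pos]) (auto simp: vec \<iota>)
      then show ?thesis by (simp add: G_def \<iota>)
    qed
    show "\<bar>expectation (\<lambda>w. h (X i w) (X j w) * h (X k w) (X l w))\<bar>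
      \<le> K * ((wt i j + wt i k + wt i l) * (wt i j + wt j k + wt j l) * (wt i k + wt j k + wt k l))"
    proof (rule le_mult3_of_le_cubes[OF _ _ _ K])
      show "\<bar>expectation (\<lambda>w. h (X i w) (X j w) * h (X k w) (X l w))\<bar> \<le> K * (wt i j + wt i k + wt i l) ^ 3"
        using le'[of 1] by (simp add: Compl_4 \<iota> add.assoc)
      show "\<bar>expectation (\<lambda>w. h (X i w) (X j w) * h (X k w) (X l w))\<bar> \<le> K * (wt i j + wt j k + wt j l) ^ 3"
        using le'[of 2] by (simp add: Compl_4 \<iota> wt_sym[of j i] add.assoc)
      show "\<bar>expectation (\<lambda>w. h (X i w) (X j w) * h (X k w) (X l w))\<bar> \<le> K * (wt i k + wt j k + wt k l) ^ 3"
        using le'[of 3] by (simp add: Compl_4 \<iota> wt_sym[of k i] wt_sym[of k j] add.assoc)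
    qed (simp_all add: wt_bounds)
  qed
qed

text \<open>The shared variable occurs in both factors, so degeneracy is used at the endpoint
  \<open>p\<close>. One replacement is enough here, because the coincidence supplies an edge of
  weight 1 and only one further edge is wanted. The indices \<open>i1\<close> to \<open>i4\<close>
  are carried along because the assumption on triples draws them from two ordered pairs.\<close>

lemma expectation_hh_shared_le:
  "\<exists>K\<ge>0. \<forall>i1 i2 i3 i4 p s q. 1 \<le> i1 \<and> i1 < i2 \<and> 1 \<le> i3 \<and> i3 < i4 \<and>
      {p, s, q} \<subseteq> {i1, i2, i3, i4} \<and> distinct [p, s, q] \<longrightarrow>
    \<bar>expectation (\<lambda>w. h (X p w) (X s w) * h (X s w) (X q w))\<bar> \<le> K * (wt p s + wt p q)"
proof -
  obtain L where L: "0 < L" and T: "\<forall>n i1 i2 i3 i4. 1 \<le> i1 \<and> i1 < i2 \<and> i2 \<le> n \<and> 1 \<le> i3 \<and> i3 < i4 \<and> i4 \<le> n \<longrightarrow>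
        (\<forall>i\<in>{i1, i2, i3, i4}. \<forall>j\<in>{i1, i2, i3, i4}. \<forall>k\<in>{i1, i2, i3, i4}. distinct [i, j, k] \<longrightarrow>
           regular_vector L M (\<lambda>w. vector [X i w, X j w, X k w] :: real ^ 3) \<and>
           regular_vector L M (\<lambda>w. vector [X' i w, X j w, X k w] :: real ^ 3))"
    using T2 unfolding cond_T2_def by (elim exE conjE) (rule that)
  have reg: "regular_vector L M (\<lambda>w. vector [X i w, X j w, X k w] :: real ^ 3)
      \<and> regular_vector L M (\<lambda>w. vector [X' i w, X j w, X k w] :: real ^ 3)"
    if *: "1 \<le> i1" "i1 < i2" "1 \<le> i3" "i3 < i4" and "{i, j, k} \<subseteq> {i1, i2, i3, i4}" "distinct [i, j, k]"
    for i1 i2 i3 i4 i j k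
  proof -
    have "\<forall>i\<in>{i1, i2, i3, i4}. \<forall>j\<in>{i1, i2, i3, i4}. \<forall>k\<in>{i1, i2, i3, i4}. distinct [i, j, k] \<longrightarrow>
           regular_vector L M (\<lambda>w. vector [X i w, X j w, X k w] :: real ^ 3) \<and>
           regular_vector L M (\<lambda>w. vector [X' i w, X j w, X k w] :: real ^ 3)"
      by (rule T[THEN spec, of "max i2 i4", THEN spec, THEN spec, THEN spec, THEN spec, THEN mp]) (use * in simp)
    with that(5,6) show ?thesis by blast
  qed
  define B where "B = 4 * C2 * (4 * C2)"
  define G where "G x = h (x $ 1) (x $ 2) * h (x $ 2) (x $ 3)" for x :: "real ^ 3"
  have G_meas: "G \<in> borel_measurable borel" unfolding G_def by measurable
  have G_le: "\<bar>G x\<bar> \<le> B" for x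
    unfolding G_def abs_mult B_def by (intro mult_mono abs_h_le) (use C2_nonneg in auto)
  have G_0: "(LINT x|F. G (\<chi> j. if j = 1 then x else y j)) = 0" for y
    by (simp add: G_def integral_h)
  obtain K where K: "0 \<le> K" and le: "\<And>(\<iota> :: 3 \<Rightarrow> nat). inj \<iota> \<Longrightarrow> (\<And>j. 1 \<le> \<iota> j)
      \<Longrightarrow> regular_vector L M (\<lambda>w. \<chi> j. X (\<iota> j) w)
      \<Longrightarrow> regular_vector L M (\<lambda>w. \<chi> j. if j = 1 then X' (\<iota> 1) w else X (\<iota> j) w)
      \<Longrightarrow> \<bar>expectation (\<lambda>w. G (\<chi> j. X (\<iota> j) w))\<bar> \<le> K * (\<Sum>j\<in>-{1}. wt (\<iota> 1) (\<iota> j)) ^ 3"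
    using abs_expectation_degenerate_le_wt[where 'k = 3 and L = L and B = B] L G_meas G_le G_0 by auto
  show ?thesis
  proof (intro exI[of _ "K * 4"] conjI allI impI)
    fix i1 i2 i3 i4 p s q :: nat
    assume *: "1 \<le> i1 \<and> i1 < i2 \<and> 1 \<le> i3 \<and> i3 < i4 \<and> {p, s, q} \<subseteq> {i1, i2, i3, i4} \<and> distinct [p, s, q]"
    define \<iota> where "\<iota> = (\<lambda>m. (vector [p, s, q] :: nat ^ 3) $ m)"
    have \<iota>: "\<iota> 1 = p" "\<iota> 2 = s" "\<iota> 3 = q" by (simp_all add: \<iota>_def)
    have vec: "(\<lambda>w. \<chi> m. Y m w) = (\<lambda>w. vector [Y 1 w, Y 2 w, Y 3 w] :: real ^ 3)"
      for Y :: "3 \<Rightarrow> 'a \<Rightarrow> real"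
      by (simp add: fun_eq_iff vec_eq_iff forall_3)
    have inj: "inj \<iota>" unfolding inj_def using * by (simp add: forall_3 \<iota>)
    have pos: "1 \<le> \<iota> m" for m
    proof -
      have "\<forall>m. 1 \<le> \<iota> m" using * by (auto simp: forall_3 \<iota>)
      then show ?thesis ..
    qed
    have "\<bar>expectation (\<lambda>w. G (\<chi> m. X (\<iota> m) w))\<bar> \<le> K * (\<Sum>m\<in>-{1}. wt (\<iota> 1) (\<iota> m)) ^ 3"
    proof -
      have "regular_vector L M (\<lambda>w. vector [X p w, X s w, X q w] :: real ^ 3) \<and>
           regular_vector L M (\<lambda>w. vector [X' p w, X s w, X q w] :: real ^ 3)"
        by (rule reg[of i1 i2 i3 i4]) (use * in blast)+
      then show ?thesis by (intro le[OF inj pos]) (simp_all add: vec \<iota>)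
    qed
    then have "\<bar>expectation (\<lambda>w. h (X p w) (X s w) * h (X s w) (X q w))\<bar> \<le> K * (wt p s + wt p q) ^ 3"
      by (simp add: G_def \<iota> Compl_3)
    \<comment> \<open>The cube is lowered to the first power: a sum of two weights is at most 2, and
      4 is the square of 2.\<close>
    also have "\<dots> \<le> K * ((wt p s + wt p q) * 4)"
    proof (intro mult_left_mono K)
      let ?u = "wt p s + wt p q"
      have u: "0 \<le> ?u" "?u \<le> 2" using wt_bounds[of p s] wt_bounds[of p q] by linarith+
      then have "?u * (?u * ?u) \<le> ?u * (2 * 2)" by (intro mult_left_mono mult_mono) auto
      then show "?u ^ 3 \<le> ?u * 4" by (simp add: power3_eq_cube mult.assoc)
    qed
    finally show "\<bar>expectation (\<lambda>w. h (X p w) (X s w) * h (X s w) (X q w))\<bar> \<le> K * 4 * (wt p s + wt p q)"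
      by (simp add: mult_ac)
  qed (use K in simp)
qed

abbreviation "wt2 i j k l \<equiv> esym2 (wt i j) (wt i k) (wt i l) (wt j k) (wt j l) (wt k l)"

text \<open>Since \<open>wt i i = 1\<close>, the bound for four distinct indices covers coinciding indices as well.\<close>

lemma expectation_hh_le:
  "\<exists>K\<ge>0. \<forall>i j k l. 1 \<le> i \<and> i < j \<and> 1 \<le> k \<and> k < l \<longrightarrow>
    expectation (\<lambda>w. h (X i w) (X j w) * h (X k w) (X l w)) \<le> K * wt2 i j k l"
proof -
  obtain K4 where K4: "0 \<le> K4" "\<And>i j k l. 1 \<le> i \<Longrightarrow> i < j \<Longrightarrow> 1 \<le> k \<Longrightarrow> k < l \<Longrightarrow> distinct [i, j, k, l] \<Longrightarrow>
    \<bar>expectation (\<lambda>w. h (X i w) (X j w) * h (X k w) (X l w))\<bar>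
    \<le> K4 * ((wt i j + wt i k + wt i l) * (wt i j + wt j k + wt j l) * (wt i k + wt j k + wt k l))"
    using expectation_hh_disjoint_le by blast
  obtain K3 where K3: "0 \<le> K3" "\<forall>i1 i2 i3 i4 p s q. 1 \<le> i1 \<and> i1 < i2 \<and> 1 \<le> i3 \<and> i3 < i4 \<and>
      {p, s, q} \<subseteq> {i1, i2, i3, i4} \<and> distinct [p, s, q] \<longrightarrow>
    \<bar>expectation (\<lambda>w. h (X p w) (X s w) * h (X s w) (X q w))\<bar> \<le> K3 * (wt p s + wt p q)"
    using expectation_hh_shared_le by (elim exE conjE) (rule that)
  define K2 where "K2 = 4 * C2 * (4 * C2)"
  have K2: "0 \<le> K2" using C2_nonneg by (simp add: K2_def)
  have nn: "0 \<le> wt i j * wt k l" for i j k l by (simp add: wt_bounds)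
  have *: "\<bar>expectation (\<lambda>w. h (X i w) (X j w) * h (X k w) (X l w))\<bar> \<le> (4 * K4 + K3 + K2) * wt2 i j k l"
    if ij: "1 \<le> i" "i < j" and kl: "1 \<le> k" "k < l" for i j k l
  proof -
    let ?E = "\<bar>expectation (\<lambda>w. h (X i w) (X j w) * h (X k w) (X l w))\<bar>"
    have e_nonneg: "0 \<le> wt2 i j k l" by (simp add: esym2_def nn)
    have m: "X m \<in> borel_measurable M" if "m \<in> {i, j, k, l}" for m
      using that ij kl by (intro X_measurable) auto
    have "?E \<le> 4 * K4 * wt2 i j k l \<or> ?E \<le> K3 * wt2 i j k l \<or> ?E \<le> K2 * wt2 i j k l"
    proof -
      \<comment> \<open>Since \<open>i < j\<close> and \<open>k < l\<close>, pairs that meet agree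
        entirely or in exactly one entry, and this entry can sit in four positions.\<close>
      consider "distinct [i, j, k, l]" | "i = k" "j = l" | "i = k" "j \<noteq> l" | "i = l" | "j = k" | "j = l" "i \<noteq> k"
        using ij kl by fastforce
      then show ?thesis
      proof cases
        case 1
        have "?E \<le> K4 * ((wt i j + wt i k + wt i l) * (wt i j + wt j k + wt j l) * (wt i k + wt j k + wt k l))"
          by (rule K4(2)[OF ij kl 1])
        also have "\<dots> \<le> K4 * (4 * wt2 i j k l)"
          by (intro mult_left_mono K4(1) three_stars_le_esym2) (auto simp: wt_bounds)
        finally show ?thesis by simp
      next
        case 2
        have "?E \<le> K2"
        proof (rule abs_expectation_le)
          show "\<bar>h (X i w) (X j w) * h (X k w) (X l w)\<bar> \<le> K2" for w
            unfolding K2_def abs_mult by (intro mult_mono abs_h_le) (use C2_nonneg in auto)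
        qed (intro borel_measurable_times measurable_h m; simp)
        \<comment> \<open>Here the edges \<open>ik\<close> and \<open>jl\<close> both have weight 1,
          and their product is one of the fifteen terms.\<close>
        also have "1 \<le> wt2 i j k l"
          using 2 nn by (simp add: esym2_def wt_refl wt_bounds add_nonneg_nonneg)
        from mult_left_mono[OF this K2] have "K2 \<le> K2 * wt2 i j k l" by simp
        finally show ?thesis by simp
      next
        case 3
        have "?E \<le> K3 * (wt j i + wt j l)"
          using K3(2)[rule_format, of i j k l j i l] 3 ij kl by (simp add: h_sym[of "X j _"])
        \<comment> \<open>The edge \<open>ik\<close> has weight 1, so the two weights are its
          products with the edges \<open>ij\<close> and \<open>jl\<close>. The remaining cases use
          their own edge of weight 1 in the same way.\<close>
        also have "\<dots> \<le> K3 * wt2 i j k l"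
          using 3 nn K3(1) by (intro mult_left_mono)
            (auto simp: esym2_def wt_refl wt_bounds add_nonneg_nonneg wt_sym[of j i])
        finally show ?thesis by simp
      next
        case 4
        have "?E \<le> K3 * (wt j i + wt j k)"
          using K3(2)[rule_format, of i j k l j i k] 4 ij kl by (simp add: h_sym[of "X j _"] h_sym[of "X k _"])
        also have "\<dots> \<le> K3 * wt2 i j k l"
          using 4 nn K3(1) by (intro mult_left_mono)
            (auto simp: esym2_def wt_refl wt_bounds add_nonneg_nonneg wt_sym[of j i])
        finally show ?thesis by simp
      next
        case 5
        have "?E \<le> K3 * (wt i j + wt i l)"
          using K3(2)[rule_format, of i j k l i j l] 5 ij kl by simp
        also have "\<dots> \<le> K3 * wt2 i j k l"
          using 5 nn K3(1) by (intro mult_left_mono)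
            (auto simp: esym2_def wt_refl wt_bounds add_nonneg_nonneg)
        finally show ?thesis by simp
      next
        case 6
        have "?E \<le> K3 * (wt i j + wt i k)"
          using K3(2)[rule_format, of i j k l i j k] 6 ij kl by (simp add: h_sym[of "X k _"])
        also have "\<dots> \<le> K3 * wt2 i j k l"
          using 6 nn K3(1) by (intro mult_left_mono)
            (auto simp: esym2_def wt_refl wt_bounds add_nonneg_nonneg)
        finally show ?thesis by simp
      qed
    qed
    moreover have "0 \<le> K4 * wt2 i j k l" "0 \<le> K3 * wt2 i j k l" "0 \<le> K2 * wt2 i j k l"
      using e_nonneg K4(1) K3(1) K2 by auto
    ultimately show ?thesis by (auto simp: distrib_right)
  qed
  show ?thesis
    using K4(1) K3(1) K2 order_trans[OF abs_ge_self *] by (intro exI[of _ "4 * K4 + K3 + K2"]) auto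
qed

lemma expectation_sum_h_square_le:
  "\<exists>K\<ge>0. \<forall>n. expectation (\<lambda>w. (\<Sum>(i, j)\<in>pairs n. h (X i w) (X j w))\<^sup>2) \<le> K * (real n)\<^sup>2"
proof -
  obtain K where K: "0 \<le> K" and le: "\<And>i j k l. 1 \<le> i \<Longrightarrow> i < j \<Longrightarrow> 1 \<le> k \<Longrightarrow> k < l \<Longrightarrow>
    expectation (\<lambda>w. h (X i w) (X j w) * h (X k w) (X l w)) \<le> K * wt2 i j k l"
    using expectation_hh_le by blast
  obtain B where B: "\<And>n i. (\<Sum>j\<in>{1..n}. wt i j) \<le> B" using sum_wt_bounded by blast
  have nn: "0 \<le> wt2 i j k l" for i j k l by (simp add: esym2_def wt_bounds)
  have "expectation (\<lambda>w. (\<Sum>(i, j)\<in>pairs n. h (X i w) (X j w))\<^sup>2) \<le> K * (15 * B\<^sup>2) * (real n)\<^sup>2" for n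
  proof -
    let ?A = "{1..n}"
    have sub: "pairs n \<subseteq> ?A \<times> ?A" by auto
    have int: "integrable M (\<lambda>w. h (X i w) (X j w) * h (X k w) (X l w))"
      if "(i, j) \<in> pairs n" "(k, l) \<in> pairs n" for i j k l
    proof (rule integrable_const_bound[where B = "4 * C2 * (4 * C2)"])
      show "AE w in M. norm (h (X i w) (X j w) * h (X k w) (X l w)) \<le> 4 * C2 * (4 * C2)"
        unfolding real_norm_def abs_mult by (intro AE_I2 mult_mono abs_h_le) (use C2_nonneg in auto)
    qed (intro borel_measurable_times measurable_h X_measurable; use that in simp)
    have "expectation (\<lambda>w. (\<Sum>(i, j)\<in>pairs n. h (X i w) (X j w))\<^sup>2)
        = expectation (\<lambda>w. \<Sum>(i, j)\<in>pairs n. \<Sum>(k, l)\<in>pairs n. h (X i w) (X j w) * h (X k w) (X l w))"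
      by (simp add: power2_eq_square sum_product case_prod_beta')
    also have "\<dots> = (\<Sum>(i, j)\<in>pairs n. \<Sum>(k, l)\<in>pairs n.
        expectation (\<lambda>w. h (X i w) (X j w) * h (X k w) (X l w)))"
      using int by (subst Bochner_Integration.integral_sum;
        force simp: case_prod_beta' Bochner_Integration.integral_sum intro!: sum.cong)
    also have "\<dots> \<le> (\<Sum>(i, j)\<in>pairs n. \<Sum>(k, l)\<in>pairs n. K * wt2 i j k l)"
      using le by (intro sum_mono) (auto intro!: sum_mono)
    \<comment> \<open>Passing to all index pairs only adds nonnegative terms and restores the
      symmetry that permuting the four indices requires.\<close>
    also have "\<dots> \<le> (\<Sum>(i, j)\<in>?A \<times> ?A. \<Sum>(k, l)\<in>?A \<times> ?A. K * wt2 i j k l)"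
      using K nn sub
      by (intro sum_mono2[OF _ sub, THEN order_trans[rotated]] sum_mono)
        (auto intro!: sum_mono2 sum_nonneg mult_nonneg_nonneg)
    also have "\<dots> = K * sum4 ?A wt2"
      unfolding sum4_def by (simp add: sum.cartesian_product[symmetric] sum_distrib_left)
    also have "\<dots> \<le> K * (15 * (card ?A * B)\<^sup>2)"
      by (intro mult_left_mono K sum4_esym2_le) (auto simp: wt_bounds wt_sym B[simplified])
    finally show ?thesis by (simp add: power_mult_distrib mult_ac)
  qed
  then show ?thesis using K by (intro exI[of _ "K * (15 * B\<^sup>2)"]) auto
qed

end

section \<open>A central limit theorem for associated processes\<close>

lemma cesaro_mean_tendsto:
  fixes x :: "nat \<Rightarrow> real"
  assumes "x \<longlonglongrightarrow> L"
  shows "(\<lambda>n. (\<Sum>k<n. x k) / real n) \<longlonglongrightarrow> L"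
proof (rule LIMSEQ_I)
  fix r :: real assume r: "0 < r"
  obtain N where N: "\<And>n. n \<ge> N \<Longrightarrow> \<bar>x n - L\<bar> < r / 2"
    using LIMSEQ_D[OF assms, of "r / 2"] r by auto
  define B where "B = (\<Sum>k<N. \<bar>x k - L\<bar>)"
  obtain N' :: nat where N': "2 * B / r < real N'" using reals_Archimedean2 by blast
  show "\<exists>no. \<forall>n\<ge>no. norm ((\<Sum>k<n. x k) / real n - L) < r"
  proof (intro exI[of _ "max (N + 1) N'"] allI impI)
    fix n assume n: "max (N + 1) N' \<le> n"
    then have n0: "0 < n" and nN: "N \<le> n" "real N' \<le> real n" by auto
    have "\<bar>\<Sum>k<n. x k - L\<bar> \<le> (\<Sum>k<n. \<bar>x k - L\<bar>)" by (rule sum_abs)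
    also have "\<dots> = B + (\<Sum>k\<in>{N..<n}. \<bar>x k - L\<bar>)"
      unfolding B_def using nN sum.atLeastLessThan_concat[of 0 N n "\<lambda>k. \<bar>x k - L\<bar>"]
      by (simp add: atLeast0LessThan)
    also have "(\<Sum>k\<in>{N..<n}. \<bar>x k - L\<bar>) \<le> (\<Sum>k\<in>{N..<n}. r / 2)"
      using N by (intro sum_mono) (auto intro: less_imp_le)
    also have "\<dots> \<le> n * (r / 2)" using r by simp
    finally have "\<bar>\<Sum>k<n. x k - L\<bar> \<le> B + n * (r / 2)" by simp
    moreover have "B < n * (r / 2)"
    proof -
      have "2 * B / r < n" using N' nN by linarith
      then show ?thesis using r by (simp add: field_simps)
    qed
    ultimately have *: "\<bar>\<Sum>k<n. x k - L\<bar> < n * r" by simp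
    have "norm ((\<Sum>k<n. x k) / real n - L) = \<bar>\<Sum>k<n. x k - L\<bar> / n"
      using n0 by (simp add: sum_subtractf abs_div_pos[symmetric] field_simps)
    also have "\<dots> < r" using * n0 by (simp add: field_simps)
    finally show "norm ((\<Sum>k<n. x k) / real n - L) < r" .
  qed
qed

section \<open>Elementary bounds for trigonometric and exponential functions\<close>

lemma abs_cos_diff_le: "\<bar>cos x - cos y\<bar> \<le> \<bar>x - y\<bar>" for x y :: real
proof -
  have "\<bar>cos x - cos y\<bar> = 2 * (\<bar>sin ((x + y) / 2)\<bar> * \<bar>sin ((y - x) / 2)\<bar>)"
    unfolding cos_diff_cos by (simp add: abs_mult)
  also have "\<dots> \<le> 2 * (1 * \<bar>(y - x) / 2\<bar>)"
    by (intro mult_left_mono mult_mono abs_sin_le_one abs_sin_x_le_abs_x) auto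
  finally show ?thesis by simp
qed

lemma abs_sin_diff_le: "\<bar>sin x - sin y\<bar> \<le> \<bar>x - y\<bar>" for x y :: real
  using abs_cos_diff_le[of "pi / 2 - x" "pi / 2 - y"] by (simp add: cos_sin_eq[symmetric] sin_cos_eq)

lemma norm_iexp_diff_le: "cmod (iexp x - iexp y) \<le> \<bar>x - y\<bar>"
proof -
  have "iexp x - iexp y = iexp y * (iexp (x - y) - 1)"
    by (simp add: algebra_simps exp_diff)
  then have "cmod (iexp x - iexp y) = cmod (iexp (x - y) - 1)" by (simp add: norm_mult)
  also have "\<dots> \<le> \<bar>x - y\<bar>" using iexp_approx1[of "x - y" 0] by simp
  finally show ?thesis .
qed

lemma exp_minus_approx:
  fixes x :: real
  assumes "0 \<le> x"
  shows "\<bar>exp (- x) - (1 - x)\<bar> \<le> x\<^sup>2"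
proof -
  have "1 - x \<le> exp (- x)" using exp_ge_add_one_self[of "- x"] by simp
  moreover have "exp (- x) \<le> 1 - x + x\<^sup>2"
  proof -
    \<comment> \<open>The product equals \<open>1 + x ^ 3\<close>.\<close>
    have "1 \<le> (1 + x) * (1 - x + x\<^sup>2)" using assms by (simp add: algebra_simps power2_eq_square)
    also have "\<dots> \<le> exp x * (1 - x + x\<^sup>2)"
    proof (intro mult_right_mono exp_ge_add_one_self)
      have "1 - x + x\<^sup>2 = (1 - x / 2)\<^sup>2 + 3 / 4 * x\<^sup>2" by (simp add: power2_eq_square algebra_simps)
      then show "0 \<le> 1 - x + x\<^sup>2" by simp
    qed
    finally show ?thesis by (simp add: exp_minus field_simps)
  qed
  ultimately show ?thesis by simp
qed

section \<open>Characteristic functions of associated variables\<close>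

context prob_space begin

lemma integrable_iexp:
  assumes [measurable]: "U \<in> borel_measurable M"
  shows "integrable M (\<lambda>w. iexp (U w))"
  by (rule integrable_const_bound[where B = 1]) auto

lemma expectation_iexp:
  assumes [measurable]: "U \<in> borel_measurable M"
  shows "(CLINT w|M. iexp (U w))
    = complex_of_real (expectation (\<lambda>w. cos (U w))) + \<i> * complex_of_real (expectation (\<lambda>w. sin (U w)))"
proof -
  have i: "integrable M (\<lambda>w. complex_of_real (cos (U w)))" "integrable M (\<lambda>w. complex_of_real (sin (U w)))"
    by (rule integrable_const_bound[where B = 1]; simp)+
  have "(CLINT w|M. iexp (U w)) = (CLINT w|M. complex_of_real (cos (U w)) + \<i> * complex_of_real (sin (U w)))"
    by (simp add: exp_Euler cos_of_real sin_of_real)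
  also have "\<dots> = (CLINT w|M. complex_of_real (cos (U w))) + \<i> * (CLINT w|M. complex_of_real (sin (U w)))"
    using i by simp
  finally show ?thesis by simp
qed

lemma norm_expectation_iexp_le_1:
  assumes "U \<in> borel_measurable M"
  shows "cmod (CLINT w|M. iexp (U w)) \<le> 1"
proof -
  have "cmod (CLINT w|M. iexp (U w)) \<le> (LINT w|M. cmod (iexp (U w)))" by (rule integral_norm_bound)
  then show ?thesis by (simp add: prob_space)
qed

lemma norm_expectation_iexp_diff_le:
  assumes [measurable]: "U \<in> borel_measurable M" "V \<in> borel_measurable M" and int: "integrable M (\<lambda>w. \<bar>U w - V w\<bar>)"
  shows "cmod ((CLINT w|M. iexp (U w)) - (CLINT w|M. iexp (V w))) \<le> expectation (\<lambda>w. \<bar>U w - V w\<bar>)"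
proof -
  have "cmod ((CLINT w|M. iexp (U w)) - (CLINT w|M. iexp (V w))) = cmod (CLINT w|M. iexp (U w) - iexp (V w))"
    by (simp add: integrable_iexp)
  also have "\<dots> \<le> (LINT w|M. cmod (iexp (U w) - iexp (V w)))" by (rule integral_norm_bound)
  also have "\<dots> \<le> expectation (\<lambda>w. \<bar>U w - V w\<bar>)"
    by (intro integral_mono int norm_iexp_diff_le integrable_norm Bochner_Integration.integrable_diff integrable_iexp)
      measurable
  finally show ?thesis .
qed

text \<open>As sine and cosine are 1-Lipschitz, \<open>f \<lless> f'\<close> implies \<open>cos (s f) \<lless> \<bar>s\<bar> f'\<close>, and likewise for sine.\<close>

lemma norm_iexp_covariance_le:
  fixes X :: "'i \<Rightarrow> 'a \<Rightarrow> real"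
  assumes assoc: "finitely_associated M X J"
    and f: "coordwise_dominated J f f'" and g: "coordwise_dominated J g g'"
    and b: "ess_bounded (\<lambda>w. f (\<lambda>j. X j w))" "ess_bounded (\<lambda>w. f' (\<lambda>j. X j w))"
      "ess_bounded (\<lambda>w. g (\<lambda>j. X j w))" "ess_bounded (\<lambda>w. g' (\<lambda>j. X j w))"
  shows "cmod ((CLINT w|M. iexp (s * (f (\<lambda>j. X j w) + g (\<lambda>j. X j w))))
      - (CLINT w|M. iexp (s * f (\<lambda>j. X j w))) * (CLINT w|M. iexp (s * g (\<lambda>j. X j w))))
    \<le> 4 * s\<^sup>2 * covariance M (\<lambda>w. f' (\<lambda>j. X j w)) (\<lambda>w. g' (\<lambda>j. X j w))"
proof -
  let ?U = "\<lambda>w. s * f (\<lambda>j. X j w)" and ?V = "\<lambda>w. s * g (\<lambda>j. X j w)"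
  let ?c = "covariance M (\<lambda>w. f' (\<lambda>j. X j w)) (\<lambda>w. g' (\<lambda>j. X j w))"
  have [measurable]: "?U \<in> borel_measurable M" "?V \<in> borel_measurable M"
    by (intro borel_measurable_times borel_measurable_const ess_bounded_measurable b)+
  have eb: "ess_bounded (\<lambda>w. cos (?U w))" "ess_bounded (\<lambda>w. sin (?U w))"
    "ess_bounded (\<lambda>w. cos (?V w))" "ess_bounded (\<lambda>w. sin (?V w))"
    by (rule ess_boundedI[where c = 1]; simp)+
  have lip: "coordwise_dominated J (\<lambda>x. u (s * k x)) (\<lambda>x. \<bar>s\<bar> * k' x)"
    if k: "coordwise_dominated J k k'" and u: "\<And>x y. \<bar>u x - u y\<bar> \<le> \<bar>x - y\<bar>"
    for u :: "real \<Rightarrow> real" and k k' :: "('i \<Rightarrow> real) \<Rightarrow> real"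
    unfolding coordwise_dominated_def
  proof (intro allI impI)
    fix x y :: "'i \<Rightarrow> real" assume "\<forall>j\<in>J. x j \<le> y j"
    then have "\<bar>k y - k x\<bar> \<le> k' y - k' x" using k unfolding coordwise_dominated_def by blast
    then have "\<bar>s\<bar> * \<bar>k y - k x\<bar> \<le> \<bar>s\<bar> * (k' y - k' x)" by (intro mult_left_mono) auto
    with u[of "s * k y" "s * k x"] show "\<bar>u (s * k y) - u (s * k x)\<bar> \<le> \<bar>s\<bar> * k' y - \<bar>s\<bar> * k' x"
      by (simp add: abs_mult right_diff_distrib[symmetric])
  qed
  have cov: "\<bar>covariance M (\<lambda>w. u (?U w)) (\<lambda>w. v (?V w))\<bar> \<le> s\<^sup>2 * ?c"
    if uv: "u \<in> {cos, sin}" "v \<in> {cos, sin}" for u v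
  proof -
    have lu: "\<And>x y. \<bar>u x - u y\<bar> \<le> \<bar>x - y\<bar>" and lv: "\<And>x y. \<bar>v x - v y\<bar> \<le> \<bar>x - y\<bar>"
      using uv abs_cos_diff_le abs_sin_diff_le by auto
    have "\<bar>covariance M (\<lambda>w. u (?U w)) (\<lambda>w. v (?V w))\<bar>
      \<le> covariance M (\<lambda>w. \<bar>s\<bar> * f' (\<lambda>j. X j w)) (\<lambda>w. \<bar>s\<bar> * g' (\<lambda>j. X j w))"
      by (rule abs_covariance_le_dominated[OF assoc lip[OF f lu] lip[OF g lv]])
        (use uv eb b in \<open>auto intro: ess_bounded_cmult\<close>)
    also have "\<dots> = s\<^sup>2 * ?c"
      using b by (simp add: covariance_cmult_left covariance_cmult_right ess_bounded_cmult
        power2_eq_square mult.assoc[symmetric])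
    finally show ?thesis .
  qed
  have E: "expectation (\<lambda>w. u (?U w) * v (?V w))
      = covariance M (\<lambda>w. u (?U w)) (\<lambda>w. v (?V w)) + expectation (\<lambda>w. u (?U w)) * expectation (\<lambda>w. v (?V w))"
    if "u \<in> {cos, sin}" "v \<in> {cos, sin}" for u v
    using that eb by (auto simp: covariance_eq)
  have E': "expectation (\<lambda>w. cos (?V w) * sin (?U w))
      = covariance M (\<lambda>w. sin (?U w)) (\<lambda>w. cos (?V w)) + expectation (\<lambda>w. cos (?V w)) * expectation (\<lambda>w. sin (?U w))"
    using E[of sin cos] by (simp add: mult.commute)
  \<comment> \<open>The addition formulas split real and imaginary part into two covariances each;
    four covariances of size at most \<open>s\<^sup>2 * ?c\<close> explain the factor 4.\<close>
  let ?z = "complex_of_real (covariance M (\<lambda>w. cos (?U w)) (\<lambda>w. cos (?V w))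
        - covariance M (\<lambda>w. sin (?U w)) (\<lambda>w. sin (?V w)))
      + \<i> * complex_of_real (covariance M (\<lambda>w. sin (?U w)) (\<lambda>w. cos (?V w))
        + covariance M (\<lambda>w. cos (?U w)) (\<lambda>w. sin (?V w)))"
  have i: "integrable M (\<lambda>w. cos (?U w) * cos (?V w))" "integrable M (\<lambda>w. sin (?U w) * sin (?V w))"
    "integrable M (\<lambda>w. sin (?U w) * cos (?V w))" "integrable M (\<lambda>w. cos (?U w) * sin (?V w))"
    by (auto intro!: ess_bounded_integrable ess_bounded_mult eb)
  have "(CLINT w|M. iexp (?U w + ?V w)) - (CLINT w|M. iexp (?U w)) * (CLINT w|M. iexp (?V w)) = ?z"
    using i
    by (subst (1 2 3) expectation_iexp)
      (simp_all add: cos_add sin_add E E' complex_eq_iff algebra_simps)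
  moreover have "cmod ?z \<le> \<bar>covariance M (\<lambda>w. cos (?U w)) (\<lambda>w. cos (?V w))
        - covariance M (\<lambda>w. sin (?U w)) (\<lambda>w. sin (?V w))\<bar>
      + \<bar>covariance M (\<lambda>w. sin (?U w)) (\<lambda>w. cos (?V w))
        + covariance M (\<lambda>w. cos (?U w)) (\<lambda>w. sin (?V w))\<bar>"
    by (rule order_trans[OF norm_triangle_ineq]) (simp only: norm_mult norm_ii mult_1 norm_of_real order_refl)
  moreover have "\<dots> \<le> 4 * s\<^sup>2 * ?c"
    using cov[of cos cos] cov[of sin sin] cov[of sin cos] cov[of cos sin] by simp
  ultimately show ?thesis by (simp add: distrib_left)
qed

end

text \<open>An iterated limit: \<open>l\<close> is fixed first to make \<open>e l\<close> and the
  distance of \<open>a l\<close> to the limit small, and then \<open>n\<close> grows. The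
  convergence of \<open>R l\<close> may depend on \<open>l\<close>.\<close>

lemma tendsto_if_eventually_close:
  fixes z :: "nat \<Rightarrow> complex"
  assumes a: "a \<longlonglongrightarrow> A" and e: "e \<longlonglongrightarrow> (0 :: real)"
    and R: "\<And>l. 1 \<le> l \<Longrightarrow> (\<lambda>n. R l n) \<longlonglongrightarrow> (0 :: real)"
    and le: "\<And>l n. 1 \<le> l \<Longrightarrow> 1 \<le> n \<Longrightarrow> cmod (z n - a l) \<le> e l + R l n"
  shows "z \<longlonglongrightarrow> A"
proof (rule LIMSEQ_I)
  fix r :: real assume r: "0 < r"
  have "\<forall>\<^sub>F l in sequentially. cmod (a l - A) < r / 3 \<and> \<bar>e l\<bar> < r / 3 \<and> 1 \<le> l"
    using eventually_conj[OF tendstoD[OF a, of "r / 3"]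
        eventually_conj[OF tendstoD[OF e, of "r / 3"] eventually_ge_at_top[of 1]]] r
    by (simp add: dist_norm)
  then obtain l where l: "cmod (a l - A) < r / 3" "\<bar>e l\<bar> < r / 3" "1 \<le> l"
    using eventually_happens'[OF sequentially_bot] by blast
  obtain N where N: "\<And>n. n \<ge> N \<Longrightarrow> \<bar>R l n\<bar> < r / 3"
    using LIMSEQ_D[OF R[OF l(3)], of "r / 3"] r by auto
  show "\<exists>no. \<forall>n\<ge>no. cmod (z n - A) < r"
  proof (intro exI[of _ "max N 1"] allI impI)
    fix n assume "max N 1 \<le> n"
    then have "cmod (z n - a l) < r / 3 + r / 3" using le[OF l(3), of n] N[of n] l(2) by auto
    then show "cmod (z n - A) < r"
      using norm_triangle_ineq[of "z n - a l" "a l - A"] l(1) by simp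
  qed
qed

lemma div_over_tendsto:
  assumes "1 \<le> l"
  shows "(\<lambda>n. real (n div l) / real n) \<longlonglongrightarrow> 1 / real l"
proof (rule tendsto_sandwich)
  show "(\<lambda>n. 1 / real l - 1 / real n) \<longlonglongrightarrow> 1 / real l"
    using tendsto_diff[OF tendsto_const lim_1_over_n] by simp
  show "\<forall>\<^sub>F n in sequentially. 1 / real l - 1 / real n \<le> real (n div l) / real n"
    using eventually_gt_at_top[of 0]
  proof eventually_elim
    fix n :: nat assume n: "0 < n"
    have "real n \<le> real (n div l) * real l + real l"
      using div_mult_mod_eq[of n l] mod_less_divisor[of l n] assms
      by (metis add_le_cancel_left less_eq_Suc_le less_imp_le of_nat_add of_nat_le_iff of_nat_mult One_nat_def)
    then show "1 / real l - 1 / real n \<le> real (n div l) / real n"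
      using n assms mult_left_mono[of "real n" "real (n div l) * real l + real l" "real n"]
      by (simp add: field_simps)
  qed
  show "\<forall>\<^sub>F n in sequentially. real (n div l) / real n \<le> 1 / real l"
    using eventually_gt_at_top[of 0]
  proof eventually_elim
    fix n :: nat assume n: "0 < n"
    have "real (n div l) * real l \<le> real n" by (metis div_times_less_eq_dividend of_nat_le_iff of_nat_mult)
    then show "real (n div l) / real n \<le> 1 / real l" using n assms by (simp add: field_simps)
  qed
qed simp

section \<open>Covariances of partial sums\<close>

context stationary_associated begin

definition psum :: "(real \<Rightarrow> real) \<Rightarrow> nat \<Rightarrow> 'a \<Rightarrow> real" where
  "psum p n w = (\<Sum>i\<in>{1..n}. p (X i w))"

definition autocov :: "(real \<Rightarrow> real) \<Rightarrow> nat \<Rightarrow> real" where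
  "autocov p d = covariance M (\<lambda>w. p (X 1 w)) (\<lambda>w. p (X (1 + d) w))"

text \<open>Counting the lags backwards from the last summand makes them consecutive. The case
  \<open>r = 1\<close> gives the increments of the variance, general \<open>r\<close> the covariance
  of the past with a later block.\<close>

lemma sum_autocov_left:
  assumes p: "p \<in> borel_measurable borel" and b: "\<And>i. 1 \<le> i \<Longrightarrow> ess_bounded (\<lambda>w. p (X i w))" and r: "1 \<le> r"
  shows "covariance M (psum p n) (\<lambda>w. p (X (n + r) w)) = (\<Sum>j<n. autocov p (j + r))"
proof -
  have "covariance M (psum p n) (\<lambda>w. p (X (n + r) w))
      = (\<Sum>i\<in>{1..n}. covariance M (\<lambda>w. p (X i w)) (\<lambda>w. p (X (n + r) w)))"
    unfolding psum_def[abs_def] using b r by (intro covariance_sum_left) auto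
  also have "\<dots> = (\<Sum>i\<in>{1..n}. autocov p (n + r - i))"
  proof (rule sum.cong[OF refl])
    fix i assume "i \<in> {1..n}"
    then show "covariance M (\<lambda>w. p (X i w)) (\<lambda>w. p (X (n + r) w)) = autocov p (n + r - i)"
      using covariance_shift[of i p p "n + r - i"] p by (simp add: autocov_def)
  qed
  also have "\<dots> = (\<Sum>j<n. autocov p (j + r))"
    by (rule sum.reindex_bij_witness[of _ "\<lambda>j. n - j" "\<lambda>i. n - i"]) auto
  finally show ?thesis .
qed

text \<open>The increments of the variance are a constant plus twice the partial sums of a
  convergent series, so the quotient is the Cesaro mean of a convergent sequence.\<close>

lemma variance_psum_over_n:
  assumes p: "p \<in> borel_measurable borel" and b: "\<And>i. 1 \<le> i \<Longrightarrow> ess_bounded (\<lambda>w. p (X i w))"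
    and s: "summable (\<lambda>j. autocov p (Suc j))"
  shows "(\<lambda>n. variance (psum p n) / real n) \<longlonglongrightarrow> autocov p 0 + 2 * (\<Sum>j. autocov p (Suc j))"
proof -
  have ebS: "ess_bounded (psum p n)" for n
    unfolding psum_def[abs_def] using b by (intro ess_bounded_sum) auto
  have V: "variance Y = covariance M Y Y" for Y by (simp add: covariance_def power2_eq_square)
  have step: "variance (psum p (Suc n)) = variance (psum p n) + (autocov p 0 + 2 * (\<Sum>j<n. autocov p (Suc j)))" for n
  proof -
    have eb: "ess_bounded (\<lambda>w. p (X (Suc n) w))" by (rule b) simp
    have "psum p (Suc n) = (\<lambda>w. psum p n w + p (X (Suc n) w))" by (simp add: psum_def fun_eq_iff)
    then have "variance (psum p (Suc n)) = covariance M (\<lambda>w. psum p n w + p (X (Suc n) w)) (\<lambda>w. psum p n w + p (X (Suc n) w))"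
      by (simp add: V)
    also have "\<dots> = covariance M (psum p n) (psum p n) + 2 * covariance M (psum p n) (\<lambda>w. p (X (Suc n) w))
        + covariance M (\<lambda>w. p (X (Suc n) w)) (\<lambda>w. p (X (Suc n) w))"
      using ebS[of n] eb covariance_commute[of "\<lambda>w. p (X (Suc n) w)" "psum p n"]
      by (simp add: covariance_add_left covariance_add_right ess_bounded_add)
    also have "covariance M (\<lambda>w. p (X (Suc n) w)) (\<lambda>w. p (X (Suc n) w)) = autocov p 0"
      using covariance_shift[of "Suc n" p p 0] p by (simp add: autocov_def)
    finally show ?thesis using sum_autocov_left[OF p b, of 1 n] by (simp add: V)
  qed
  have "variance (psum p n) = (\<Sum>k<n. autocov p 0 + 2 * (\<Sum>j<k. autocov p (Suc j)))" for n
    by (induction n) (simp_all only: step, simp_all add: psum_def[abs_def])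
  moreover have "(\<lambda>k. autocov p 0 + 2 * (\<Sum>j<k. autocov p (Suc j))) \<longlonglongrightarrow> autocov p 0 + 2 * (\<Sum>j. autocov p (Suc j))"
    by (intro tendsto_intros summable_LIMSEQ s)
  ultimately show ?thesis by (simp add: cesaro_mean_tendsto)
qed

lemma expectation_iexp_block:
  assumes p: "p \<in> borel_measurable borel"
  shows "(CLINT w|M. iexp (s * (\<Sum>r\<in>{1..l}. p (X (r + k) w)))) = (CLINT w|M. iexp (s * psum p l w))"
proof -
  have [measurable]: "(\<lambda>x. p (x r)) \<in> borel_measurable (Pi\<^sub>M {1..l} (\<lambda>_. borel))" if "r \<in> {1..l}" for r
    by (rule measurable_compose[OF measurable_component_singleton[OF that] p])
  have "(\<lambda>x. iexp (s * (\<Sum>r\<in>{1..l}. p (x r)))) \<in> borel_measurable (Pi\<^sub>M {1..l} (\<lambda>_. borel))"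
    by measurable
  from integral_shift[OF this, of k] show ?thesis by (simp add: psum_def)
qed

text \<open>The r-th variable of a block sees the past only through lags of size at least
  \<open>r\<close>. Summing these tails over the block bounds its covariance with a past of any
  length, and as a sum of tails of a convergent series it is of smaller order than
  \<open>l\<close>.\<close>

definition lag_tail :: "(real \<Rightarrow> real) \<Rightarrow> nat \<Rightarrow> real" where
  "lag_tail q l = (\<Sum>r<l. \<Sum>d. autocov q (d + Suc r))"

lemma lag_tail_over_n:
  assumes "summable (autocov q)"
  shows "(\<lambda>l. lag_tail q l / real l) \<longlonglongrightarrow> 0"
proof -
  have "(\<lambda>k. \<Sum>d. autocov q (d + k)) \<longlonglongrightarrow> 0"
    using suminf_exist_split2[OF assms] by simp
  then have "(\<lambda>r. \<Sum>d. autocov q (d + Suc r)) \<longlonglongrightarrow> 0" by (rule LIMSEQ_Suc)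
  then show ?thesis unfolding lag_tail_def by (rule cesaro_mean_tendsto)
qed

end

section \<open>Newman's block argument\<close>

locale dominated_functional = stationary_associated +
  fixes p q :: "real \<Rightarrow> real" and K :: real
  assumes p_measurable: "p \<in> borel_measurable borel"
    and p_bounded: "\<And>x. \<bar>p x\<bar> \<le> K"
    and p_centered: "(LINT x|F. p x) = 0"
    and dominated: "\<And>x y. x \<le> y \<Longrightarrow> \<bar>p y - p x\<bar> \<le> q y - q x"
    and q_summable: "summable (autocov q)"
    and p_summable: "summable (\<lambda>j. autocov p (Suc j))"
begin

lemma q_mono: "mono q"
  using dominated by (intro monoI) (smt (verit))

lemma q_measurable: "q \<in> borel_measurable borel"
  by (rule borel_measurable_mono[OF q_mono])

lemma K_nonneg: "0 \<le> K"
  using p_bounded[of 0] by linarith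

lemma ess_bounded_p: "1 \<le> i \<Longrightarrow> ess_bounded (\<lambda>w. p (X i w))"
  by (rule ess_boundedI[where c = K])
    (auto intro: measurable_compose[OF X_measurable p_measurable] simp: p_bounded)

text \<open>No bound on \<open>q\<close> is assumed, but a monotone function is bounded on
  \<open>[- C, C]\<close> by its values at the endpoints, and the variables stay there.\<close>

lemma ess_bounded_q: assumes "1 \<le> i" shows "ess_bounded (\<lambda>w. q (X i w))"
proof (rule ess_boundedI)
  show "(\<lambda>w. q (X i w)) \<in> borel_measurable M"
    by (rule measurable_compose[OF X_measurable[OF assms] q_measurable])
  show "AE w in M. \<bar>q (X i w)\<bar> \<le> \<bar>q C\<bar> + \<bar>q (- C)\<bar>"
    using X_bounded[OF assms]
  proof eventually_elim
    fix w assume "\<bar>X i w\<bar> \<le> C"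
    then have "q (- C) \<le> q (X i w)" "q (X i w) \<le> q C" using q_mono by (auto intro: monoD)
    then show "\<bar>q (X i w)\<bar> \<le> \<bar>q C\<bar> + \<bar>q (- C)\<bar>" by linarith
  qed
qed

lemma dominated_sum:
  fixes I J :: "'i set"
  assumes "I \<subseteq> J"
  shows "coordwise_dominated J (\<lambda>x. \<Sum>i\<in>I. p (x i)) (\<lambda>x. \<Sum>i\<in>I. q (x i))"
  unfolding coordwise_dominated_def
proof (intro allI impI)
  fix x y :: "'i \<Rightarrow> real" assume xy: "\<forall>j\<in>J. x j \<le> y j"
  have "\<bar>(\<Sum>i\<in>I. p (y i)) - (\<Sum>i\<in>I. p (x i))\<bar> \<le> (\<Sum>i\<in>I. \<bar>p (y i) - p (x i)\<bar>)"
    by (simp add: sum_subtractf[symmetric])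
  also have "\<dots> \<le> (\<Sum>i\<in>I. q (y i) - q (x i))"
    using xy assms by (intro sum_mono dominated) auto
  finally show "\<bar>(\<Sum>i\<in>I. p (y i)) - (\<Sum>i\<in>I. p (x i))\<bar> \<le> (\<Sum>i\<in>I. q (y i)) - (\<Sum>i\<in>I. q (x i))"
    by (simp add: sum_subtractf)
qed

lemma autocov_q_nonneg: "0 \<le> autocov q d"
proof -
  have "coordwise_dominated {1, 1 + d} (\<lambda>x. q (x k)) (\<lambda>x. q (x k))" if "k \<in> {1, 1 + d}" for k
    using that q_mono by (auto simp: coordwise_dominated_def abs_of_nonneg monoD)
  then have "\<bar>covariance M (\<lambda>w. q (X 1 w)) (\<lambda>w. q (X (1 + d) w))\<bar>
    \<le> covariance M (\<lambda>w. q (X 1 w)) (\<lambda>w. q (X (1 + d) w))"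
    by (intro abs_covariance_le_dominated[where J = "{1, 1 + d}" and X = X
      and f = "\<lambda>x. q (x 1)" and f' = "\<lambda>x. q (x 1)" and g = "\<lambda>x. q (x (1 + d))" and g' = "\<lambda>x. q (x (1 + d))"]
      finitely_associated_X ess_bounded_q) simp_all
  then show ?thesis by (simp add: autocov_def)
qed

text \<open>Extending the sum over lags to infinity, which is harmless as the terms are nonnegative,
  removes the dependence on the length \<open>k\<close> of the past.\<close>

lemma covariance_block_le:
  "covariance M (psum q k) (\<lambda>w. \<Sum>r\<in>{1..l}. q (X (r + k) w)) \<le> lag_tail q l"
proof -
  have eb: "ess_bounded (psum q k)"
    unfolding psum_def[abs_def] using ess_bounded_q by (intro ess_bounded_sum) auto
  have "covariance M (psum q k) (\<lambda>w. \<Sum>r\<in>{1..l}. q (X (r + k) w))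
      = (\<Sum>r\<in>{1..l}. covariance M (psum q k) (\<lambda>w. q (X (k + r) w)))"
    using ess_bounded_q eb by (subst covariance_sum_right) (auto simp: add.commute)
  also have "\<dots> = (\<Sum>r\<in>{1..l}. \<Sum>j<k. autocov q (j + r))"
    using sum_autocov_left[OF q_measurable ess_bounded_q] by (intro sum.cong) auto
  also have "\<dots> \<le> (\<Sum>r\<in>{1..l}. \<Sum>d. autocov q (d + r))"
    using q_summable autocov_q_nonneg by (intro sum_mono sum_le_suminf) auto
  also have "\<dots> = lag_tail q l" unfolding lag_tail_def
    by (rule sum.reindex_bij_witness[of _ Suc "\<lambda>r. r - 1"]) auto
  finally show ?thesis .
qed

lemma psum_measurable: "psum p n \<in> borel_measurable M"
  unfolding psum_def[abs_def]
  by (intro borel_measurable_sum measurable_compose[OF X_measurable p_measurable]) auto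

lemma abs_psum_le: "\<bar>psum p n w\<bar> \<le> K * n"
proof -
  have "\<bar>psum p n w\<bar> \<le> (\<Sum>i\<in>{1..n}. \<bar>p (X i w)\<bar>)" unfolding psum_def by (rule sum_abs)
  also have "\<dots> \<le> (\<Sum>i\<in>{1..n}. K)" by (intro sum_mono p_bounded)
  finally show ?thesis by (simp add: mult.commute)
qed

lemma integrable_psum: "integrable M (psum p n)"
  by (rule integrable_const_bound[where B = "K * n"]) (auto simp: abs_psum_le psum_measurable)

lemma expectation_psum: "expectation (psum p n) = 0"
proof -
  have "expectation (psum p n) = (\<Sum>i\<in>{1..n}. expectation (\<lambda>w. p (X i w)))"
    unfolding psum_def[abs_def]
    by (rule Bochner_Integration.integral_sum) (simp add: ess_bounded_integrable[OF ess_bounded_p])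
  also have "\<dots> = 0" using integral_X[OF _ p_measurable] by (simp add: p_centered)
  finally show ?thesis .
qed

text \<open>Each induction step splits off the last block at the cost of one covariance with the
  past. The earlier error is multiplied by a number of modulus at most 1, so the errors merely add
  up.\<close>

lemma norm_expectation_blocks_le:
  "cmod ((CLINT w|M. iexp (s * psum p (m * l) w)) - (CLINT w|M. iexp (s * psum p l w)) ^ m)
    \<le> m * (4 * s\<^sup>2 * lag_tail q l)"
proof (induction m)
  case 0
  then show ?case by (simp add: psum_def prob_space)
next
  case (Suc m)
  let ?k = "m * l"
  let ?E = "\<lambda>n. CLINT w|M. iexp (s * psum p n w)"
  let ?J = "{1..?k + l}"
  have dom: "coordwise_dominated ?J (\<lambda>x. \<Sum>i\<in>{1..?k}. p (x i)) (\<lambda>x. \<Sum>i\<in>{1..?k}. q (x i))"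
    by (rule dominated_sum) auto
  \<comment> \<open>The block is renumbered from 1, the form in which stationarity removes the
    shift.\<close>
  have re: "(\<Sum>i\<in>{?k + 1..?k + l}. u i) = (\<Sum>r\<in>{1..l}. u (r + ?k))" for u :: "nat \<Rightarrow> real"
    using sum.shift_bounds_cl_nat_ivl[of u 1 ?k l] by (simp add: add.commute)
  have "coordwise_dominated ?J (\<lambda>x. \<Sum>i\<in>{?k + 1..?k + l}. p (x i)) (\<lambda>x. \<Sum>i\<in>{?k + 1..?k + l}. q (x i))"
    by (rule dominated_sum) auto
  then have dom': "coordwise_dominated ?J (\<lambda>x. \<Sum>r\<in>{1..l}. p (x (r + ?k))) (\<lambda>x. \<Sum>r\<in>{1..l}. q (x (r + ?k)))"
    unfolding re .
  have split: "psum p (Suc m * l) w = psum p ?k w + (\<Sum>r\<in>{1..l}. p (X (r + ?k) w))" for w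
  proof -
    have "{1..Suc m * l} = {1..?k} \<union> {?k + 1..?k + l}" by auto
    then have "psum p (Suc m * l) w = (\<Sum>i\<in>{1..?k}. p (X i w)) + (\<Sum>i\<in>{?k + 1..?k + l}. p (X i w))"
      unfolding psum_def by (simp add: sum.union_disjoint)
    then show ?thesis by (simp only: re psum_def)
  qed
  have "cmod ((CLINT w|M. iexp (s * (psum p ?k w + (\<Sum>r\<in>{1..l}. p (X (r + ?k) w)))))
        - ?E ?k * (CLINT w|M. iexp (s * (\<Sum>r\<in>{1..l}. p (X (r + ?k) w)))))
      \<le> 4 * s\<^sup>2 * covariance M (psum q ?k) (\<lambda>w. \<Sum>r\<in>{1..l}. q (X (r + ?k) w))"
    unfolding psum_def[abs_def]
    by (rule norm_iexp_covariance_le[OF finitely_associated_X dom dom'])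
      (auto intro!: ess_bounded_sum ess_bounded_p ess_bounded_q)
  then have "cmod (?E (Suc m * l) - ?E ?k * ?E l)
      \<le> 4 * s\<^sup>2 * covariance M (psum q ?k) (\<lambda>w. \<Sum>r\<in>{1..l}. q (X (r + ?k) w))"
    unfolding split expectation_iexp_block[OF p_measurable] .
  also have "4 * s\<^sup>2 * covariance M (psum q ?k) (\<lambda>w. \<Sum>r\<in>{1..l}. q (X (r + ?k) w)) \<le> 4 * s\<^sup>2 * lag_tail q l"
    by (intro mult_left_mono covariance_block_le) auto
  finally have 1: "cmod (?E (Suc m * l) - ?E ?k * ?E l) \<le> 4 * s\<^sup>2 * lag_tail q l" .
  have "cmod (?E ?k * ?E l - ?E l ^ m * ?E l) = cmod (?E ?k - ?E l ^ m) * cmod (?E l)"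
    by (simp add: left_diff_distrib[symmetric] norm_mult)
  also have "\<dots> \<le> cmod (?E ?k - ?E l ^ m) * 1"
    by (intro mult_left_mono norm_expectation_iexp_le_1 borel_measurable_times psum_measurable) auto
  finally have "cmod (?E ?k * ?E l - ?E l ^ m * ?E l) \<le> m * (4 * s\<^sup>2 * lag_tail q l)"
    using Suc by simp
  then have "cmod (?E (Suc m * l) - ?E l ^ m * ?E l) \<le> 4 * s\<^sup>2 * lag_tail q l + m * (4 * s\<^sup>2 * lag_tail q l)"
    using norm_triangle_ineq[of "?E (Suc m * l) - ?E ?k * ?E l" "?E ?k * ?E l - ?E l ^ m * ?E l"] 1 by simp
  then show ?case by (simp add: mult.commute distrib_right)
qed

text \<open>The crude third moment bound \<open>(K * l) ^ 3\<close> is good enough, since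
  \<open>l\<close> stays fixed while \<open>s\<close> tends to 0.\<close>

lemma norm_char_psum_approx:
  "cmod ((CLINT w|M. iexp (s * psum p l w)) - (1 - complex_of_real (s\<^sup>2 * variance (psum p l) / 2)))
    \<le> \<bar>s\<bar> ^ 3 * (K * l) ^ 3 / 6"
proof -
  let ?S = "psum p l"
  have [measurable]: "?S \<in> borel_measurable M" by (rule psum_measurable)
  have i2: "integrable M (\<lambda>w. (?S w)\<^sup>2)"
    by (rule integrable_const_bound[where B = "(K * l)\<^sup>2"])
      (auto simp: abs_psum_le intro!: power2_le_iff_abs_le[THEN iffD2] mult_nonneg_nonneg K_nonneg)
  have ic: "integrable M (\<lambda>w. complex_of_real (?S w))" "integrable M (\<lambda>w. complex_of_real ((?S w)\<^sup>2))"
    using i2 integrable_psum by (auto simp del: of_real_power)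
  have V: "variance ?S = expectation (\<lambda>w. (?S w)\<^sup>2)" by (simp add: expectation_psum)
  let ?P = "\<lambda>w. 1 + \<i> * complex_of_real s * complex_of_real (?S w) - complex_of_real (s\<^sup>2 / 2) * complex_of_real ((?S w)\<^sup>2)"
  have iP: "integrable M ?P" using ic by (intro Bochner_Integration.integrable_diff
      Bochner_Integration.integrable_add integrable_mult_right) auto
  have "(CLINT w|M. ?P w) = 1 - complex_of_real (s\<^sup>2 * variance ?S / 2)"
    using ic expectation_psum[of l] unfolding V
    by (simp add: prob_space del: of_real_power)
  then have "cmod ((CLINT w|M. iexp (s * ?S w)) - (1 - complex_of_real (s\<^sup>2 * variance ?S / 2)))
      = cmod (CLINT w|M. iexp (s * ?S w) - ?P w)"
    using iP integrable_iexp[of "\<lambda>w. s * ?S w"] by simp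
  also have "\<dots> \<le> (LINT w|M. cmod (iexp (s * ?S w) - ?P w))" by (rule integral_norm_bound)
  also have "\<dots> \<le> (LINT w|M. \<bar>s\<bar> ^ 3 * (K * l) ^ 3 / 6)"
  proof (intro integral_mono integrable_norm)
    show "integrable M (\<lambda>w. iexp (s * ?S w) - ?P w)"
      by (rule Bochner_Integration.integrable_diff[OF integrable_iexp iP]) measurable
    fix w
    have P: "(\<Sum>k\<le>2. (\<i> * complex_of_real (s * ?S w)) ^ k / fact k) = ?P w"
      by (simp add: numeral_2_eq_2 power2_eq_square algebra_simps)
    have "Suc 2 = 3" "fact 3 = (6 :: real)" by (simp_all add: eval_nat_numeral)
    then have "cmod (iexp (s * ?S w) - ?P w) \<le> \<bar>s * ?S w\<bar> ^ 3 / 6"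
      using iexp_approx1[of "s * ?S w" 2] unfolding P by (simp only:)
    also have "\<dots> \<le> (\<bar>s\<bar> * (K * l)) ^ 3 / 6"
      unfolding abs_mult by (intro divide_right_mono power_mono mult_left_mono abs_psum_le) auto
    finally show "cmod (iexp (s * ?S w) - ?P w) \<le> \<bar>s\<bar> ^ 3 * (K * l) ^ 3 / 6"
      by (simp add: power_mult_distrib)
  qed auto
  also have "\<dots> = \<bar>s\<bar> ^ 3 * (K * l) ^ 3 / 6" by (simp add: prob_space)
  finally show ?thesis .
qed

end

context dominated_functional begin

lemma lag_tail_nonneg: "0 \<le> lag_tail q l"
  unfolding lag_tail_def using q_summable autocov_q_nonneg
  by (intro sum_nonneg suminf_nonneg summable_iff_shift[THEN iffD2]) auto

lemma abs_psum_diff_le: "m * l \<le> n \<Longrightarrow> n \<le> m * l + l \<Longrightarrow> \<bar>psum p n w - psum p (m * l) w\<bar> \<le> K * l"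
proof -
  assume n: "m * l \<le> n" "n \<le> m * l + l"
  have "{1..n} = {1..m * l} \<union> {m * l + 1..n}" using n by auto
  then have "psum p n w - psum p (m * l) w = (\<Sum>i\<in>{m * l + 1..n}. p (X i w))"
    unfolding psum_def by (simp add: sum.union_disjoint)
  also have "\<bar>\<dots>\<bar> \<le> (\<Sum>i\<in>{m * l + 1..n}. \<bar>p (X i w)\<bar>)" by (rule sum_abs)
  also have "\<dots> \<le> (\<Sum>i\<in>{m * l + 1..n}. K)" by (intro sum_mono p_bounded)
  also have "\<dots> = K * real (n - m * l)" by simp
  also have "\<dots> \<le> K * l"
    using n K_nonneg by (intro mult_left_mono of_nat_mono) auto
  finally show ?thesis .
qed

text \<open>The first summand, the dependence between blocks, is the only one that survives when
  \<open>n\<close> grows for fixed \<open>l\<close>. The bracket collects the incomplete last block,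
  the Taylor errors of one block taken \<open>n div l\<close> times, and the rounding of
  \<open>n / l\<close>.\<close>

lemma char_psum_block_le:
  fixes t :: real and n l :: nat
  assumes l: "1 \<le> l" and n: "1 \<le> n"
  defines "s \<equiv> t / sqrt n" and "u \<equiv> t\<^sup>2 * (real (n div l) / real n)" and "V \<equiv> variance (psum p l)"
  shows "cmod ((CLINT w|M. iexp (t / sqrt n * psum p n w)) - complex_of_real (exp (- (t\<^sup>2 * (V / l) / 2))))
    \<le> 4 * t\<^sup>2 * (lag_tail q l / l)
      + (\<bar>s\<bar> * (K * l) + u * (\<bar>s\<bar> * ((K * l) ^ 3 / 6) + s\<^sup>2 * (V / 2)\<^sup>2)
        + \<bar>exp (- (u * V / 2)) - exp (- (t\<^sup>2 * (V / l) / 2))\<bar>)"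
proof -
  define m where "m = n div l"
  have ml: "m * l \<le> n" "n \<le> m * l + l"
  proof -
    have "n = m * l + n mod l" "n mod l < l" using l by (simp_all add: m_def)
    then show "m * l \<le> n" "n \<le> m * l + l" by linarith+
  qed
  have u: "m * s\<^sup>2 = u" using n by (simp add: u_def s_def m_def power_divide)
  let ?E = "\<lambda>k. CLINT w|M. iexp (s * psum p k w)"
  \<comment> \<open>\<open>c\<close> is the Gaussian factor of a single block, so
    \<open>c ^ m\<close> is again a Gaussian value, with exponent
    \<open>- (u * V / 2)\<close>.\<close>
  define c where "c = complex_of_real (exp (- (s\<^sup>2 * V / 2)))"
  let ?a = "complex_of_real (exp (- (t\<^sup>2 * (V / l) / 2)))"
  have [measurable]: "psum p k \<in> borel_measurable M" for k by (rule psum_measurable)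
  have V: "0 \<le> V" unfolding V_def by (rule variance_positive)
  have 1: "cmod (?E n - ?E (m * l)) \<le> \<bar>s\<bar> * (K * l)"
  proof -
    have bound: "\<bar>s * psum p n w - s * psum p (m * l) w\<bar> \<le> \<bar>s\<bar> * (K * l)" for w
      unfolding right_diff_distrib[symmetric] abs_mult by (intro mult_left_mono abs_psum_diff_le ml) simp
    have int: "integrable M (\<lambda>w. \<bar>s * psum p n w - s * psum p (m * l) w\<bar>)"
      by (rule integrable_const_bound[where B = "\<bar>s\<bar> * (K * l)"]) (use bound in auto)
    have "cmod (?E n - ?E (m * l)) \<le> expectation (\<lambda>w. \<bar>s * psum p n w - s * psum p (m * l) w\<bar>)"
      by (rule norm_expectation_iexp_diff_le[OF _ _ int]) measurable
    also have "\<dots> \<le> expectation (\<lambda>w. \<bar>s\<bar> * (K * l))"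
      by (intro integral_mono int bound) simp
    finally show ?thesis by (simp add: prob_space)
  qed
  have 2: "cmod (?E (m * l) - ?E l ^ m) \<le> 4 * t\<^sup>2 * (lag_tail q l / l)"
  proof -
    have "cmod (?E (m * l) - ?E l ^ m) \<le> 4 * (m * s\<^sup>2) * lag_tail q l"
      using norm_expectation_blocks_le[of s m l] by (simp add: mult_ac)
    \<comment> \<open>The number of blocks compensates the scaling: \<open>m\<close> errors of order
      \<open>t\<^sup>2 / n\<close> leave the average of the lag tail over one block.\<close>
    also have "m * s\<^sup>2 \<le> t\<^sup>2 / l"
    proof -
      have "real m * real l \<le> real n" using ml(1) by (metis of_nat_le_iff of_nat_mult)
      then have "real m / real n \<le> 1 / l" using l n by (simp add: field_simps)
      then have "t\<^sup>2 * (real m / real n) \<le> t\<^sup>2 * (1 / l)" by (rule mult_left_mono) simp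
      then show ?thesis using u unfolding u_def m_def by simp
    qed
    finally show ?thesis using lag_tail_nonneg[of l] by (simp add: mult_left_mono mult_right_mono)
  qed
  have c1: "cmod c \<le> 1" unfolding c_def norm_of_real using V by simp
  have 3: "cmod (?E l ^ m - c ^ m) \<le> u * (\<bar>s\<bar> * ((K * l) ^ 3 / 6) + s\<^sup>2 * (V / 2)\<^sup>2)"
  proof -
    have "cmod (1 - complex_of_real (s\<^sup>2 * V / 2) - c) = \<bar>exp (- (s\<^sup>2 * V / 2)) - (1 - s\<^sup>2 * V / 2)\<bar>"
      unfolding c_def by (metis abs_minus_commute norm_of_real of_real_1 of_real_diff)
    also have "\<dots> \<le> (s\<^sup>2 * V / 2)\<^sup>2" by (rule exp_minus_approx) (use V in simp)
    finally have "cmod (?E l - c) \<le> \<bar>s\<bar> ^ 3 * (K * l) ^ 3 / 6 + (s\<^sup>2 * V / 2)\<^sup>2"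
      using norm_char_psum_approx[of s l, folded V_def]
        norm_triangle_ineq[of "?E l - (1 - complex_of_real (s\<^sup>2 * V / 2))" "1 - complex_of_real (s\<^sup>2 * V / 2) - c"]
      by simp
    also have "\<dots> = s\<^sup>2 * (\<bar>s\<bar> * ((K * l) ^ 3 / 6) + s\<^sup>2 * (V / 2)\<^sup>2)"
      by (simp add: power3_eq_cube power2_eq_square algebra_simps abs_mult_self_eq)
    finally have "m * cmod (?E l - c) \<le> m * (s\<^sup>2 * (\<bar>s\<bar> * ((K * l) ^ 3 / 6) + s\<^sup>2 * (V / 2)\<^sup>2))"
      by (rule mult_left_mono) simp
    moreover have "cmod (?E l ^ m - c ^ m) \<le> m * cmod (?E l - c)"
      by (rule norm_power_diff[OF _ c1]) (intro norm_expectation_iexp_le_1, measurable)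
    ultimately show ?thesis by (simp add: u[symmetric] mult.assoc)
  qed
  have 4: "cmod (c ^ m - ?a) = \<bar>exp (- (u * V / 2)) - exp (- (t\<^sup>2 * (V / l) / 2))\<bar>"
  proof -
    have "c ^ m = complex_of_real (exp (- (u * V / 2)))"
      unfolding c_def of_real_power[symmetric] exp_of_nat_mult[symmetric] u[symmetric] by (simp add: mult_ac)
    then show ?thesis by (metis norm_of_real of_real_diff)
  qed
  have "cmod (?E n - ?a) \<le> cmod (?E n - ?E (m * l)) + cmod (?E (m * l) - ?E l ^ m)
      + cmod (?E l ^ m - c ^ m) + cmod (c ^ m - ?a)"
    using norm_triangle_ineq[of "?E n - ?E (m * l)" "?E (m * l) - ?a"]
      norm_triangle_ineq[of "?E (m * l) - ?E l ^ m" "?E l ^ m - ?a"]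
      norm_triangle_ineq[of "?E l ^ m - c ^ m" "c ^ m - ?a"] by simp
  with 1 2 3 4 show ?thesis unfolding s_def by simp
qed

theorem char_psum_tendsto:
  "(\<lambda>n. CLINT w|M. iexp (t / sqrt (real n) * psum p n w)) \<longlonglongrightarrow>
    complex_of_real (exp (- (t\<^sup>2 * (autocov p 0 + 2 * (\<Sum>j. autocov p (Suc j))) / 2)))"
proof -
  let ?V = "\<lambda>l. variance (psum p l)"
  let ?s = "\<lambda>n. t / sqrt (real n)"
  let ?u = "\<lambda>l n. t\<^sup>2 * (real (n div l) / real n)"
  have s: "?s \<longlonglongrightarrow> 0"
    by (intro tendsto_divide_0[OF tendsto_const] filterlim_at_top_imp_at_infinity
      filterlim_compose[OF sqrt_at_top filterlim_real_sequentially])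
  have u: "?u l \<longlonglongrightarrow> t\<^sup>2 * (1 / real l)" if "1 \<le> l" for l
    by (intro tendsto_intros div_over_tendsto that)
  show ?thesis
  proof (rule tendsto_if_eventually_close[where
      a = "\<lambda>l. complex_of_real (exp (- (t\<^sup>2 * (?V l / l) / 2)))"
      and e = "\<lambda>l. 4 * t\<^sup>2 * (lag_tail q l / l)"
      and R = "\<lambda>l n. \<bar>?s n\<bar> * (K * l) + ?u l n * (\<bar>?s n\<bar> * ((K * l) ^ 3 / 6) + (?s n)\<^sup>2 * (?V l / 2)\<^sup>2)
        + \<bar>exp (- (?u l n * ?V l / 2)) - exp (- (t\<^sup>2 * (?V l / l) / 2))\<bar>"])
    show "(\<lambda>l. complex_of_real (exp (- (t\<^sup>2 * (?V l / real l) / 2))))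
        \<longlonglongrightarrow> complex_of_real (exp (- (t\<^sup>2 * (autocov p 0 + 2 * (\<Sum>j. autocov p (Suc j))) / 2)))"
      by (intro tendsto_intros variance_psum_over_n[OF p_measurable ess_bounded_p p_summable]) auto
    show "(\<lambda>l. 4 * t\<^sup>2 * (lag_tail q l / real l)) \<longlonglongrightarrow> 0"
      using tendsto_mult[OF tendsto_const lag_tail_over_n[OF q_summable], of "4 * t\<^sup>2"] by simp
    show "(\<lambda>n. \<bar>?s n\<bar> * (K * l) + ?u l n * (\<bar>?s n\<bar> * ((K * l) ^ 3 / 6) + (?s n)\<^sup>2 * (?V l / 2)\<^sup>2)
        + \<bar>exp (- (?u l n * ?V l / 2)) - exp (- (t\<^sup>2 * (?V l / l) / 2))\<bar>) \<longlonglongrightarrow> 0"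
      if l: "1 \<le> l" for l
    proof -
      \<comment> \<open>In the limit every term with a factor \<open>?s n\<close> vanishes, and the
        last difference cancels because \<open>n div l / n\<close> tends to
        \<open>1 / l\<close>.\<close>
      have "(\<lambda>n. \<bar>?s n\<bar> * (K * l) + ?u l n * (\<bar>?s n\<bar> * ((K * l) ^ 3 / 6) + (?s n)\<^sup>2 * (?V l / 2)\<^sup>2)
        + \<bar>exp (- (?u l n * ?V l / 2)) - exp (- (t\<^sup>2 * (?V l / l) / 2))\<bar>)
        \<longlonglongrightarrow> \<bar>0\<bar> * (K * l) + t\<^sup>2 * (1 / real l) * (\<bar>0\<bar> * ((K * l) ^ 3 / 6) + 0\<^sup>2 * (?V l / 2)\<^sup>2)
        + \<bar>exp (- (t\<^sup>2 * (1 / real l) * ?V l / 2)) - exp (- (t\<^sup>2 * (?V l / l) / 2))\<bar>"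
        by (intro tendsto_intros s u[OF l]) auto
      then show ?thesis by simp
    qed
  qed (rule char_psum_block_le)
qed

end

text \<open>Each index belongs to \<open>n - 1\<close> pairs. Subtraction in the reals keeps the
  formula valid at \<open>n = 0\<close>, where the sum on the right is empty.\<close>

lemma sum_pairs_add:
  fixes a :: "nat \<Rightarrow> real"
  shows "(\<Sum>(i, j)\<in>pairs n. a i + a j) = (real n - 1) * (\<Sum>i\<in>{1..n}. a i)"
proof (induction n)
  case 0
  have "pairs 0 = {}" by auto
  then show ?case by (simp only: sum.empty) simp
next
  case (Suc n)
  have fin: "finite (pairs n)" by (rule finite_subset[of _ "{1..n} \<times> {1..n}"]) auto
  have "pairs (Suc n) = pairs n \<union> (\<lambda>i. (i, Suc n)) ` {1..n}" by auto
  then have "(\<Sum>(i, j)\<in>pairs (Suc n). a i + a j)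
      = (\<Sum>(i, j)\<in>pairs n. a i + a j) + (\<Sum>(i, j)\<in>(\<lambda>i. (i, Suc n)) ` {1..n}. a i + a j)"
    using fin by (simp only:) (rule sum.union_disjoint; auto)
  also have "(\<Sum>(i, j)\<in>(\<lambda>i. (i, Suc n)) ` {1..n}. a i + a j) = (\<Sum>i\<in>{1..n}. a i + a (Suc n))"
    by (subst sum.reindex) (auto simp: inj_on_def)
  finally show ?case using Suc by (simp add: sum.distrib algebra_simps)
qed

lemma real_choose_2: "real (n choose 2) = real n * (real n - 1) / 2"
  by (induction n) (simp_all add: numeral_2_eq_2 field_simps)

section \<open>The U-statistic\<close>

context ustat_setting begin

abbreviation "c1 x \<equiv> r1 x - theta \<rho> F"

text \<open>The U-statistic of the degenerate kernel. Its mean square is of order 1/n^2, whereas the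
  linear part has variance of order 1/n.\<close>

definition remainder :: "nat \<Rightarrow> 'a \<Rightarrow> real" where
  "remainder n w = (\<Sum>(i, j)\<in>pairs n. h (X i w) (X j w)) / real (n choose 2)"

lemma hoeffding_decomposition:
  assumes n: "2 \<le> n"
  shows "U_stat \<rho> X n w = theta \<rho> F + 2 / n * psum c1 n w + remainder n w"
proof -
  let ?N = "real (n choose 2)"
  have N: "0 < ?N" using n by (simp add: real_choose_2)
  \<comment> \<open>The number of pairs comes from the same counting formula, with half of the
    constant placed at each entry.\<close>
  have card: "(\<Sum>(i, j)\<in>pairs n. theta \<rho> F) = theta \<rho> F * ?N"
    using sum_pairs_add[of "\<lambda>_. theta \<rho> F / 2" n]
    by (simp add: real_choose_2 case_prod_beta' mult.commute)
  have "(\<Sum>(i, j)\<in>pairs n. \<rho> (X i w) (X j w))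
      = (\<Sum>(i, j)\<in>pairs n. (theta \<rho> F + (c1 (X i w) + c1 (X j w))) + h (X i w) (X j w))"
    by (intro sum.cong refl) (auto simp: h_def)
  also have "\<dots> = (\<Sum>(i, j)\<in>pairs n. theta \<rho> F) + (\<Sum>(i, j)\<in>pairs n. c1 (X i w) + c1 (X j w))
      + (\<Sum>(i, j)\<in>pairs n. h (X i w) (X j w))"
    unfolding case_prod_beta' by (simp only: sum.distrib)
  also have "\<dots> = theta \<rho> F * ?N + (real n - 1) * psum c1 n w + (\<Sum>(i, j)\<in>pairs n. h (X i w) (X j w))"
    unfolding card psum_def sum_pairs_add[of "\<lambda>i. c1 (X i w)"] ..
  also have "(real n - 1) * psum c1 n w = ?N * (2 / n * psum c1 n w)"
    using n by (simp add: real_choose_2)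
  finally show ?thesis using N
    by (simp add: U_stat_def remainder_def add_divide_distrib)
qed

lemma c1_measurable: "(\<lambda>x. c1 x) \<in> borel_measurable borel"
  by measurable

lemma abs_c1_le: "\<bar>c1 x\<bar> \<le> 2 * C2"
  using abs_rho1_le[of x] abs_theta_le by linarith

lemma ess_bounded_c1: "1 \<le> i \<Longrightarrow> ess_bounded (\<lambda>w. c1 (X i w))"
  by (rule ess_boundedI[where c = "2 * C2"])
    (auto intro: measurable_compose[OF X_measurable c1_measurable] simp: abs_c1_le)

lemma ess_bounded_psum: "ess_bounded (psum c1 n)"
  unfolding psum_def[abs_def] using ess_bounded_c1 by (intro ess_bounded_sum) auto

lemma autocov_shift: "autocov (\<lambda>x. f x - c) d = autocov f d" if "integrable F f" "f \<in> borel_measurable borel"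
proof -
  have "expectation (\<lambda>w. f (X i w) - c) = expectation (\<lambda>w. f (X i w)) - c" if "1 \<le> i" for i
    using that \<open>integrable F f\<close> \<open>f \<in> _\<close> integral_X[OF that, of f] integral_X[OF that, of "\<lambda>x. f x - c"]
    by (simp add: F.prob_space[simplified])
  then show ?thesis by (simp add: autocov_def covariance_def)
qed

lemma autocov_c1: "autocov (\<lambda>x. c1 x) d = sigma1 M X \<rho> F d"
  by (subst autocov_shift[OF integrable_rho1 measurable_rho1]) (simp add: autocov_def sigma1_def)

lemma sigmaU_sq_eq: "sigmaU_sq M X \<rho> F = autocov (\<lambda>x. c1 x) 0 + 2 * (\<Sum>j. autocov (\<lambda>x. c1 x) (Suc j))"
  unfolding autocov_c1 sigmaU_sq_def sigma1_sq_def by (simp add: sigma1_def covariance_def power2_eq_square)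

lemma ess_bounded_h: "1 \<le> i \<Longrightarrow> 1 \<le> j \<Longrightarrow> ess_bounded (\<lambda>w. h (X i w) (X j w))"
  by (rule ess_boundedI[where c = "4 * C2"]) (auto intro!: measurable_h X_measurable abs_h_le)

lemma ess_bounded_remainder: "ess_bounded (remainder n)"
proof -
  have "ess_bounded (\<lambda>w. (1 / real (n choose 2)) * (\<Sum>p\<in>pairs n. h (X (fst p) w) (X (snd p) w)))"
    by (intro ess_bounded_cmult ess_bounded_sum ess_bounded_h) auto
  then show ?thesis by (simp add: remainder_def[abs_def] case_prod_beta')
qed

lemma expectation_remainder_square_le:
  "\<exists>K\<ge>0. \<forall>n\<ge>2. expectation (\<lambda>w. (remainder n w)\<^sup>2) \<le> K / (real n)\<^sup>2"
proof -
  obtain K where K: "0 \<le> K" "\<And>n. expectation (\<lambda>w. (\<Sum>(i, j)\<in>pairs n. h (X i w) (X j w))\<^sup>2) \<le> K * (real n)\<^sup>2"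
    using expectation_sum_h_square_le by blast
  have "expectation (\<lambda>w. (remainder n w)\<^sup>2) \<le> 16 * K / (real n)\<^sup>2" if n: "2 \<le> n" for n
  proof -
    let ?N = "real (n choose 2)"
    \<comment> \<open>For \<open>2 \<le> n\<close> the binomial coefficient is at least a quarter of
      \<open>n\<^sup>2\<close>; squaring the 4 gives the constant 16.\<close>
    have "real n * (real n / 2) \<le> real n * (real n - 1)" using n by (intro mult_left_mono) auto
    then have N: "(real n)\<^sup>2 / 4 \<le> ?N" by (simp add: real_choose_2 power2_eq_square)
    have "expectation (\<lambda>w. (remainder n w)\<^sup>2)
        = expectation (\<lambda>w. (\<Sum>(i, j)\<in>pairs n. h (X i w) (X j w))\<^sup>2) / ?N\<^sup>2"
      by (simp add: remainder_def power_divide)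
    also have "\<dots> \<le> K * (real n)\<^sup>2 / ((real n)\<^sup>2 / 4)\<^sup>2"
      using K N n by (intro frac_le power_mono) auto
    also have "\<dots> = 16 * K / (real n)\<^sup>2" using n by (simp add: power2_eq_square)
    finally show ?thesis .
  qed
  then show ?thesis using K(1) by (intro exI[of _ "16 * K"]) auto
qed

lemma tendsto_const_over_sqrt: "(\<lambda>n. K / sqrt (real n)) \<longlonglongrightarrow> (0 :: real)"
  by (intro tendsto_divide_0[OF tendsto_const] filterlim_at_top_imp_at_infinity
      filterlim_compose[OF sqrt_at_top filterlim_real_sequentially])

lemma variance_U_stat_tendsto:
  assumes sigma: "summable (\<lambda>j. sigma1 M X \<rho> F (Suc j))"
  shows "(\<lambda>n. real n * variance (U_stat \<rho> X n)) \<longlonglongrightarrow> 4 * sigmaU_sq M X \<rho> F"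
proof -
  let ?V = "\<lambda>n. variance (psum c1 n) / real n"
  have V: "?V \<longlonglongrightarrow> sigmaU_sq M X \<rho> F"
    unfolding sigmaU_sq_eq using sigma
    by (intro variance_psum_over_n[OF c1_measurable] ess_bounded_c1) (simp_all add: autocov_c1)
  obtain K where K: "0 \<le> K" "\<And>n. n \<ge> 2 \<Longrightarrow> expectation (\<lambda>w. (remainder n w)\<^sup>2) \<le> K / (real n)\<^sup>2"
    using expectation_remainder_square_le by blast
  have main: "\<bar>real n * variance (U_stat \<rho> X n) - 4 * ?V n\<bar>
      \<le> (4 * ?V n + K) / sqrt (real n) + K / sqrt (real n)" if n: "2 \<le> n" for n
  proof -
    let ?A = "\<lambda>w. 2 / n * psum c1 n w" and ?R = "remainder n"
    have eA: "ess_bounded ?A" by (rule ess_bounded_cmult[OF ess_bounded_psum])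
    have iA: "integrable M ?A" and iR: "integrable M ?R"
      using eA ess_bounded_remainder by (auto intro: ess_bounded_integrable)
    have VR: "variance ?R \<le> K / (real n)\<^sup>2"
    proof -
      have "variance ?R = expectation (\<lambda>w. (?R w)\<^sup>2) - (expectation ?R)\<^sup>2"
        using ess_bounded_integrable[OF ess_bounded_mult[OF ess_bounded_remainder ess_bounded_remainder]] iR
        by (intro variance_eq) (simp_all add: power2_eq_square)
      with K(2)[OF n] show ?thesis by (smt (verit) zero_le_power2)
    qed
    have VR0: "0 \<le> variance ?R" by (rule variance_positive)
    have VA: "real n * variance ?A = 4 * ?V n"
    proof -
      have "variance ?A = (2 / n)\<^sup>2 * variance (psum c1 n)"
        \<comment> \<open>The scaled sum is read as the constant 0 plus \<open>2 / n\<close> times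
          the partial sum.\<close>
        using variance_add[OF ess_bounded_const[of 0] ess_bounded_psum, of "2 / n" n]
          covariance_const_left[OF ess_bounded_psum, of 0 n] by simp
      then show ?thesis using n by (simp add: power2_eq_square)
    qed
    have VU: "variance (U_stat \<rho> X n) = variance ?A + 2 * covariance M ?A ?R + variance ?R"
    proof -
      have "U_stat \<rho> X n = (\<lambda>w. (?A w + 1 * ?R w) + theta \<rho> F)"
        using hoeffding_decomposition[OF n] by (simp add: fun_eq_iff)
      then have "variance (U_stat \<rho> X n) = variance (\<lambda>w. ?A w + 1 * ?R w)"
        using iA iR by (simp add: prob_space)
      then show ?thesis using variance_add[OF eA ess_bounded_remainder, of 1 n] by simp
    qed
    let ?q = "sqrt (real n)"
    have q: "0 < ?q" "1 \<le> ?q" "?q * ?q = n" using n by auto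
    \<comment> \<open>The weight \<open>sqrt n\<close> balances the two variances, of order 1/n and
      1/n^2: \<open>2 * ?q * \<bar>covariance M ?A ?R\<bar>\<close> is then of order 1/n, and the
      covariance times \<open>n\<close> is of order 1 / sqrt n.\<close>
    have "0 \<le> variance (\<lambda>w. ?A w + c * ?R w)" for c by (rule variance_positive)
    from this[of ?q] this[of "- ?q"]
    have "2 * ?q * \<bar>covariance M ?A ?R\<bar> \<le> variance ?A + n * variance ?R"
      unfolding variance_add[OF eA ess_bounded_remainder] using q(3) by (auto simp: abs_if power2_eq_square)
    then have "?q * (2 * ?q * \<bar>covariance M ?A ?R\<bar>) \<le> ?q * (variance ?A + n * variance ?R)"
      using q by (intro mult_left_mono) auto
    moreover have "?q * (2 * ?q * \<bar>covariance M ?A ?R\<bar>) = (?q * ?q) * (2 * \<bar>covariance M ?A ?R\<bar>)"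
      by (simp only: mult_ac)
    then have "?q * (2 * ?q * \<bar>covariance M ?A ?R\<bar>) = n * (2 * \<bar>covariance M ?A ?R\<bar>)"
      by (simp only: q(3))
    ultimately have "n * (2 * \<bar>covariance M ?A ?R\<bar>) \<le> ?q * (variance ?A + n * variance ?R)"
      by (simp only:)
    also have "\<dots> = (?q * ?q) * (variance ?A + n * variance ?R) / ?q"
    proof -
      have "b * z = (b * b) * z / b" if "0 < b" for b z :: real using that by simp
      from this[OF q(1)] show ?thesis .
    qed
    also have "\<dots> = (n * variance ?A + real n * real n * variance ?R) / ?q"
      by (simp only: q(3) distrib_left mult.assoc)
    also have "\<dots> \<le> (4 * ?V n + K) / ?q"
    proof (rule divide_right_mono)
      have "real n * real n * variance ?R \<le> real n * real n * (K / (real n)\<^sup>2)"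
        using VR by (intro mult_left_mono) auto
      also have "\<dots> = K" using n by (simp add: power2_eq_square)
      finally show "n * variance ?A + real n * real n * variance ?R \<le> 4 * ?V n + K" using VA by simp
    qed (use q in simp)
    finally have "n * (2 * \<bar>covariance M ?A ?R\<bar>) \<le> (4 * ?V n + K) / ?q" .
    moreover have "n * variance ?R \<le> K / ?q"
    proof -
      have "n * variance ?R \<le> n * (K / (real n)\<^sup>2)" using VR by (intro mult_left_mono) auto
      also have "\<dots> = K / (?q * ?q)" using n q(3) by (simp add: power2_eq_square)
      also have "\<dots> \<le> K / (?q * 1)" using q K(1) by (intro divide_left_mono mult_left_mono) auto
      finally show ?thesis by simp
    qed
    moreover have "real n * variance (U_stat \<rho> X n) - 4 * ?V n = n * (2 * covariance M ?A ?R) + n * variance ?R"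
      unfolding VU VA[symmetric] by (simp add: algebra_simps)
    moreover have "\<bar>n * (2 * covariance M ?A ?R)\<bar> = n * (2 * \<bar>covariance M ?A ?R\<bar>)"
      by (simp add: abs_mult)
    moreover have "0 \<le> n * variance ?R" using VR0 by simp
    ultimately show ?thesis by linarith
  qed
  have "(\<lambda>n. (4 * ?V n + K) * (1 / sqrt (real n)) + K / sqrt (real n)) \<longlonglongrightarrow> (4 * sigmaU_sq M X \<rho> F + K) * 0 + 0"
    by (intro tendsto_intros V tendsto_const_over_sqrt)
  then have lim: "(\<lambda>n. (4 * ?V n + K) / sqrt (real n) + K / sqrt (real n)) \<longlonglongrightarrow> 0" by simp
  have "(\<lambda>n. real n * variance (U_stat \<rho> X n) - 4 * ?V n) \<longlonglongrightarrow> 0"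
    by (rule Lim_null_comparison[OF eventually_mono[OF eventually_ge_at_top[of 2]] lim])
      (unfold real_norm_def, rule main)
  from tendsto_add[OF this tendsto_mult[OF tendsto_const V, of 4]] show ?thesis by simp
qed

lemma U_stat_measurable: "U_stat \<rho> X n \<in> borel_measurable M"
proof -
  have "(\<lambda>w. (\<Sum>p\<in>pairs n. \<rho> (X (fst p) w) (X (snd p) w)) / real (n choose 2)) \<in> borel_measurable M"
    by (intro borel_measurable_divide borel_measurable_sum measurable_rho X_measurable borel_measurable_const) auto
  then show ?thesis by (simp add: U_stat_def[abs_def] case_prod_beta')
qed

lemma U_stat_clt:
  assumes sigma: "summable (\<lambda>j. sigma1 M X \<rho> F (Suc j))"
    and pos: "0 < sigmaU_sq M X \<rho> F"
    and dom: "mono_dominated r1 q"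
    and q: "summable (\<lambda>j. covariance M (\<lambda>w. q (X 1 w)) (\<lambda>w. q (X (Suc j) w)))"
  shows "weak_conv_m
    (\<lambda>n. distr M borel (\<lambda>w. sqrt (real n) * (U_stat \<rho> X n w - theta \<rho> F) / (2 * sqrt (sigmaU_sq M X \<rho> F))))
    std_normal_distribution"
proof -
  interpret D: dominated_functional M X F C "\<lambda>x. c1 x" q "2 * C2"
  proof
    show "(\<lambda>x. c1 x) \<in> borel_measurable borel" by (rule c1_measurable)
    show "\<bar>c1 x\<bar> \<le> 2 * C2" for x by (rule abs_c1_le)
    show "(LINT x|F. c1 x) = 0"
      using integrable_rho1 by (simp add: theta_eq[symmetric] F.prob_space[simplified])
    show "\<bar>c1 y - c1 x\<bar> \<le> q y - q x" if "x \<le> y" for x y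
      using dom monoD[OF _ that] unfolding mono_dominated_def by (fastforce simp: abs_le_iff)
    show "summable (autocov q)" using q by (simp add: autocov_def[abs_def])
    show "summable (\<lambda>j. autocov (\<lambda>x. c1 x) (Suc j))" using sigma by (simp add: autocov_c1)
  qed
  let ?\<sigma> = "sqrt (sigmaU_sq M X \<rho> F)"
  have \<sigma>: "0 < ?\<sigma>" "?\<sigma>\<^sup>2 = sigmaU_sq M X \<rho> F" using pos by auto
  let ?W = "\<lambda>n w. sqrt (real n) * (U_stat \<rho> X n w - theta \<rho> F) / (2 * ?\<sigma>)"
  have W: "?W n \<in> borel_measurable M" for n
    by (intro borel_measurable_divide borel_measurable_times borel_measurable_diff U_stat_measurable
      borel_measurable_const)
  have psum_meas: "psum c1 n \<in> borel_measurable M" for n by (rule D.psum_measurable)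
  obtain K where K: "0 \<le> K" "\<And>n. n \<ge> 2 \<Longrightarrow> expectation (\<lambda>w. (remainder n w)\<^sup>2) \<le> K / (real n)\<^sup>2"
    using expectation_remainder_square_le by blast
  show ?thesis
  proof (rule levy_continuity)
    show "real_distribution (distr M borel (?W n))" for n
      by (rule real_distribution_distr) (rule W)
    show "real_distribution std_normal_distribution" by (rule real_dist_normal_dist)
    fix t
    \<comment> \<open>The 2 of the linear part \<open>2 / n\<close> cancels the 2 in the
      normalisation \<open>2 * ?\<sigma>\<close>.\<close>
    let ?s = "t / ?\<sigma>"
    let ?P = "\<lambda>n. CLINT w|M. iexp (?s / sqrt (real n) * psum c1 n w)"
    have char: "char (distr M borel (?W n)) t = (CLINT w|M. iexp (t * ?W n w))" for n
      unfolding char_def by (rule integral_distr[OF W]) measurable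
    \<comment> \<open>The normalised remainder carries a factor of order sqrt n, while its first
      absolute moment is of order 1/n.\<close>
    have close: "norm ((CLINT w|M. iexp (t * ?W n w)) - ?P n)
        \<le> \<bar>t\<bar> / (2 * ?\<sigma>) * ((K + 1) / 2) / sqrt (real n)" if n: "2 \<le> n" for n
    proof -
      let ?k = "t * sqrt (real n) / (2 * ?\<sigma>)"
      have q: "sqrt (real n) * sqrt (real n) = n" "0 < sqrt (real n)" using n by auto
      have eq: "t * ?W n w - ?s / sqrt (real n) * psum c1 n w = ?k * remainder n w" for w
      proof -
        have "sqrt (real n) * (2 / n) = 2 / sqrt (real n)" using q by (simp add: field_simps)
        then have "sqrt (real n) * (2 / n * psum c1 n w + remainder n w)
            = 2 / sqrt (real n) * psum c1 n w + sqrt (real n) * remainder n w"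
          by (metis distrib_left mult.assoc)
        moreover have "U_stat \<rho> X n w - theta \<rho> F = 2 / n * psum c1 n w + remainder n w"
          using hoeffding_decomposition[OF n] by simp
        ultimately have W_eq: "t * ?W n w
            = t * (2 / sqrt (real n) * psum c1 n w + sqrt (real n) * remainder n w) / (2 * ?\<sigma>)" by simp
        have "t * (2 / b * x + b * y) / (2 * a) - t / a / b * x = t * b / (2 * a) * y"
          if "0 < a" "0 < b" for a b x y :: real
          using that by (simp add: field_simps)
        then show ?thesis unfolding W_eq using \<sigma>(1) q(2) by blast
      qed
      have iR: "integrable M (\<lambda>w. \<bar>remainder n w\<bar>)"
        by (intro integrable_abs ess_bounded_integrable ess_bounded_remainder)
      have iR2: "integrable M (\<lambda>w. (remainder n w)\<^sup>2)"
        using ess_bounded_integrable[OF ess_bounded_mult[OF ess_bounded_remainder ess_bounded_remainder]]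
        by (simp add: power2_eq_square)
      have "norm ((CLINT w|M. iexp (t * ?W n w)) - ?P n)
          \<le> expectation (\<lambda>w. \<bar>t * ?W n w - ?s / sqrt (real n) * psum c1 n w\<bar>)"
      proof (rule norm_expectation_iexp_diff_le)
        show "integrable M (\<lambda>w. \<bar>t * ?W n w - ?s / sqrt (real n) * psum c1 n w\<bar>)"
          unfolding eq abs_mult by (rule integrable_mult_right) (rule iR)
      qed (intro borel_measurable_times borel_measurable_const W psum_meas)+
      also have "\<dots> = \<bar>?k\<bar> * expectation (\<lambda>w. \<bar>remainder n w\<bar>)"
        unfolding eq abs_mult by simp
      also have "\<dots> \<le> \<bar>?k\<bar> * ((K + 1) / 2 / n)"
      proof (rule mult_left_mono)
        have "expectation (\<lambda>w. \<bar>remainder n w\<bar>) \<le> expectation (\<lambda>w. n / 2 * (remainder n w)\<^sup>2 + 1 / (2 * n))"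
        proof (intro integral_mono iR)
          fix w
          \<comment> \<open>This passes from the second to the first absolute moment; the weight
            \<open>n\<close> gives both resulting terms the order 1/n.\<close>
          have "0 \<le> (real n * \<bar>remainder n w\<bar> - 1)\<^sup>2" by simp
          then have "2 * n * \<bar>remainder n w\<bar> \<le> n * n * (remainder n w)\<^sup>2 + 1"
            by (simp add: power2_diff power_mult_distrib power2_eq_square[of "real n"])
          then show "\<bar>remainder n w\<bar> \<le> n / 2 * (remainder n w)\<^sup>2 + 1 / (2 * n)"
            using n by (simp add: field_simps)
        qed (use iR2 in auto)
        also have "\<dots> = n / 2 * expectation (\<lambda>w. (remainder n w)\<^sup>2) + 1 / (2 * n)"
          using iR2 by (simp add: prob_space)
        also have "\<dots> \<le> n / 2 * (K / (real n)\<^sup>2) + 1 / (2 * n)"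
          by (intro add_right_mono mult_left_mono K(2) n) auto
        also have "\<dots> = (K + 1) / 2 / n" using n by (simp add: field_simps power2_eq_square)
        finally show "expectation (\<lambda>w. \<bar>remainder n w\<bar>) \<le> (K + 1) / 2 / n" .
      qed simp
      also have "\<dots> = \<bar>t\<bar> / (2 * ?\<sigma>) * ((K + 1) / 2) * (sqrt (real n) / n)"
        using \<sigma>(1) by (simp add: abs_mult mult_ac)
      also have "sqrt (real n) / n = 1 / sqrt (real n)" using q by (simp add: field_simps)
      finally show ?thesis by simp
    qed
    have "(\<lambda>n. (CLINT w|M. iexp (t * ?W n w)) - ?P n) \<longlonglongrightarrow> 0"
      by (rule Lim_null_comparison[OF eventually_mono[OF eventually_ge_at_top[of 2]] tendsto_const_over_sqrt])
        (rule close)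
    moreover have "?P \<longlonglongrightarrow> complex_of_real (exp (- (?s\<^sup>2 * sigmaU_sq M X \<rho> F / 2)))"
      using D.char_psum_tendsto[of ?s] unfolding sigmaU_sq_eq .
    moreover have "?s\<^sup>2 * sigmaU_sq M X \<rho> F = t\<^sup>2"
      using \<sigma>(1) pos by (simp add: power_divide)
    ultimately have "(\<lambda>n. ((CLINT w|M. iexp (t * ?W n w)) - ?P n) + ?P n) \<longlonglongrightarrow> 0 + complex_of_real (exp (- (t\<^sup>2 / 2)))"
      by (intro tendsto_add) simp_all
    then show "(\<lambda>n. char (distr M borel (?W n)) t) \<longlonglongrightarrow> char std_normal_distribution t"
      unfolding char char_std_normal_distribution by simp
  qed
qed

end

theorem theorem2p3:
  fixes M :: "'a measure" and F :: "real measure"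
    and X X' :: "nat \<Rightarrow> 'a \<Rightarrow> real"
    and \<rho> :: "real \<Rightarrow> real \<Rightarrow> real" and C1 C2 :: real
  assumes "prob_space M"
    and "\<And>n. 1 \<le> n \<Longrightarrow> X n \<in> borel_measurable M"
    and "stationary M X"
    and "associated M X {1..}"
    and "distr M borel (X 1) = F"
    and "0 < C1" and "measure M {w \<in> space M. \<bar>X 1 w\<bar> \<le> C1} = 1"
    and "iid_copy M X F X'"
    and "(\<lambda>(x, y). \<rho> x y) \<in> borel_measurable (borel :: (real \<times> real) measure)"
    and "\<And>x y. \<rho> x y = \<rho> y x"
    and "\<And>x y. \<bar>\<rho> x y\<bar> \<le> C2"
    and "summable (\<lambda>j. covariance M (X 1) (X (Suc j)) powr (1 / 21))"
    and "cond_T1 M X X'" and "cond_T2 M X X'"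
    and "integrable M (\<lambda>w. (rho1 \<rho> F (X 1 w))\<^sup>2)"
    and "summable (\<lambda>j. \<bar>sigma1 M X \<rho> F (Suc j)\<bar>)"
  shows "(\<lambda>n. prob_space.variance M (U_stat \<rho> X n) - 4 * sigmaU_sq M X \<rho> F / real n)
           \<in> o(\<lambda>n. 1 / real n) \<and>
         (sigmaU_sq M X \<rho> F > 0 \<and>
          (\<exists>\<rho>t. mono_dominated (rho1 \<rho> F) \<rho>t \<and>
             summable (\<lambda>j. covariance M (\<lambda>w. \<rho>t (X 1 w)) (\<lambda>w. \<rho>t (X (Suc j) w)))) \<longrightarrow>
          weak_conv_m
            (\<lambda>n. distr M borel (\<lambda>w. sqrt (real n) * (U_stat \<rho> X n w - theta \<rho> F) /
                                     (2 * sqrt (sigmaU_sq M X \<rho> F))))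
            std_normal_distribution)"
proof -
  interpret prob_space M by (rule assms(1))
  have [measurable]: "X (Suc 0) \<in> borel_measurable M" using assms(2) by simp
  interpret ustat_setting M X F C1 X' \<rho> C2
  proof
    show "AE w in M. \<bar>X 1 w\<bar> \<le> C1"
      using assms(7) by (subst (asm) prob_eq_1) auto
  qed (use assms in auto)
  have sigma: "summable (\<lambda>j. sigma1 M X \<rho> F (Suc j))"
    using assms(16) by (rule summable_rabs_cancel)
  have "(\<lambda>n. variance (U_stat \<rho> X n) - 4 * sigmaU_sq M X \<rho> F / real n) \<in> o(\<lambda>n. 1 / real n)"
  proof (rule smalloI_tendsto)
    have "(\<lambda>n. real n * variance (U_stat \<rho> X n) - 4 * sigmaU_sq M X \<rho> F) \<longlonglongrightarrow> 0"
      using tendsto_diff[OF variance_U_stat_tendsto[OF sigma] tendsto_const, of "4 * sigmaU_sq M X \<rho> F"]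
      by simp
    then show "(\<lambda>n. (variance (U_stat \<rho> X n) - 4 * sigmaU_sq M X \<rho> F / real n) / (1 / real n)) \<longlonglongrightarrow> 0"
    \<comment> \<open>At \<open>n = 0\<close> the quotient is 0 by convention, so equality is
      claimed only for positive \<open>n\<close>.\<close>
    proof (rule Lim_transform_eventually)
      show "\<forall>\<^sub>F n in sequentially. real n * variance (U_stat \<rho> X n) - 4 * sigmaU_sq M X \<rho> F
          = (variance (U_stat \<rho> X n) - 4 * sigmaU_sq M X \<rho> F / real n) / (1 / real n)"
        using eventually_gt_at_top[of 0] by eventually_elim (simp add: field_simps)
    qed
    show "\<forall>\<^sub>F n in sequentially. 1 / real n \<noteq> 0"
      using eventually_gt_at_top[of 0] by eventually_elim simp
  qed
  then show ?thesis using U_stat_clt[OF sigma] by blast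
qed

end
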